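(* Let $Y$ be a clean robust heteroclinic network such that for any closed semi-linear walk $\mathcal{P}\subset Y$, $\mathcal{P}=[\xi_1\to\dots\to\xi_m\to\xi_1]$, and each $1\le j\le m$ there are constants $A_j>0$ and $\rho^*(\mathcal{P},j)>0$ such that the local map $$\phi(\mathcal{P},j):\ F_{\tilde\delta}(\xi_j,\kappa_{j-1,j})\to F_{\tilde\delta}(\xi_j,\kappa_{j,j+1})$$ satisfies $$d(\Phi(\tau^{out},x),Y)<A_j\,\big(d(\Phi(\tau^{in},x),Y)\big)^{\rho^*(\mathcal{P},j)}$$ (for all nearby trajectories that enter $N_{\tilde\delta}(\xi_j)$ through $F_{\tilde\delta}(\xi_j,\kappa_{j-1,j})$ and exit through $F_{\tilde\delta}(\xi_j,\kappa_{j,j+1})$). Suppose moreover that for any such walk $$\rho^*(\mathcal{P})>1,\qquad\text{where}\quad \rho^*(\mathcal{P})=\prod_{1\le j\le m}\rho^*(\mathcal{P},j).$$ Then $Y$ is asymptotically stable.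
   Context: Consider a smooth system $\dot x=f(x)$ in $\mathbb{R}^n$ with flow $\Phi(\tau,x)$. For a hyperbolic equilibrium $\xi$, $W^u(\xi)=\{x:\alpha(x)=\xi\}$, $W^s(\xi)=\{x:\omega(x)=\xi\}$; the connection from $\xi_i$ to $\xi_j$ is $C_{ij}=[\xi_i\to\xi_j]=W^u(\xi_i)\cap W^s(\xi_j)$, and $\kappa_{ij}$ denotes a connecting trajectory in it. A heteroclinic cycle is a union of finitely many hyperbolic equilibria $\xi_1,\dots,\xi_m$ and heteroclinic connections $C_{j,j+1}$, $1\le j\le m$, $\xi_{m+1}=\xi_1$. A heteroclinic network is a connected union of finitely many heteroclinic cycles; it is robust if each connection $C_{ij}$ belongs to a flow-invariant subspace $S_{ij}$ in which it is of saddle-sink type. The networks considered consist of finitely many hyperbolic equilibria and heteroclinic connections. A compact invariant set $Y$ is clean if each invariant subset $X\subseteq Y$ satisfies $W^u(X)\subseteq Y$. A walk $[\zeta_1\to\dots\to\zeta_M]$ in $Y$ is a sequence of equilibria $\zeta_1,\dots,\zeta_M$ of $Y$ (repetitions allowed) together with connections $[\zeta_s\to\zeta_{s+1}]\subset Y$, $1\le s\le M-1$. It is semi-linear if it does not have repeating triplets, i.e. there are no $s\ne d$ with $(\zeta_{s-1},\zeta_s,\zeta_{s+1})=(\zeta_{d-1},\zeta_d,\zeta_{d+1})$. In a closed walk $[\xi_1\to\dots\to\xi_m\to\xi_1]$ the indices of $\xi_j$, $\kappa_{j-1,j}$, $\kappa_{j,j+1}$ are understood cyclically ($\xi_0=\xi_m$,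 $\xi_{m+1}=\xi_1$). $d(x,Y)$ is the distance from $x$ to $Y$ (maximum norm). For a fixed small $\tilde\delta>0$, $N_{\tilde\delta}(\xi_j)$ is the neighbourhood of $\xi_j$ bounded by the faces $|y_s|=\tilde\delta$, where $y_s$ are the coordinates centred at $\xi_j$ in a basis of eigenvectors of $\mathrm{d}f(\xi_j)$; these neighbourhoods are disjoint. $F_{\tilde\delta}(\xi_j,\kappa_{j-1,j})$ and $F_{\tilde\delta}(\xi_j,\kappa_{j,j+1})$ are the unions of the faces of $\partial N_{\tilde\delta}(\xi_j)$ that intersect the connections $[\xi_{j-1}\to\xi_j]$ and $[\xi_j\to\xi_{j+1}]$, respectively. $\tau^{in}$ and $\tau^{out}$ are the times at which the trajectory $\Phi(\tau,x)$ enters and exits $N_{\tilde\delta}(\xi_j)$; the local map sends the entry point to the exit point. "Nearby trajectories" are those in a $\delta$-neighbourhood of $Y$, for some sufficiently small $\delta\ll\tilde\delta$, which are not contained in $Y$. A set $Y$ is Lyapunov stable if for any neighbourhood $U$ of $Y$ there is a neighbourhood $V$ of $Y$ such that $\Phi(\tau,x)\in U$ for all $x\in V$, $\tau>0$. It is asymptotically stable if it is Lyapunov stable and in addition $V$ can be chosen such that $\lim_{\tau\to\infty}d(\Phi(\tau,x),Y)=0$ for all $x\in V$. *)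

theory Defs
  imports "HOL-Analysis.Analysis"
begin

section \<open>Smooth systems and their flows\<close>

primrec times_cont_diff :: "nat \<Rightarrow> (real^'n \<Rightarrow> real^'n) \<Rightarrow> bool" where
  "times_cont_diff 0 f \<longleftrightarrow> continuous_on UNIV f"
| "times_cont_diff (Suc k) f \<longleftrightarrow>
     f differentiable_on UNIV \<and> (\<forall>v. times_cont_diff k (\<lambda>x. frechet_derivative f (at x) v))"

definition smooth :: "(real^'n \<Rightarrow> real^'n) \<Rightarrow> bool" where
  "smooth f \<longleftrightarrow> (\<forall>k. times_cont_diff k f)"

definition flow_of :: "(real^'n \<Rightarrow> real^'n) \<Rightarrow> (real \<Rightarrow> real^'n \<Rightarrow> real^'n) \<Rightarrow> bool" where
  "flow_of f \<Phi> \<longleftrightarrow>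
     (\<forall>x. \<Phi> 0 x = x \<and> (\<forall>\<tau>. ((\<lambda>t. \<Phi> t x) has_vector_derivative f (\<Phi> \<tau> x)) (at \<tau>)))"

definition invariant :: "(real \<Rightarrow> real^'n \<Rightarrow> real^'n) \<Rightarrow> (real^'n) set \<Rightarrow> bool" where
  "invariant \<Phi> X \<longleftrightarrow> (\<forall>x\<in>X. \<forall>\<tau>. \<Phi> \<tau> x \<in> X)"

definition omega_limit :: "(real \<Rightarrow> real^'n \<Rightarrow> real^'n) \<Rightarrow> real^'n \<Rightarrow> (real^'n) set" where
  "omega_limit \<Phi> x =
     {y. \<exists>t::nat \<Rightarrow> real. filterlim t at_top sequentially \<and> (\<lambda>k. \<Phi> (t k) x) \<longlonglongrightarrow> y}"

definition alpha_limit :: "(real \<Rightarrow> real^'n \<Rightarrow> real^'n) \<Rightarrow> real^'n \<Rightarrow> (real^'n) set" where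
  "alpha_limit \<Phi> x =
     {y. \<exists>t::nat \<Rightarrow> real. filterlim t at_bot sequentially \<and> (\<lambda>k. \<Phi> (t k) x) \<longlonglongrightarrow> y}"

text \<open>The invariant manifolds are defined for arbitrary sets \<open>X\<close>; for \<open>X = {\<xi>}\<close> the conditions read
  \<open>alpha_limit \<Phi> x = {\<xi>}\<close> and \<open>omega_limit \<Phi> x = {\<xi>}\<close>. Nonemptiness excludes trajectories
  that escape to infinity, whose limit sets may be empty.\<close>

definition unstable_set :: "(real \<Rightarrow> real^'n \<Rightarrow> real^'n) \<Rightarrow> (real^'n) set \<Rightarrow> (real^'n) set" where
  "unstable_set \<Phi> X = {x. alpha_limit \<Phi> x \<noteq> {} \<and> alpha_limit \<Phi> x \<subseteq> X}"

definition stable_set :: "(real \<Rightarrow> real^'n \<Rightarrow> real^'n) \<Rightarrow> (real^'n) set \<Rightarrow> (real^'n) set" where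
  "stable_set \<Phi> X = {x. omega_limit \<Phi> x \<noteq> {} \<and> omega_limit \<Phi> x \<subseteq> X}"

definition clean :: "(real \<Rightarrow> real^'n \<Rightarrow> real^'n) \<Rightarrow> (real^'n) set \<Rightarrow> bool" where
  "clean \<Phi> Y \<longleftrightarrow> compact Y \<and> invariant \<Phi> Y \<and>
     (\<forall>X. X \<subseteq> Y \<and> invariant \<Phi> X \<longrightarrow> unstable_set \<Phi> X \<subseteq> Y)"


section \<open>Equilibria\<close>

definition equilibrium :: "(real^'n \<Rightarrow> real^'n) \<Rightarrow> real^'n \<Rightarrow> bool" where
  "equilibrium f \<xi> \<longleftrightarrow> f \<xi> = 0"

definition cjacobian :: "(real^'n \<Rightarrow> real^'n) \<Rightarrow> real^'n \<Rightarrow> complex^'n^'n" where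
  "cjacobian f \<xi> = map_matrix complex_of_real (jacobian f (at \<xi>))"

text \<open>Complex eigenvalues of the restriction of the derivative at \<open>\<xi>\<close> to an invariant linear
  subspace \<open>S\<close>: the eigenvector is to lie in the complexification of \<open>S\<close>.\<close>

definition eigenvalues_on :: "(real^'n \<Rightarrow> real^'n) \<Rightarrow> real^'n \<Rightarrow> (real^'n) set \<Rightarrow> complex set" where
  "eigenvalues_on f \<xi> S = {l. \<exists>v. v \<noteq> 0 \<and> (\<chi> i. Re (v $ i)) \<in> S \<and> (\<chi> i. Im (v $ i)) \<in> S \<and>
     cjacobian f \<xi> *v v = l *s v}"

definition hyperbolic :: "(real^'n \<Rightarrow> real^'n) \<Rightarrow> real^'n \<Rightarrow> bool" where
  "hyperbolic f \<xi> \<longleftrightarrow> equilibrium f \<xi> \<and> (\<forall>l\<in>eigenvalues_on f \<xi> UNIV. Re l \<noteq> 0)"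

definition sink_in :: "(real^'n \<Rightarrow> real^'n) \<Rightarrow> (real^'n) set \<Rightarrow> real^'n \<Rightarrow> bool" where
  "sink_in f S \<xi> \<longleftrightarrow> equilibrium f \<xi> \<and> \<xi> \<in> S \<and> (\<forall>l\<in>eigenvalues_on f \<xi> S. Re l < 0)"

definition saddle_in :: "(real^'n \<Rightarrow> real^'n) \<Rightarrow> (real^'n) set \<Rightarrow> real^'n \<Rightarrow> bool" where
  "saddle_in f S \<xi> \<longleftrightarrow> equilibrium f \<xi> \<and> \<xi> \<in> S \<and> (\<forall>l\<in>eigenvalues_on f \<xi> S. Re l \<noteq> 0) \<and>
     (\<exists>l\<in>eigenvalues_on f \<xi> S. Re l > 0) \<and> (\<exists>l\<in>eigenvalues_on f \<xi> S. Re l < 0)"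


section \<open>Heteroclinic cycles, networks and walks\<close>

definition connection :: "(real \<Rightarrow> real^'n \<Rightarrow> real^'n) \<Rightarrow> real^'n \<Rightarrow> real^'n \<Rightarrow> (real^'n) set" where
  "connection \<Phi> \<xi> \<zeta> = unstable_set \<Phi> {\<xi>} \<inter> stable_set \<Phi> {\<zeta>}"

text \<open>The end points are removed because \<open>connection \<Phi> \<xi> \<xi>\<close> always contains the equilibrium \<open>\<xi>\<close>;
  for \<open>\<xi> \<noteq> \<zeta>\<close> the condition is just \<open>connection \<Phi> \<xi> \<zeta> \<noteq> {}\<close>.\<close>

definition connected_to :: "(real \<Rightarrow> real^'n \<Rightarrow> real^'n) \<Rightarrow> real^'n \<Rightarrow> real^'n \<Rightarrow> bool" where
  "connected_to \<Phi> \<xi> \<zeta> \<longleftrightarrow> connection \<Phi> \<xi> \<zeta> - {\<xi>, \<zeta>} \<noteq> {}"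

text \<open>Closed walks and cycles are given by the list of their equilibria, without repeating the first
  one at the end; indices start at \<open>0\<close> and are taken modulo the length.\<close>

definition cyc_nth :: "'a list \<Rightarrow> nat \<Rightarrow> 'a" where
  "cyc_nth P j = P ! (j mod length P)"

definition heteroclinic_cycle ::
  "(real^'n \<Rightarrow> real^'n) \<Rightarrow> (real \<Rightarrow> real^'n \<Rightarrow> real^'n) \<Rightarrow> (real^'n) set \<Rightarrow> bool" where
  "heteroclinic_cycle f \<Phi> X \<longleftrightarrow> (\<exists>P. P \<noteq> [] \<and> (\<forall>\<xi>\<in>set P. hyperbolic f \<xi>) \<and>
     (\<forall>j<length P. connected_to \<Phi> (P ! j) (cyc_nth P (j + 1))) \<and>
     X = set P \<union> (\<Union>j<length P. connection \<Phi> (P ! j) (cyc_nth P (j + 1))))"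

definition heteroclinic_network ::
  "(real^'n \<Rightarrow> real^'n) \<Rightarrow> (real \<Rightarrow> real^'n \<Rightarrow> real^'n) \<Rightarrow> (real^'n) set \<Rightarrow> bool" where
  "heteroclinic_network f \<Phi> Y \<longleftrightarrow> connected Y \<and>
     (\<exists>\<C>. finite \<C> \<and> \<C> \<noteq> {} \<and> (\<forall>X\<in>\<C>. heteroclinic_cycle f \<Phi> X) \<and> Y = \<Union>\<C>)"

definition connection_in ::
  "(real^'n \<Rightarrow> real^'n) \<Rightarrow> (real \<Rightarrow> real^'n \<Rightarrow> real^'n) \<Rightarrow> (real^'n) set \<Rightarrow> real^'n \<Rightarrow> real^'n \<Rightarrow> bool" where
  "connection_in f \<Phi> Y \<xi> \<zeta> \<longleftrightarrow> \<xi> \<in> Y \<and> \<zeta> \<in> Y \<and> equilibrium f \<xi> \<and> equilibrium f \<zeta> \<and>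
     connected_to \<Phi> \<xi> \<zeta> \<and> connection \<Phi> \<xi> \<zeta> \<subseteq> Y"

definition robust ::
  "(real^'n \<Rightarrow> real^'n) \<Rightarrow> (real \<Rightarrow> real^'n \<Rightarrow> real^'n) \<Rightarrow> (real^'n) set \<Rightarrow> bool" where
  "robust f \<Phi> Y \<longleftrightarrow> (\<forall>\<xi> \<zeta>. connection_in f \<Phi> Y \<xi> \<zeta> \<longrightarrow>
     (\<exists>S. subspace S \<and> invariant \<Phi> S \<and> connection \<Phi> \<xi> \<zeta> \<subseteq> S \<and> saddle_in f S \<xi> \<and> sink_in f S \<zeta>))"

definition closed_walk ::
  "(real^'n \<Rightarrow> real^'n) \<Rightarrow> (real \<Rightarrow> real^'n \<Rightarrow> real^'n) \<Rightarrow> (real^'n) set \<Rightarrow> (real^'n) list \<Rightarrow> bool" where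
  "closed_walk f \<Phi> Y P \<longleftrightarrow> P \<noteq> [] \<and>
     (\<forall>j<length P. connection_in f \<Phi> Y (P ! j) (cyc_nth P (j + 1)))"

text \<open>The predecessor of index \<open>j\<close> is written \<open>j + length P - 1\<close> to avoid truncated subtraction.\<close>

definition semi_linear :: "'a list \<Rightarrow> bool" where
  "semi_linear P \<longleftrightarrow>
     inj_on (\<lambda>j. (cyc_nth P (j + length P - 1), P ! j, cyc_nth P (j + 1))) {..<length P}"


section \<open>Boxes around equilibria and local maps\<close>

definition maxdist :: "real^'n \<Rightarrow> (real^'n) set \<Rightarrow> real" where
  "maxdist x Y = (INF y\<in>Y. infnorm (x - y))"

text \<open>The columns of the matrix \<open>E\<close> are the basis of eigenvectors. To cover non-real eigenvalues the
  basis lives in \<open>\<complex>\<^sup>n\<close> and is closed under conjugation, so that a point of \<open>\<real>\<^sup>n\<close> has conjugate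
  coordinates along conjugate eigenvectors and real coordinates along real ones.\<close>

definition eigenbasis :: "(real^'n \<Rightarrow> real^'n) \<Rightarrow> real^'n \<Rightarrow> complex^'n^'n \<Rightarrow> bool" where
  "eigenbasis f \<xi> E \<longleftrightarrow> invertible E \<and>
     (\<forall>s. \<exists>l. cjacobian f \<xi> *v column s E = l *s column s E) \<and>
     (\<forall>s. \<exists>r. column r E = (\<chi> i. cnj (column s E $ i)))"

definition eigencoords :: "complex^'n^'n \<Rightarrow> real^'n \<Rightarrow> real^'n \<Rightarrow> complex^'n" where
  "eigencoords E \<xi> x = matrix_inv E *v (\<chi> i. complex_of_real ((x - \<xi>) $ i))"

definition box_nbhd :: "complex^'n^'n \<Rightarrow> real^'n \<Rightarrow> real \<Rightarrow> (real^'n) set" where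
  "box_nbhd E \<xi> r = {x. \<forall>s. cmod (eigencoords E \<xi> x $ s) < r}"

text \<open>Along a real eigenvector the boundary part \<open>|y\<^sub>s| = r\<close> has two components, the opposite
  faces \<open>y\<^sub>s = r\<close> and \<open>y\<^sub>s = -r\<close> of the box; along a complex one it is a single face.\<close>

definition faces :: "complex^'n^'n \<Rightarrow> real^'n \<Rightarrow> real \<Rightarrow> (real^'n) set set" where
  "faces E \<xi> r = (\<Union>s. components
     {x. cmod (eigencoords E \<xi> x $ s) = r \<and> (\<forall>q. cmod (eigencoords E \<xi> x $ q) \<le> r)})"

definition faces_meeting ::
  "complex^'n^'n \<Rightarrow> real^'n \<Rightarrow> real \<Rightarrow> (real^'n) set \<Rightarrow> (real^'n) set" where
  "faces_meeting E \<xi> r C = \<Union>{F \<in> faces E \<xi> r. F \<inter> C \<noteq> {}}"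

text \<open>The bound on the local map at the \<open>j\<close>-th equilibrium of the closed walk \<open>P\<close>, with boxes of size
  \<open>r\<close> and eigenvector bases \<open>E\<close>. Nearby trajectories are those
  outside \<open>Y\<close> that stay in the \<open>\<delta>\<close>-neighbourhood of \<open>Y\<close> during their passage through the box.
  Requiring this for all times would make the condition vacuous at an unstable \<open>Y\<close>.\<close>

definition local_map_bound ::
  "(real \<Rightarrow> real^'n \<Rightarrow> real^'n) \<Rightarrow> (real^'n \<Rightarrow> complex^'n^'n) \<Rightarrow> real \<Rightarrow> (real^'n) set \<Rightarrow>
   (real^'n) list \<Rightarrow> nat \<Rightarrow> real \<Rightarrow> real \<Rightarrow> bool" where
  "local_map_bound \<Phi> E r Y P j A \<rho> \<longleftrightarrow>
     (let \<xi>prev = cyc_nth P (j + length P - 1); \<xi> = P ! j; \<xi>next = cyc_nth P (j + 1);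
          F_in = faces_meeting (E \<xi>) \<xi> r (connection \<Phi> \<xi>prev \<xi>);
          F_out = faces_meeting (E \<xi>) \<xi> r (connection \<Phi> \<xi> \<xi>next)
      in \<exists>\<delta>>0. \<forall>x \<tau>in \<tau>out.
           x \<notin> Y \<and> \<tau>in < \<tau>out \<and> \<Phi> \<tau>in x \<in> F_in \<and> \<Phi> \<tau>out x \<in> F_out \<and>
           (\<forall>\<tau>\<in>{\<tau>in<..<\<tau>out}. \<Phi> \<tau> x \<in> box_nbhd (E \<xi>) \<xi> r) \<and>
           (\<forall>\<tau>\<in>{\<tau>in..\<tau>out}. maxdist (\<Phi> \<tau> x) Y < \<delta>) \<longrightarrow>
           maxdist (\<Phi> \<tau>out x) Y < A * maxdist (\<Phi> \<tau>in x) Y powr \<rho>)"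


section \<open>Stability\<close>

definition lyapunov_stable :: "(real \<Rightarrow> real^'n \<Rightarrow> real^'n) \<Rightarrow> (real^'n) set \<Rightarrow> bool" where
  "lyapunov_stable \<Phi> Y \<longleftrightarrow> (\<forall>U. open U \<and> Y \<subseteq> U \<longrightarrow>
     (\<exists>V. open V \<and> Y \<subseteq> V \<and> (\<forall>x\<in>V. \<forall>\<tau>>0. \<Phi> \<tau> x \<in> U)))"

definition asymptotically_stable :: "(real \<Rightarrow> real^'n \<Rightarrow> real^'n) \<Rightarrow> (real^'n) set \<Rightarrow> bool" where
  "asymptotically_stable \<Phi> Y \<longleftrightarrow> lyapunov_stable \<Phi> Y \<and>
     (\<exists>V. open V \<and> Y \<subseteq> V \<and> (\<forall>x\<in>V. ((\<lambda>\<tau>. maxdist (\<Phi> \<tau> x) Y) \<longlongrightarrow> 0) at_top))"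

end

theory Submission
  imports Defs "HOL-Library.Transitive_Closure_Table"
begin

text \<open>Let \<open>d\<close> be the distance to \<open>Y\<close>. A trajectory near \<open>Y\<close> spends long times in the boxes around the
  equilibria and short times between them. If it visits \<open>a\<close>, \<open>c\<close>, \<open>b\<close> in this order along
  connections, the local map at \<open>c\<close> multiplies \<open>\<bar>ln d\<bar>\<close> by the exponent of the triple \<open>(a, c, b)\<close>, up to
  an additive constant, and the bounded time outside the boxes only costs another additive constant.
  The bound at a triple does not depend on the closed walk it is taken from, so the largest
  exponent offered by the finitely many closed walks without repeated edges can be used. Then the product
  of the exponents around each of these walks exceeds \<open>1\<close>, and there is a potential \<open>\<pi>\<close> on the edges such
  that \<open>\<bar>ln d\<bar> exp (- \<pi>)\<close>, read off when a box is entered along an edge, grows by a factor \<open>\<kappa> > 1\<close> from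
  one box to the next as soon as it is large (lemmas \<open>weighted_potential\<close> and \<open>progress\<close>). So a
  trajectory that starts close to \<open>Y\<close> stays close and tends to \<open>Y\<close>.

  The delicate point is to attach a walk to a trajectory. A connection may be of higher dimension,
  with trajectories that pass other equilibria arbitrarily closely, so the boxes visited for longer than a given time
  need not be consecutive along connections, whatever this time is. What holds, by
  compactness, is the following: if a trajectory leaves the box of \<open>c\<close> after a long stay, and within
  time \<open>S\<close> it enters the box of \<open>e\<close> for a long stay, where long means at least \<open>h S\<close>, then it leaves and
  enters through faces that meet the connection from \<open>c\<close> to \<open>e\<close> (lemma \<open>matching\<close>). Each point of \<open>Y\<close> comes
  from one equilibrium and goes to another, so each point near \<open>Y\<close> outside the boxes lies in such a gap, of length
  at most a fixed \<open>S\<close> (lemma \<open>covering\<close>). The threshold \<open>h S\<close> exceeds \<open>S\<close>, so two gaps cannot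
  overlap without being nested, and the maximal gaps follow each other and spell out a walk (lemma \<open>itinerary_exists\<close>).
  Cleanness enters through the unstable manifolds of the equilibria: they lie in \<open>Y\<close>, which also keeps
  a trajectory close to \<open>Y\<close> during an arbitrarily long stay in a box (lemma \<open>stay_close\<close>).\<close>

section \<open>Solutions of the differential equation\<close>
definition solves :: "(real^'n \<Rightarrow> real^'n) \<Rightarrow> (real \<Rightarrow> real^'n) \<Rightarrow> bool" where
  "solves f u \<longleftrightarrow> (\<forall>t. (u has_vector_derivative f (u t)) (at t))"

lemma solves_shift: "solves f u \<Longrightarrow> solves f (\<lambda>t. u (s + t))"
  unfolding solves_def
proof
  fix t assume u: "\<forall>t. (u has_vector_derivative f (u t)) (at t)"
  have "((\<lambda>t. s + t) has_vector_derivative 1) (at t)"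
    by (auto intro!: derivative_eq_intros)
  from vector_diff_chain_at[OF this] u
  show "((\<lambda>t. u (s + t)) has_vector_derivative f (u (s + t))) (at t)"
    by (fastforce simp: o_def)
qed

lemma solves_reverse: "solves f u \<Longrightarrow> solves (\<lambda>x. - f x) (\<lambda>t. u (- t))"
  unfolding solves_def
proof
  fix t assume u: "\<forall>t. (u has_vector_derivative f (u t)) (at t)"
  have "((\<lambda>t::real. - t) has_vector_derivative (-1)) (at t)"
    by (auto intro!: derivative_eq_intros)
  from vector_diff_chain_at[OF this] u
  show "((\<lambda>t. u (- t)) has_vector_derivative - f (u (- t))) (at t)"
    by (fastforce simp: o_def)
qed

lemma solves_continuous: "solves f u \<Longrightarrow> continuous_on S u"
  unfolding solves_def
  by (meson continuous_at_imp_continuous_on has_vector_derivative_continuous)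

lemma solves_const: "f c = 0 \<Longrightarrow> solves f (\<lambda>_. c)"
  by (simp add: solves_def)

lemma flow_solves: "flow_of f \<Phi> \<Longrightarrow> solves f (\<lambda>t. \<Phi> t x)"
  by (simp add: flow_of_def solves_def)

lemma flow_zero: "flow_of f \<Phi> \<Longrightarrow> \<Phi> 0 x = x"
  by (simp add: flow_of_def)

text \<open>Differentiating \<open>|u - v|\<^sup>2 exp (- 2 L t)\<close> shows that it does not increase.\<close>
lemma gronwall_forward:
  fixes f :: "real^'n \<Rightarrow> real^'n"
  assumes u: "solves f u" and v: "solves f v" and T: "0 \<le> T"
    and uB: "\<And>t. 0 \<le> t \<Longrightarrow> t \<le> T \<Longrightarrow> u t \<in> B" and vB: "\<And>t. 0 \<le> t \<Longrightarrow> t \<le> T \<Longrightarrow> v t \<in> B"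
    and L: "\<And>x y. x \<in> B \<Longrightarrow> y \<in> B \<Longrightarrow> norm (f x - f y) \<le> L * norm (x - y)"
  shows "norm (u T - v T) \<le> norm (u 0 - v 0) * exp (L * T)"
proof -
  define w where "w t = (u t - v t) \<bullet> (u t - v t) * exp (- 2 * L * t)" for t
  have dw: "(w has_real_derivative
      (2 * ((u t - v t) \<bullet> (f (u t) - f (v t))) - 2 * L * ((u t - v t) \<bullet> (u t - v t))) * exp (- 2 * L * t)) (at t)" for t
  proof -
    have 1: "((\<lambda>t. u t - v t) has_vector_derivative (f (u t) - f (v t))) (at t)"
      using u v by (auto simp: solves_def intro!: derivative_intros)
    have "((\<lambda>t. (u t - v t) \<bullet> (u t - v t)) has_derivative
       (\<lambda>h. (u t - v t) \<bullet> (h *\<^sub>R (f (u t) - f (v t))) + (h *\<^sub>R (f (u t) - f (v t))) \<bullet> (u t - v t))) (at t)"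
      using has_derivative_inner[OF 1[unfolded has_vector_derivative_def] 1[unfolded has_vector_derivative_def]] .
    then have "((\<lambda>t. (u t - v t) \<bullet> (u t - v t)) has_real_derivative
        2 * ((u t - v t) \<bullet> (f (u t) - f (v t)))) (at t)"
      unfolding has_field_derivative_def
      by (rule has_derivative_eq_rhs) (auto simp: inner_commute algebra_simps)
    moreover have "((\<lambda>t. exp (- 2 * L * t)) has_real_derivative - 2 * L * exp (- 2 * L * t)) (at t)"
      by (auto intro!: derivative_eq_intros)
    ultimately show ?thesis unfolding w_def
      by (rule DERIV_mult[THEN DERIV_cong]) (simp add: algebra_simps)
  qed
  have "w T \<le> w 0"
  proof (rule DERIV_nonpos_imp_nonincreasing[OF T])
    fix t assume t: "0 \<le> t" "t \<le> T"
    have "(u t - v t) \<bullet> (f (u t) - f (v t)) \<le> norm (u t - v t) * norm (f (u t) - f (v t))"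
      by (rule norm_cauchy_schwarz)
    also have "\<dots> \<le> norm (u t - v t) * (L * norm (u t - v t))"
      by (intro mult_left_mono L uB vB t) auto
    also have "\<dots> = L * ((u t - v t) \<bullet> (u t - v t))"
      by (simp add: power2_norm_eq_inner[symmetric] power2_eq_square)
    finally have "(2 * ((u t - v t) \<bullet> (f (u t) - f (v t))) - 2 * L * ((u t - v t) \<bullet> (u t - v t))) * exp (- 2 * L * t) \<le> 0"
      by (simp add: mult_nonpos_nonneg)
    with dw show "\<exists>y. (w has_real_derivative y) (at t) \<and> y \<le> 0" by blast
  qed
  then have "(norm (u T - v T))\<^sup>2 * exp (- 2 * L * T) \<le> (norm (u 0 - v 0))\<^sup>2"
    by (simp add: w_def power2_norm_eq_inner)
  then have "(norm (u T - v T))\<^sup>2 \<le> (norm (u 0 - v 0))\<^sup>2 * exp (2 * L * T)"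
    by (simp add: exp_minus field_simps)
  also have "\<dots> = (norm (u 0 - v 0) * exp (L * T))\<^sup>2"
    by (simp add: power_mult_distrib exp_double[symmetric] mult.assoc)
  finally show ?thesis
    by (rule power2_le_imp_le) simp
qed

text \<open>Only a bound on the initial distance is assumed, so the Lipschitz estimate on the
  \<open>1\<close>-neighbourhood of \<open>v\<close> must first be justified: up to the first time at which the distance is \<open>1\<close>,
  Gronwall's inequality keeps it strictly below \<open>1\<close>, so there is no such time.\<close>
lemma shadowing_forward:
  fixes f :: "real^'n \<Rightarrow> real^'n"
  assumes u: "solves f u" and v: "solves f v"
    and B: "\<And>t x. 0 \<le> t \<Longrightarrow> t \<le> S \<Longrightarrow> norm (x - v t) \<le> 1 \<Longrightarrow> x \<in> B"
    and L: "\<And>x y. x \<in> B \<Longrightarrow> y \<in> B \<Longrightarrow> norm (f x - f y) \<le> L * norm (x - y)" and L0: "0 \<le> L"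
    and close: "norm (u 0 - v 0) * exp (L * S) < 1" and T: "0 \<le> T" "T \<le> S"
  shows "norm (u T - v T) \<le> norm (u 0 - v 0) * exp (L * T)"
proof -
  have est: "norm (u t - v t) \<le> norm (u 0 - v 0) * exp (L * t)"
    if t: "0 \<le> t" "t \<le> S" and le1: "\<And>s. 0 \<le> s \<Longrightarrow> s \<le> t \<Longrightarrow> norm (u s - v s) \<le> 1" for t
  proof (rule gronwall_forward[OF u v t(1) _ _ L])
    fix s assume "0 \<le> s" "s \<le> t"
    then show "u s \<in> B" "v s \<in> B" using B[of s "u s"] B[of s "v s"] le1[of s] t by auto
  qed
  have mono: "norm (u 0 - v 0) * exp (L * t) < 1" if "t \<le> S" for t
  proof -
    have "norm (u 0 - v 0) * exp (L * t) \<le> norm (u 0 - v 0) * exp (L * S)"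
      using that L0 by (intro mult_left_mono) (auto intro: mult_left_mono)
    then show ?thesis using close by simp
  qed
  have "norm (u t - v t) < 1" if "0 \<le> t" "t \<le> S" for t
  proof (rule ccontr)
    assume neg: "\<not> norm (u t - v t) < 1"
    define g where "g s = norm (u s - v s)" for s
    have cont: "continuous_on A g" for A unfolding g_def
      by (intro continuous_intros solves_continuous[OF u] solves_continuous[OF v])
    \<comment> \<open>\<open>Inf Z\<close> is the first time at which the distance is \<open>1\<close>.\<close>
    define Z where "Z = {s \<in> {0..t}. 1 \<le> g s}"
    have "closed Z" unfolding Z_def
      by (intro continuous_on_closed_Collect_le cont) auto
    moreover have "t \<in> Z" using neg that by (auto simp: Z_def g_def)
    moreover have "bdd_below Z" by (auto simp: Z_def)
    ultimately have "Inf Z \<in> Z" by (intro closed_contains_Inf) auto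
    then have Z: "0 \<le> Inf Z" "Inf Z \<le> t" "1 \<le> g (Inf Z)" by (auto simp: Z_def)
    have bef: "g s < 1" if "0 \<le> s" "s < Inf Z" for s
    proof (rule ccontr)
      assume "\<not> g s < 1"
      then have "s \<in> Z" using that Z by (auto simp: Z_def)
      then have "Inf Z \<le> s" using \<open>bdd_below Z\<close> by (rule cInf_lower)
      then show False using that by simp
    qed
    have g0: "g 0 < 1" using mono[of 0] that unfolding g_def by simp
    have "Inf Z \<noteq> 0" using Z g0 by auto
    have "g (Inf Z) \<le> 1"
    proof (rule ccontr)
      assume "\<not> g (Inf Z) \<le> 1"
      have "\<exists>s. 0 \<le> s \<and> s \<le> Inf Z \<and> g s = 1"
        using Z g0 \<open>\<not> g (Inf Z) \<le> 1\<close> by (intro IVT' cont) auto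
      then show False using bef \<open>\<not> g (Inf Z) \<le> 1\<close> by (metis less_eq_real_def order_less_irrefl)
    qed
    then have "g s \<le> 1" if "0 \<le> s" "s \<le> Inf Z" for s
      using bef[of s] that by (cases "s = Inf Z") auto
    then have "g (Inf Z) \<le> norm (u 0 - v 0) * exp (L * Inf Z)"
      using est[of "Inf Z"] Z \<open>t \<le> S\<close> unfolding g_def by simp
    then show False using mono[of "Inf Z"] Z \<open>t \<le> S\<close> by simp
  qed
  then show ?thesis using T by (intro est) (auto intro: less_imp_le)
qed

lemma shadowing:
  fixes f :: "real^'n \<Rightarrow> real^'n"
  assumes u: "solves f u" and v: "solves f v"
    and B: "\<And>t x. \<bar>t\<bar> \<le> S \<Longrightarrow> norm (x - v t) \<le> 1 \<Longrightarrow> x \<in> B"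
    and L: "\<And>x y. x \<in> B \<Longrightarrow> y \<in> B \<Longrightarrow> norm (f x - f y) \<le> L * norm (x - y)" and L0: "0 \<le> L"
    and close: "norm (u 0 - v 0) * exp (L * S) < 1" and T: "\<bar>T\<bar> \<le> S"
  shows "norm (u T - v T) \<le> norm (u 0 - v 0) * exp (L * \<bar>T\<bar>)"
proof (cases "0 \<le> T")
  case True
  have "norm (u T - v T) \<le> norm (u 0 - v 0) * exp (L * T)"
  proof (rule shadowing_forward[OF u v _ L L0 close])
    show "x \<in> B" if "0 \<le> t" "t \<le> S" "norm (x - v t) \<le> 1" for t x
      using B[of t x] that by simp
  qed (use True T in auto)
  then show ?thesis using True by simp
next
  case False
  have L': "norm (- f x - - f y) \<le> L * norm (x - y)" if "x \<in> B" "y \<in> B" for x y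
    using L[OF that] by (simp add: norm_minus_commute)
  have B': "x \<in> B" if "0 \<le> t" "t \<le> S" "norm (x - v (- t)) \<le> 1" for t x
    using B[of "- t" x] that by simp
  have "norm (u (- (- T)) - v (- (- T))) \<le> norm (u (- 0) - v (- 0)) * exp (L * - T)"
    by (rule shadowing_forward[OF solves_reverse[OF u] solves_reverse[OF v] B' L' L0])
      (use close False T in auto)
  then show ?thesis using False by simp
qed

lemma smooth_lipschitz_on_ball:
  fixes f :: "real^'n \<Rightarrow> real^'n"
  assumes "smooth f"
  obtains L where "0 \<le> L" "\<And>x y. norm x \<le> R \<Longrightarrow> norm y \<le> R \<Longrightarrow> norm (f x - f y) \<le> L * norm (x - y)"
proof -
  define D where "D x = frechet_derivative f (at x)" for x
  have "times_cont_diff (Suc 0) f" using assms unfolding smooth_def by blast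
  then have diff: "\<And>x. f differentiable (at x)" and cont: "\<And>v. continuous_on UNIV (\<lambda>x. D x v)"
    by (auto simp: differentiable_on_def D_def)
  have der: "(f has_derivative D x) (at x)" for x
    using diff frechet_derivative_works unfolding D_def by blast
  have lin: "linear (D x)" for x using der by (rule has_derivative_linear)
  have "\<exists>K. \<forall>x\<in>cball 0 R. norm (D x b) \<le> K" for b
  proof -
    have "compact ((\<lambda>x. D x b) ` cball 0 R)"
      by (intro compact_continuous_image continuous_on_subset[OF cont]) auto
    then show ?thesis by (metis bounded_iff compact_imp_bounded image_eqI)
  qed
  then obtain K where K: "\<And>b x. x \<in> cball 0 R \<Longrightarrow> norm (D x b) \<le> K b" by metis
  define L where "L = (\<Sum>b\<in>Basis. \<bar>K b\<bar>)"
  have bound: "norm (D x h) \<le> L * norm h" if "x \<in> cball 0 R" for x h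
  proof -
    have "D x h = D x (\<Sum>b\<in>Basis. (h \<bullet> b) *\<^sub>R b)" by (simp add: euclidean_representation)
    also have "\<dots> = (\<Sum>b\<in>Basis. (h \<bullet> b) *\<^sub>R D x b)"
      using lin by (simp add: linear_sum linear_cmul)
    also have "norm \<dots> \<le> (\<Sum>b\<in>Basis. \<bar>h \<bullet> b\<bar> * norm (D x b))"
      by (rule order_trans[OF norm_sum]) simp
    also have "\<dots> \<le> (\<Sum>b\<in>Basis. norm h * \<bar>K b\<bar>)"
      using K[OF that] by (intro sum_mono mult_mono) (auto simp: Basis_le_norm intro: order_trans[OF _ abs_ge_self])
    finally show ?thesis by (simp add: L_def sum_distrib_left mult.commute)
  qed
  have "norm (f x - f y) \<le> L * norm (x - y)" if "norm x \<le> R" "norm y \<le> R" for x y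
  proof (rule differentiable_bound[of "cball 0 R"])
    show "(f has_derivative D x) (at x within cball 0 R)" for x
      using der by (rule has_derivative_at_withinI)
    show "onorm (D x) \<le> L" if "x \<in> cball 0 R" for x
      using bound[OF that] by (rule onorm_le)
  qed (use that in auto)
  moreover have "0 \<le> L" by (simp add: L_def sum_nonneg)
  ultimately show ?thesis using that by blast
qed

text \<open>Continuous dependence on initial data, uniformly on compact time intervals.\<close>

lemma solves_converge:
  fixes f :: "real^'n \<Rightarrow> real^'n"
  assumes sm: "smooth f" and v: "solves f v" and u: "\<And>n. solves f (u n)"
    and lim: "(\<lambda>n. u n 0) \<longlonglongrightarrow> v 0" and e: "0 < e"
  shows "\<forall>\<^sub>F n in sequentially. \<forall>t. \<bar>t\<bar> \<le> S \<longrightarrow> norm (u n t - v t) < e"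
proof -
  have "bounded (v ` {-S..S})"
    by (intro compact_imp_bounded compact_continuous_image solves_continuous[OF v]) auto
  then obtain R where R: "\<And>t. \<bar>t\<bar> \<le> S \<Longrightarrow> norm (v t) \<le> R"
    by (fastforce simp: bounded_iff abs_le_iff)
  obtain L where L: "0 \<le> L" "\<And>x y. norm x \<le> R + 1 \<Longrightarrow> norm y \<le> R + 1 \<Longrightarrow> norm (f x - f y) \<le> L * norm (x - y)"
    using smooth_lipschitz_on_ball[OF sm] by blast
  define k where "k = min 1 e / exp (L * S)"
  have k: "0 < k" using e by (simp add: k_def)
  have "\<forall>\<^sub>F n in sequentially. norm (u n 0 - v 0) < k"
    using tendstoD[OF lim k] by (simp add: dist_norm)
  then show ?thesis
  proof (rule eventually_mono)
    fix n assume "norm (u n 0 - v 0) < k"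
    then have c: "norm (u n 0 - v 0) * exp (L * S) < min 1 e"
      unfolding k_def by (simp only: pos_less_divide_eq exp_gt_zero)
    show "\<forall>t. \<bar>t\<bar> \<le> S \<longrightarrow> norm (u n t - v t) < e"
    proof (intro allI impI)
      fix t assume t: "\<bar>t\<bar> \<le> S"
      have "norm (u n t - v t) \<le> norm (u n 0 - v 0) * exp (L * \<bar>t\<bar>)"
      proof (rule shadowing[OF u v, where B = "{x. norm x \<le> R + 1}" and S = S])
        fix t x assume "\<bar>t\<bar> \<le> S" "norm (x - v t) \<le> 1"
        then show "x \<in> {x. norm x \<le> R + 1}"
          using R[of t] norm_triangle_sub[of x "v t"] by simp
      qed (use L c t in auto)
      also have "\<dots> \<le> norm (u n 0 - v 0) * exp (L * S)"
        using t L by (intro mult_left_mono) (auto intro: mult_left_mono)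
      finally show "norm (u n t - v t) < e" using c by simp
    qed
  qed
qed

lemma solves_tendsto:
  fixes f :: "real^'n \<Rightarrow> real^'n"
  assumes "smooth f" "solves f v" "\<And>n. solves f (u n)" "(\<lambda>n. u n 0) \<longlonglongrightarrow> v 0"
  shows "(\<lambda>n. u n t) \<longlonglongrightarrow> v t"
proof (rule tendstoI)
  fix e :: real assume "0 < e"
  from solves_converge[OF assms this, of "\<bar>t\<bar>"]
  show "\<forall>\<^sub>F n in sequentially. dist (u n t) (v t) < e"
    by (rule eventually_mono) (auto simp: dist_norm)
qed

lemma solves_unique:
  fixes f :: "real^'n \<Rightarrow> real^'n"
  assumes "smooth f" "solves f u" "solves f v" "u 0 = v 0"
  shows "u t = v t"
  using solves_tendsto[of f v "\<lambda>_. u" t] assms by (simp add: LIMSEQ_const_iff)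

section \<open>Distance to a compact invariant set\<close>

lemma maxdist_le: "y \<in> Y \<Longrightarrow> maxdist x Y \<le> infnorm (x - y)"
  unfolding maxdist_def by (rule cINF_lower) (auto intro!: bdd_belowI[of _ 0] simp: infnorm_pos_le)

lemma maxdist_le_norm: "y \<in> Y \<Longrightarrow> maxdist x Y \<le> norm (x - y)"
  using maxdist_le infnorm_le_norm order_trans by blast

lemma maxdist_attained:
  fixes Y :: "(real^'n) set"
  assumes "compact Y" "Y \<noteq> {}"
  obtains y where "y \<in> Y" "maxdist x Y = infnorm (x - y)"
    "norm (x - y) \<le> sqrt CARD('n) * maxdist x Y"
proof -
  have "continuous_on Y (\<lambda>y. infnorm (x - y))"
    by (intro continuous_on_infnorm continuous_intros)
  then obtain y where y: "y \<in> Y" "\<And>z. z \<in> Y \<Longrightarrow> infnorm (x - y) \<le> infnorm (x - z)"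
    using continuous_attains_inf[OF assms] by blast
  then have "infnorm (x - y) \<le> maxdist x Y"
    unfolding maxdist_def using assms by (intro cINF_greatest) auto
  then have "maxdist x Y = infnorm (x - y)" using maxdist_le[OF y(1)] by (simp add: order_antisym)
  moreover have "norm (x - y) \<le> sqrt CARD('n) * infnorm (x - y)"
    using norm_le_infnorm[of "x - y"] by simp
  ultimately show ?thesis using that y(1) by simp
qed

lemma maxdist_nonneg: "Y \<noteq> {} \<Longrightarrow> 0 \<le> maxdist x Y"
  unfolding maxdist_def by (intro cINF_greatest) (auto simp: infnorm_pos_le)

lemma maxdist_mem_iff:
  assumes "compact Y" "Y \<noteq> {}"
  shows "maxdist x Y \<le> 0 \<longleftrightarrow> x \<in> Y"
proof
  assume "maxdist x Y \<le> 0"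
  moreover obtain y where "y \<in> Y" "maxdist x Y = infnorm (x - y)" using maxdist_attained[OF assms] by blast
  ultimately show "x \<in> Y"
    by (metis eq_iff_diff_eq_0 infnorm_eq_0 infnorm_pos_le order_antisym)
next
  assume "x \<in> Y" then show "maxdist x Y \<le> 0" using maxdist_le_norm[of x Y x] by simp
qed

lemma maxdist_lipschitz:
  assumes "compact Y" "Y \<noteq> {}"
  shows "maxdist x Y \<le> maxdist z Y + norm (x - z)"
proof -
  obtain y where y: "y \<in> Y" "maxdist z Y = infnorm (z - y)" using maxdist_attained[OF assms] by blast
  have "maxdist x Y \<le> infnorm (x - y)" by (rule maxdist_le[OF y(1)])
  also have "\<dots> \<le> infnorm (x - z) + infnorm (z - y)"
    using infnorm_triangle[of "x - z" "z - y"] by simp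
  finally show ?thesis using y infnorm_le_norm[of "x - z"] by simp
qed

lemma tendsto_maxdist:
  assumes "compact Y" "Y \<noteq> {}" "(u \<longlongrightarrow> l) F"
  shows "((\<lambda>n. maxdist (u n) Y) \<longlongrightarrow> maxdist l Y) F"
proof (rule tendsto_norm_zero_cancel[OF Lim_null_comparison, THEN LIM_zero_cancel])
  show "((\<lambda>n. norm (u n - l)) \<longlongrightarrow> 0) F"
    using assms(3) by (simp add: LIM_zero_iff tendsto_norm_zero_iff)
  show "\<forall>\<^sub>F n in F. norm (norm (maxdist (u n) Y - maxdist l Y)) \<le> norm (u n - l)"
  proof (rule always_eventually, rule)
    fix n show "norm (norm (maxdist (u n) Y - maxdist l Y)) \<le> norm (u n - l)"
      using maxdist_lipschitz[OF assms(1,2), of "u n" l] maxdist_lipschitz[OF assms(1,2), of l "u n"]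
      by (simp add: norm_minus_commute)
  qed
qed

text \<open>A nearest point of \<open>Y\<close> stays in \<open>Y\<close> under the flow, and the trajectory shadows it. The factor
  \<open>sqrt CARD('n)\<close> compares the maximum norm with the Euclidean one.\<close>
lemma maxdist_growth:
  fixes f :: "real^'n \<Rightarrow> real^'n"
  assumes sm: "smooth f" and fl: "flow_of f \<Phi>" and Y: "compact Y" "Y \<noteq> {}" "invariant \<Phi> Y"
  obtains \<delta> K where "0 < \<delta>" "1 \<le> K"
    "\<And>u t. solves f u \<Longrightarrow> maxdist (u 0) Y < \<delta> \<Longrightarrow> \<bar>t\<bar> \<le> S \<Longrightarrow> maxdist (u t) Y \<le> K * maxdist (u 0) Y"
proof -
  obtain R where R: "\<And>y. y \<in> Y \<Longrightarrow> norm y \<le> R" using Y compact_imp_bounded bounded_iff by metis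
  obtain L where L: "0 \<le> L" "\<And>x y. norm x \<le> R + 1 \<Longrightarrow> norm y \<le> R + 1 \<Longrightarrow> norm (f x - f y) \<le> L * norm (x - y)"
    using smooth_lipschitz_on_ball[OF sm] by blast
  define K where "K = sqrt CARD('n) * exp (L * \<bar>S\<bar>)"
  have sq: "1 \<le> sqrt (CARD('n))" by simp
  have K: "1 \<le> K" unfolding K_def using mult_mono[OF sq, of 1 "exp (L * \<bar>S\<bar>)"] L by simp
  show ?thesis
  proof (rule that[of "1 / K" K])
    show "0 < 1 / K" "1 \<le> K" using K by auto
    fix u t assume u: "solves f u" "maxdist (u 0) Y < 1 / K" "\<bar>t\<bar> \<le> S"
    obtain y where y: "y \<in> Y" "norm (u 0 - y) \<le> sqrt CARD('n) * maxdist (u 0) Y"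
      using maxdist_attained[OF Y(1,2)] by blast
    define v where "v t = \<Phi> t y" for t
    have v: "solves f v" unfolding v_def by (rule flow_solves[OF fl])
    have vY: "v t \<in> Y" for t using Y y by (auto simp: invariant_def v_def)
    have v0: "v 0 = y" using flow_zero[OF fl] by (simp add: v_def)
    have e: "norm (u 0 - v 0) * exp (L * \<bar>S\<bar>) \<le> K * maxdist (u 0) Y"
      using y v0 by (auto simp: K_def mult.assoc mult.commute mult.left_commute intro: mult_left_mono)
    moreover have "K * maxdist (u 0) Y < 1" using u K by (simp add: field_simps)
    ultimately have c: "norm (u 0 - v 0) * exp (L * \<bar>S\<bar>) < 1" by simp
    have "maxdist (u t) Y \<le> norm (u t - v t)" by (rule maxdist_le_norm[OF vY])
    also have "\<dots> \<le> norm (u 0 - v 0) * exp (L * \<bar>t\<bar>)"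
    proof (rule shadowing[OF u(1) v, where B = "{x. norm x \<le> R + 1}" and S = "\<bar>S\<bar>"])
      fix t x assume "\<bar>t\<bar> \<le> \<bar>S\<bar>" "norm (x - v t) \<le> 1"
      then show "x \<in> {x. norm x \<le> R + 1}"
        using R[OF vY, of t] norm_triangle_sub[of x "v t"] by simp
    qed (use L c u in auto)
    also have "\<dots> \<le> norm (u 0 - v 0) * exp (L * \<bar>S\<bar>)"
      using u L by (intro mult_left_mono) (auto intro: mult_left_mono)
    also have "\<dots> \<le> K * maxdist (u 0) Y" by (rule e)
    finally show "maxdist (u t) Y \<le> K * maxdist (u 0) Y" .
  qed
qed

section \<open>Boxes and faces in eigenvector coordinates\<close>
definition complexify :: "real^'n \<Rightarrow> complex^'n" where
  "complexify h = (\<chi> i. complex_of_real (h $ i))"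

definition realpart :: "complex^'n \<Rightarrow> real^'n" where
  "realpart z = (\<chi> i. Re (z $ i))"

lemma linear_complexify: "linear complexify"
  by (auto simp: linear_iff complexify_def vec_eq_iff complex_eq_iff)

lemma linear_realpart: "linear realpart"
  by (auto simp: linear_iff realpart_def vec_eq_iff)

lemma realpart_complexify [simp]: "realpart (complexify h) = h"
  by (simp add: realpart_def complexify_def vec_eq_iff)

lemma eigencoords_complexify: "eigencoords E \<xi> x = matrix_inv E *v complexify (x - \<xi>)"
  by (simp add: eigencoords_def complexify_def)

lemma matrix_inv_vector:
  fixes A :: "complex^'n^'n"
  assumes "invertible A"
  shows "A *v (matrix_inv A *v z) = z" "matrix_inv A *v (A *v z) = z"
proof -
  have "A ** matrix_inv A = mat 1 \<and> matrix_inv A ** A = mat 1"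
    using assms unfolding invertible_def matrix_inv_def by (rule someI_ex)
  then show "A *v (matrix_inv A *v z) = z" "matrix_inv A *v (A *v z) = z"
    by (simp_all add: matrix_vector_mul_assoc)
qed

lemma eigencoords_expand: "invertible E \<Longrightarrow> E *v eigencoords E \<xi> x = complexify (x - \<xi>)"
  by (simp add: eigencoords_complexify matrix_inv_vector)

lemma eigencoords_recover: "invertible E \<Longrightarrow> x = \<xi> + realpart (E *v eigencoords E \<xi> x)"
  by (simp add: eigencoords_expand)

lemma linear_coords: "linear (\<lambda>h. A *v complexify h)"
  using linear_compose[OF linear_complexify matrix_vector_mul_linear, of A] by (simp add: o_def)

lemma linear_uncoords: "linear (\<lambda>z. realpart (A *v z))"
  using linear_compose[OF matrix_vector_mul_linear linear_realpart, of A] by (simp add: o_def)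

lemma eigencoords_self [simp]: "eigencoords E \<xi> \<xi> = 0"
  using linear_0[OF linear_coords] by (simp add: eigencoords_complexify)

lemma eigencoords_affine:
  assumes "a + b = 1"
  shows "eigencoords E \<xi> (a *\<^sub>R x + b *\<^sub>R y) = a *\<^sub>R eigencoords E \<xi> x + b *\<^sub>R eigencoords E \<xi> y"
proof -
  have "a *\<^sub>R x + b *\<^sub>R y - \<xi> = a *\<^sub>R (x - \<xi>) + b *\<^sub>R (y - \<xi>)"
    using assms by (simp add: algebra_simps) (metis scaleR_left_distrib scaleR_one)
  then show ?thesis
    using linear_coords[of "matrix_inv E"] unfolding linear_iff eigencoords_complexify by simp
qed

lemma continuous_on_eigencoords [continuous_intros]:
  "continuous_on S g \<Longrightarrow> continuous_on S (\<lambda>x. eigencoords E \<xi> (g x))"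
  unfolding eigencoords_complexify
  using bounded_linear.continuous_on[OF linear_coords[of "matrix_inv E", unfolded linear_conv_bounded_linear],
      of S "\<lambda>x. g x - \<xi>"]
  by (simp add: continuous_on_diff)

lemma norm_le_eigencoords:
  assumes "invertible E"
  obtains C where "0 < C" "\<And>x. norm (x - \<xi>) \<le> C * norm (eigencoords E \<xi> x)"
proof -
  obtain C where C: "0 < C" "\<And>z. norm (realpart (E *v z)) \<le> C * norm z"
    using linear_bounded_pos[OF linear_uncoords[of E]] by auto
  show ?thesis
    by (rule that[OF C(1)]) (use C(2)[of "eigencoords E \<xi> _"] eigencoords_expand[OF assms, of \<xi>] in simp)
qed

definition closed_box :: "complex^'n^'n \<Rightarrow> real^'n \<Rightarrow> real \<Rightarrow> (real^'n) set" where
  "closed_box E \<xi> r = {x. \<forall>s. cmod (eigencoords E \<xi> x $ s) \<le> r}"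

lemma box_subset_closed_box: "box_nbhd E \<xi> r \<subseteq> closed_box E \<xi> r"
  by (auto simp: box_nbhd_def closed_box_def intro: less_imp_le)

lemma open_box_nbhd: "open (box_nbhd E \<xi> r)"
proof -
  have "box_nbhd E \<xi> r = (\<Inter>s\<in>UNIV. {x. cmod (eigencoords E \<xi> x $ s) < r})"
    by (auto simp: box_nbhd_def)
  also have "open \<dots>" by (intro open_INT ballI open_Collect_less continuous_intros) simp
  finally show ?thesis .
qed

lemma closed_closed_box: "closed (closed_box E \<xi> r)"
  unfolding closed_box_def
  by (intro closed_Collect_all closed_Collect_le continuous_intros)

lemma center_in_box: "0 < r \<Longrightarrow> \<xi> \<in> box_nbhd E \<xi> r"
  by (simp add: box_nbhd_def)

lemma closed_box_bound:
  assumes "invertible (E :: complex^'n^'n)"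
  obtains C where "0 < C" "\<And>r x. x \<in> closed_box E \<xi> r \<Longrightarrow> norm (x - \<xi>) \<le> C * r"
proof -
  obtain C where C: "0 < C" "\<And>x. norm (x - \<xi>) \<le> C * norm (eigencoords E \<xi> x)"
    using norm_le_eigencoords[OF assms] by blast
  have "norm (x - \<xi>) \<le> (C * CARD('n)) * r" if "x \<in> closed_box E \<xi> r" for x r
  proof -
    have "norm (eigencoords E \<xi> x) \<le> (\<Sum>s\<in>UNIV. norm (eigencoords E \<xi> x $ s))"
      by (simp add: norm_vec_def L2_set_le_sum)
    also have "\<dots> \<le> CARD('n) * r"
      using that sum_bounded_above[of "UNIV :: 'n set" "\<lambda>s. cmod (eigencoords E \<xi> x $ s)" r]
      by (simp add: closed_box_def)
    finally have "C * norm (eigencoords E \<xi> x) \<le> C * (CARD('n) * r)" using C by simp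
    then show ?thesis using C(2)[of x] by (simp add: mult.assoc)
  qed
  then show ?thesis using that[of "C * CARD('n)"] C by simp
qed

lemma compact_closed_box:
  assumes "invertible E" shows "compact (closed_box E \<xi> r)"
proof -
  obtain C where "0 < C" "\<And>r x. x \<in> closed_box E \<xi> r \<Longrightarrow> norm (x - \<xi>) \<le> C * r"
    using closed_box_bound[OF assms] by blast
  then have "closed_box E \<xi> r \<subseteq> cball \<xi> (C * r)" by (auto simp: dist_norm norm_minus_commute)
  then show ?thesis using closed_closed_box bounded_subset bounded_cball compact_eq_bounded_closed by blast
qed

lemma closed_box_small:
  assumes "invertible E" "0 < e"
  shows "\<forall>\<^sub>F r in at_right 0. closed_box E \<xi> r \<subseteq> ball \<xi> e"
proof -
  obtain C where C: "0 < C" "\<And>r x. x \<in> closed_box E \<xi> r \<Longrightarrow> norm (x - \<xi>) \<le> C * r"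
    using closed_box_bound[OF assms(1)] by blast
  have "0 < e / C" using C assms by simp
  then have "\<forall>\<^sub>F r in at_right 0. r < e / C" by (auto simp: eventually_at_right_field)
  then show ?thesis
  proof (rule eventually_mono)
    fix r assume "r < e / C"
    then have "C * r < e" using C by (simp add: field_simps)
    then show "closed_box E \<xi> r \<subseteq> ball \<xi> e"
      using C(2) by (fastforce simp: dist_norm norm_minus_commute)
  qed
qed

definition side :: "complex^'n^'n \<Rightarrow> real^'n \<Rightarrow> real \<Rightarrow> 'n \<Rightarrow> (real^'n) set" where
  "side E \<xi> r s = {x. cmod (eigencoords E \<xi> x $ s) = r \<and> (\<forall>q. cmod (eigencoords E \<xi> x $ q) \<le> r)}"

lemma faces_side: "faces E \<xi> r = (\<Union>s. components (side E \<xi> r s))"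
  by (simp add: faces_def side_def)

lemma closed_side: "closed (side E \<xi> r s)"
  unfolding side_def
  by (intro closed_Collect_conj closed_Collect_all closed_Collect_le closed_Collect_eq continuous_intros)

lemma closed_face: "F \<in> faces E \<xi> r \<Longrightarrow> closed F"
  by (auto simp: faces_side intro: closed_components[OF closed_side])

lemma face_subset: "F \<in> faces E \<xi> r \<Longrightarrow> F \<subseteq> closed_box E \<xi> r - box_nbhd E \<xi> r"
  using in_components_subset[of F "side E \<xi> r _"]
  by (auto simp: faces_side side_def closed_box_def box_nbhd_def)

lemma boundary_in_face:
  assumes "x \<in> closed_box E \<xi> r" "x \<notin> box_nbhd E \<xi> r"
  obtains F where "F \<in> faces E \<xi> r" "x \<in> F"
proof -
  obtain s where s: "\<not> cmod (eigencoords E \<xi> x $ s) < r" using assms(2) by (auto simp: box_nbhd_def)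
  have "cmod (eigencoords E \<xi> x $ s) \<le> r" using assms(1) by (simp add: closed_box_def)
  then have "x \<in> side E \<xi> r s" using s assms by (simp add: side_def closed_box_def)
  then have "x \<in> \<Union> (components (side E \<xi> r s))" by simp
  then obtain F where "F \<in> components (side E \<xi> r s)" "x \<in> F" by blast
  then show ?thesis using that unfolding faces_side by blast
qed

lemma finite_components_Union:
  assumes "finite K" "\<And>C. C \<in> K \<Longrightarrow> connected C" "\<Union>K = A"
  shows "finite (components A)"
proof (rule finite_subset)
  show "components A \<subseteq> (\<lambda>C. connected_component_set A (SOME x. x \<in> C)) ` K"
  proof
    fix D assume "D \<in> components A"
    then obtain x where x: "x \<in> A" "D = connected_component_set A x" by (auto simp: components_iff)
    then obtain C where C: "C \<in> K" "x \<in> C" using assms(3) by auto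
    define y where "y = (SOME x. x \<in> C)"
    have "y \<in> C" unfolding y_def using C(2) by (rule someI)
    then have "connected_component A x y"
      using C assms(2)[OF C(1)] assms(3) unfolding connected_component_def by blast
    then have "D = connected_component_set A y" using x connected_component_eq by fastforce
    then show "D \<in> (\<lambda>C. connected_component_set A (SOME x. x \<in> C)) ` K"
      using C y_def by auto
  qed
qed (use assms in simp)

lemma column_axis: "column s A = (A :: complex^'n^'n) *v axis s 1"
  by (simp add: column_def matrix_vector_mult_def axis_def vec_eq_iff if_distrib cong: if_cong)

definition conj_vec :: "complex^'n \<Rightarrow> complex^'n" where
  "conj_vec z = (\<chi> i. cnj (z $ i))"

text \<open>Conjugation permutes the columns of the eigenvector matrix by an involution \<open>\<sigma>\<close>. Comparing the
  expansion of a real vector with its conjugate gives the symmetry of the coordinates; conversely,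
  every symmetric coordinate vector comes from a real point.\<close>
lemma eigencoords_conj:
  fixes E :: "complex^'n^'n"
  assumes E: "eigenbasis f \<xi> E"
  obtains \<sigma> where "\<And>s. \<sigma> (\<sigma> s) = s"
    "\<And>x s. eigencoords E \<xi> x $ (\<sigma> s) = cnj (eigencoords E \<xi> x $ s)"
    "\<And>z. (\<And>s. z $ (\<sigma> s) = cnj (z $ s)) \<Longrightarrow> eigencoords E \<xi> (\<xi> + realpart (E *v z)) = z"
proof -
  have inv: "invertible E" and "\<forall>s. \<exists>r. column r E = conj_vec (column s E)"
    using E by (auto simp: eigenbasis_def conj_vec_def)
  then obtain \<sigma> where \<sigma>: "\<And>s. column (\<sigma> s) E = conj_vec (column s E)" by metis
  have conj2 [simp]: "conj_vec (conj_vec z) = z" for z :: "complex^'n"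
    by (simp add: conj_vec_def vec_eq_iff)
  have inj: "inj ((*v) E)" by (rule inj_matrix_vector_mult[OF inv])
  have inv2: "\<sigma> (\<sigma> s) = s" for s
  proof -
    have "column (\<sigma> (\<sigma> s)) E = column s E" by (simp add: \<sigma>)
    then have "axis (\<sigma> (\<sigma> s)) (1::complex) = axis s 1" using inj by (simp add: column_axis inj_eq)
    then show ?thesis by (simp add: axis_eq_axis)
  qed
  then have bij: "bij \<sigma>" by (intro o_bij[of \<sigma>]) (auto simp: fun_eq_iff)
  have conj_mult: "conj_vec (E *v z) = E *v (\<chi> s. cnj (z $ \<sigma> s))" for z
  proof -
    have "conj_vec (E *v z) = (\<Sum>s\<in>UNIV. cnj (z $ s) *s column (\<sigma> s) E)"
      unfolding \<sigma> by (simp add: matrix_mult_sum conj_vec_def vec_eq_iff)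
    also have "\<dots> = (\<Sum>s\<in>UNIV. cnj (z $ \<sigma> s) *s column (\<sigma> (\<sigma> s)) E)"
      using sum.reindex_bij_betw[OF bij, of "\<lambda>s. cnj (z $ s) *s column (\<sigma> s) E"] by simp
    finally show ?thesis by (simp add: inv2 matrix_mult_sum)
  qed
  have 1: "eigencoords E \<xi> x $ (\<sigma> s) = cnj (eigencoords E \<xi> x $ s)" for x s
  proof -
    define z where "z = eigencoords E \<xi> x"
    have "E *v (\<chi> s. cnj (z $ \<sigma> s)) = conj_vec (complexify (x - \<xi>))"
      unfolding z_def conj_mult[symmetric] eigencoords_expand[OF inv] ..
    also have "\<dots> = E *v z"
      unfolding z_def eigencoords_expand[OF inv] by (simp add: conj_vec_def complexify_def vec_eq_iff)
    finally have "(\<chi> s. cnj (z $ \<sigma> s)) = z" using inj by (simp add: inj_eq)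
    then have "(\<chi> s. cnj (z $ \<sigma> s)) $ s = z $ s" by simp
    then have "cnj (z $ \<sigma> s) = z $ s" by simp
    then show ?thesis unfolding z_def by (metis complex_cnj_cnj)
  qed
  have 2: "eigencoords E \<xi> (\<xi> + realpart (E *v z)) = z" if z: "\<And>s. z $ (\<sigma> s) = cnj (z $ s)" for z
  proof -
    have "conj_vec (E *v z) = E *v z"
      unfolding conj_mult by (rule arg_cong[where f = "(*v) E"]) (simp add: vec_eq_iff z)
    then have "complexify (realpart (E *v z)) = E *v z"
      by (simp add: vec_eq_iff conj_vec_def complexify_def realpart_def complex_eq_iff)
    then show ?thesis by (simp add: eigencoords_complexify matrix_inv_vector[OF inv])
  qed
  show ?thesis using that inv2 1 2 by blast
qed

text \<open>Each boundary part \<open>|y\<^sub>s| = r\<close> is a union of at most two connected sets. For a real coordinate these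
  are the convex slices \<open>y\<^sub>s = r\<close> and \<open>y\<^sub>s = -r\<close>. For a complex one, rotating \<open>y\<^sub>s\<close> and its conjugate
  partner in opposite directions moves any point to the convex slice \<open>y\<^sub>s = r\<close>. Finiteness lets a
  sequence of boundary points be refined to lie in one closed face, which then contains its limit.\<close>
lemma finite_faces:
  fixes E :: "complex^'n^'n"
  assumes E: "eigenbasis f \<xi> E"
  shows "finite (faces E \<xi> r)"
  unfolding faces_side
proof (intro finite_UN_I)
  fix s :: 'n
  have inv: "invertible E" using E by (simp add: eigenbasis_def)
  obtain \<sigma> where \<sigma>: "\<And>s. \<sigma> (\<sigma> s) = s"
    "\<And>x s. eigencoords E \<xi> x $ (\<sigma> s) = cnj (eigencoords E \<xi> x $ s)"
    "\<And>z. (\<And>s. z $ (\<sigma> s) = cnj (z $ s)) \<Longrightarrow> eigencoords E \<xi> (\<xi> + realpart (E *v z)) = z"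
    using eigencoords_conj[OF E] by blast
  define H where "H c = {x \<in> closed_box E \<xi> r. eigencoords E \<xi> x $ s = c}" for c :: complex
  have "convex (H c)" for c
  proof (rule convexI)
    fix x y and a b :: real
    assume xy: "x \<in> H c" "y \<in> H c" "0 \<le> a" "0 \<le> b" "a + b = 1"
    have "cmod (eigencoords E \<xi> (a *\<^sub>R x + b *\<^sub>R y) $ q) \<le> r" for q
    proof -
      have "cmod (eigencoords E \<xi> (a *\<^sub>R x + b *\<^sub>R y) $ q)
          \<le> a * cmod (eigencoords E \<xi> x $ q) + b * cmod (eigencoords E \<xi> y $ q)"
        unfolding eigencoords_affine[OF xy(5)]
        using norm_triangle_ineq[of "a *\<^sub>R eigencoords E \<xi> x $ q" "b *\<^sub>R eigencoords E \<xi> y $ q"] xy by simp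
      also have "\<dots> \<le> a * r + b * r"
        using xy by (intro add_mono mult_left_mono) (auto simp: H_def closed_box_def)
      finally show ?thesis using xy(5) by (simp add: distrib_right[symmetric])
    qed
    moreover have "eigencoords E \<xi> (a *\<^sub>R x + b *\<^sub>R y) $ s = c"
      unfolding eigencoords_affine[OF xy(5)] using xy
      by (simp add: H_def scaleR_left_distrib[symmetric])
    ultimately show "a *\<^sub>R x + b *\<^sub>R y \<in> H c" by (simp add: H_def closed_box_def)
  qed
  then have conn: "connected (H c)" for c by (rule convex_connected)
  show "finite (components (side E \<xi> r s))"
  proof (cases "\<sigma> s = s")
    case True
    have "Im (eigencoords E \<xi> x $ s) = 0" for x
      using \<sigma>(2)[of x s] True by (simp add: complex_eq_iff)
    then have *: "cmod (eigencoords E \<xi> x $ s) = r \<longleftrightarrow> 0 \<le> r \<and>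
        (eigencoords E \<xi> x $ s = of_real r \<or> eigencoords E \<xi> x $ s = of_real (- r))" for x
      by (simp add: cmod_eq_Re complex_eq_iff) arith
    show ?thesis
    proof (cases "0 \<le> r")
      case True
      show ?thesis
        by (rule finite_components_Union[of "{H (of_real r), H (of_real (- r))}"])
          (use conn True in \<open>auto simp: side_def H_def closed_box_def *\<close>)
    next
      case False
      then have "side E \<xi> r s = {}" using * by (auto simp: side_def)
      then show ?thesis by simp
    qed
  next
    case False
    have "connected (side E \<xi> r s)"
    proof (cases "side E \<xi> r s = {}")
      case nonempty: False
      then have r: "0 \<le> r" by (auto simp: side_def)
      have to_H: "\<exists>y. y \<in> H (of_real r) \<and> connected_component (side E \<xi> r s) x y"
        if x: "x \<in> side E \<xi> r s" for x
      proof -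
        define z where "z = eigencoords E \<xi> x"
        \<comment> \<open>Opposite rotation of the conjugate pair keeps the point real and all moduli fixed.\<close>
        define w where "w t = (\<chi> q. (if q = s then cis t else if q = \<sigma> s then cis (- t) else 1) * z $ q)" for t
        define y where "y t = \<xi> + realpart (E *v w t)" for t
        have "w t $ (\<sigma> q) = cnj (w t $ q)" for t q
          using False \<sigma>(1)[of q] \<sigma>(1)[of s] \<sigma>(2)[of x q]
          by (auto simp: w_def z_def cis_cnj)
        then have coord: "eigencoords E \<xi> (y t) = w t" for t
          unfolding y_def by (rule \<sigma>(3))
        have cmod_w: "cmod (w t $ q) = cmod (z $ q)" for t q
          by (simp add: w_def norm_mult)
        have in_side: "y t \<in> side E \<xi> r s" for t
          using x by (simp add: side_def coord cmod_w z_def)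
        have "continuous_on UNIV w"
          unfolding w_def
        proof (intro continuous_on_vec_lambda continuous_on_mult)
          show "continuous_on UNIV (\<lambda>t. if q = s then cis t else if q = \<sigma> s then cis (- t) else 1)" for q
            by (cases "q = s"; cases "q = \<sigma> s") (auto intro!: continuous_intros)
        qed simp
        then have "continuous_on UNIV y"
          unfolding y_def by (intro continuous_intros linear_continuous_on_compose[OF _ linear_uncoords])
        then have "connected (range y)" by (rule connected_continuous_image) simp
        moreover have "w 0 = z" by (simp add: w_def vec_eq_iff)
        then have "y 0 = x" unfolding y_def z_def by (simp add: eigencoords_recover[OF inv, symmetric])
        moreover have "y (- Arg (z $ s)) \<in> H (of_real r)"
        proof -
          have "z $ s = of_real r * cis (Arg (z $ s))"
            using x rcis_cmod_Arg[of "z $ s"] by (simp add: side_def z_def rcis_def)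
          then have "cis (- Arg (z $ s)) * z $ s = of_real r * (cis (- Arg (z $ s)) * cis (Arg (z $ s)))"
            using mult.left_commute by metis
          then have "cis (- Arg (z $ s)) * z $ s = of_real r" by (simp add: cis_mult)
          then have "w (- Arg (z $ s)) $ s = of_real r" by (simp add: w_def)
          then show ?thesis using in_side[of "- Arg (z $ s)"] by (simp add: H_def coord side_def closed_box_def)
        qed
        ultimately show ?thesis
          using in_side unfolding connected_component_def by blast
      qed
      have "H (of_real r) \<subseteq> side E \<xi> r s" using r by (auto simp: H_def side_def closed_box_def)
      then have "connected_component (side E \<xi> r s) x y" if "x \<in> H (of_real r)" "y \<in> H (of_real r)" for x y
        using conn[of "of_real r"] that unfolding connected_component_def by blast
      then show ?thesis
        unfolding connected_iff_connected_component
        by (meson to_H connected_component_trans connected_component_sym)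
    qed simp
    show ?thesis
      by (rule finite_components_Union[of "{side E \<xi> r s}"]) (use \<open>connected (side E \<xi> r s)\<close> in auto)
  qed
qed simp

section \<open>Hyperbolic equilibria are isolated\<close>

text \<open>If \<open>g\<close> were at least \<open>e\<close> at arbitrarily late times, it would be at least \<open>e / 2\<close> on intervals of a
  fixed length, and \<open>w\<close> would gain a fixed amount on each of them, against its boundedness.\<close>
lemma barbalat:
  fixes w g :: "real \<Rightarrow> real"
  assumes \<mu>: "0 < \<mu>"
    and der: "\<And>t. t0 \<le> t \<Longrightarrow> \<exists>D. (w has_real_derivative D) (at t) \<and> \<mu> * (g t)\<^sup>2 \<le> D"
    and bdd: "\<And>t. t0 \<le> t \<Longrightarrow> w t \<le> B"
    and lip: "\<And>s t. t0 \<le> s \<Longrightarrow> s \<le> t \<Longrightarrow> \<bar>g t - g s\<bar> \<le> L * (t - s)"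
    and nonneg: "\<And>t. 0 \<le> g t"
  shows "(g \<longlongrightarrow> 0) at_top"
proof (rule tendstoI)
  fix e :: real assume e: "0 < e"
  define L' where "L' = max 1 L"
  define h where "h = e / (2 * L')"
  define c where "c = h * (\<mu> * (e / 2)\<^sup>2)"
  have pos: "0 < L'" "0 < h" "0 < c" using e \<mu> by (auto simp: L'_def h_def c_def)
  obtain D where D: "\<And>t. t0 \<le> t \<Longrightarrow> (w has_real_derivative D t) (at t)"
      "\<And>t. t0 \<le> t \<Longrightarrow> \<mu> * (g t)\<^sup>2 \<le> D t"
    using der by metis
  have D0: "0 \<le> D t" if "t0 \<le> t" for t
    using D(2)[OF that] \<mu> by (smt (verit) mult_nonneg_nonneg zero_le_power2)
  have mono: "w s \<le> w t" if "t0 \<le> s" "s \<le> t" for s t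
    by (rule DERIV_nonneg_imp_nondecreasing[OF that(2)]) (use D(1) D0 order_trans[OF that(1)] in blast)
  have gain: "w t + c \<le> w (t + h)" if t: "t0 \<le> t" "e \<le> g t" for t
  proof -
    have "\<exists>z>t. z < t + h \<and> w (t + h) - w t = (t + h - t) * D z"
      by (rule MVT2) (use pos t D(1) in auto)
    then obtain z where z: "t < z" "z < t + h" "w (t + h) - w t = h * D z" by auto
    have "\<bar>g z - g t\<bar> \<le> L * (z - t)" by (rule lip) (use z t in auto)
    also have "\<dots> \<le> L' * (z - t)" using z by (intro mult_right_mono) (auto simp: L'_def)
    also have "\<dots> \<le> L' * h" using z pos by (intro mult_left_mono) auto
    also have "\<dots> = e / 2" using pos by (simp add: h_def)
    finally have "e / 2 \<le> g z" using t by linarith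
    then have "(e / 2)\<^sup>2 \<le> (g z)\<^sup>2" using e by (intro power_mono) auto
    then have "\<mu> * (e / 2)\<^sup>2 \<le> D z" using D(2)[of z] z t \<mu> mult_left_mono[of "(e / 2)\<^sup>2" "(g z)\<^sup>2" \<mu>] by linarith
    then have "c \<le> h * D z" unfolding c_def using pos by (intro mult_left_mono) auto
    then show ?thesis using z by simp
  qed
  have bddA: "bdd_above (w ` {t0..})" using bdd by (auto intro!: bdd_aboveI[of _ B])
  have "\<exists>t1\<ge>t0. Sup (w ` {t0..}) - c < w t1"
    using less_cSup_iff[OF _ bddA, of "Sup (w ` {t0..}) - c"] pos by auto
  then obtain t1 where t1: "t0 \<le> t1" "Sup (w ` {t0..}) - c < w t1" by blast
  have "g t < e" if "t1 \<le> t" for t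
  proof (rule ccontr)
    assume "\<not> g t < e"
    then have "w t + c \<le> w (t + h)" using gain t1 that by simp
    moreover have "w t1 \<le> w t" using mono t1 that by simp
    moreover have "w (t + h) \<le> Sup (w ` {t0..})"
      by (rule cSup_upper[OF _ bddA]) (use t1 that pos in auto)
    ultimately show False using t1 by simp
  qed
  then show "\<forall>\<^sub>F t in at_top. dist (g t) 0 < e"
    using nonneg by (auto simp: eventually_at_top_linorder dist_real_def intro!: exI[of _ t1])
qed

lemma complexify_jacobian: "complexify (jacobian f (at \<xi>) *v h) = cjacobian f \<xi> *v complexify h"
  by (simp add: complexify_def cjacobian_def map_matrix_def matrix_vector_mult_def vec_eq_iff)

text \<open>In eigenvector coordinates the linear part is diagonal, so the derivative of
  \<open>\<Sum>\<^sub>s sgn (Re \<lambda>\<^sub>s) |y\<^sub>s|\<^sup>2\<close> along the linearised flow is \<open>2 \<Sum>\<^sub>s |Re \<lambda>\<^sub>s| |y\<^sub>s|\<^sup>2\<close>, which is positive definite;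
  the nonlinear remainder takes away at most half of it near the equilibrium.\<close>
lemma hyperbolic_lyapunov_function:
  fixes f :: "real^'n \<Rightarrow> real^'n"
  assumes diff: "f differentiable (at \<xi>)" and hyp: "hyperbolic f \<xi>" and E: "eigenbasis f \<xi> E"
  obtains W :: "real^'n \<Rightarrow> real" and \<mu> \<epsilon> where "0 < \<mu>" "0 < \<epsilon>" "continuous_on UNIV W"
    "\<And>u t. solves f u \<Longrightarrow> norm (u t - \<xi>) < \<epsilon> \<Longrightarrow>
      \<exists>D. ((\<lambda>t. W (u t)) has_real_derivative D) (at t) \<and> \<mu> * (norm (u t - \<xi>))\<^sup>2 \<le> D"
proof -
  have inv: "invertible E" using E by (simp add: eigenbasis_def)
  have inj: "inj ((*v) E)" by (rule inj_matrix_vector_mult[OF inv])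
  obtain l where l: "\<And>s. cjacobian f \<xi> *v column s E = l s *s column s E"
    using E unfolding eigenbasis_def by metis
  have l0: "Re (l s) \<noteq> 0" for s
  proof -
    have "column s E \<noteq> 0"
    proof
      assume "column s E = 0"
      then have "E *v axis s 1 = E *v 0" by (simp add: column_axis)
      then have "axis s (1 :: complex) = 0" using inj by (simp only: inj_eq)
      then show False by (simp add: axis_eq_0_iff)
    qed
    then have "l s \<in> eigenvalues_on f \<xi> UNIV" using l unfolding eigenvalues_on_def by auto
    then show ?thesis using hyp by (auto simp: hyperbolic_def)
  qed
  define m where "m = Min (range (\<lambda>s. \<bar>Re (l s)\<bar>))"
  have m: "0 < m" "\<And>s. m \<le> \<bar>Re (l s)\<bar>" unfolding m_def using l0 by (auto simp: Min_gr_iff)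
  define M where "M = matrix_inv E"
  define z where "z = eigencoords E \<xi>"
  define S :: "complex^'n \<Rightarrow> complex^'n" where "S y = (\<chi> s. sgn (Re (l s)) *\<^sub>R y $ s)" for y
  define W where "W x = z x \<bullet> S (z x)" for x
  define R where "R x = f x - jacobian f (at \<xi>) *v (x - \<xi>)" for x
  obtain C1 where C1: "0 < C1" "\<And>h. norm (M *v complexify h) \<le> C1 * norm h"
    using linear_bounded_pos[OF linear_coords[of M]] by auto
  obtain C2 where C2: "0 < C2" "\<And>x. norm (x - \<xi>) \<le> C2 * norm (z x)"
    using norm_le_eigencoords[OF inv] unfolding z_def by blast
  have linS: "linear S" by (auto simp: linear_iff S_def vec_eq_iff scaleR_add_right)
  have normS: "norm (S y) \<le> norm y" for y
    by (rule norm_le_componentwise_cart) (simp add: S_def sgn_real_def)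
  have symS: "S a \<bullet> b = a \<bullet> S b" for a b by (simp add: S_def inner_vec_def)
  have lin: "(M *v complexify (jacobian f (at \<xi>) *v (x - \<xi>))) $ s = l s * z x $ s" for x s
  proof -
    have "complexify (jacobian f (at \<xi>) *v (x - \<xi>)) = cjacobian f \<xi> *v (E *v z x)"
      by (simp add: complexify_jacobian z_def eigencoords_expand[OF inv])
    also have "\<dots> = (\<Sum>s\<in>UNIV. z x $ s *s (cjacobian f \<xi> *v column s E))"
      unfolding matrix_mult_sum[of E] vec.linear_sum[OF matrix_vector_mul_linear_gen] vector_scalar_commute ..
    also have "\<dots> = E *v (\<chi> s. l s * z x $ s)"
      by (simp add: l matrix_mult_sum[of E] mult.commute)
    finally show ?thesis by (simp add: M_def matrix_inv_vector[OF inv])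
  qed
  have "(f has_derivative (\<lambda>h. jacobian f (at \<xi>) *v h)) (at \<xi>)"
    using diff jacobian_works by blast
  moreover have f0: "f \<xi> = 0" using hyp by (simp add: hyperbolic_def equilibrium_def)
  moreover have "0 < m / (2 * C1 * C2)" using m C1 C2 by simp
  ultimately obtain \<epsilon> where \<epsilon>: "0 < \<epsilon>"
      "\<And>x. norm (x - \<xi>) < \<epsilon> \<Longrightarrow> norm (R x) \<le> m / (2 * C1 * C2) * norm (x - \<xi>)"
    unfolding has_derivative_at_alt R_def by fastforce
  show ?thesis
  proof (rule that[of "m / C2\<^sup>2" \<epsilon> W])
    show "0 < m / C2\<^sup>2" "0 < \<epsilon>" using m C2 \<epsilon> by auto
    have "continuous_on UNIV z" unfolding z_def by (intro continuous_intros)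
    moreover from this have "continuous_on UNIV (\<lambda>x. S (z x))"
      using linS by (simp add: bounded_linear.continuous_on linear_conv_bounded_linear)
    ultimately show "continuous_on UNIV W" unfolding W_def by (rule continuous_on_inner)
    fix u t assume u: "solves f u" and t: "norm (u t - \<xi>) < \<epsilon>"
    define y where "y = z (u t)"
    define y' where "y' = M *v complexify (f (u t))"
    define err where "err = M *v complexify (R (u t))"
    have y': "y' = (\<chi> s. l s * y $ s) + err"
    proof -
      have "f (u t) = jacobian f (at \<xi>) *v (u t - \<xi>) + R (u t)" by (simp add: R_def)
      then have "y' = M *v complexify (jacobian f (at \<xi>) *v (u t - \<xi>)) + err"
        unfolding y'_def err_def using linear_add[OF linear_coords[of M]] by metis
      then show ?thesis by (simp add: vec_eq_iff lin y_def)
    qed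
    have dz: "((\<lambda>t. z (u t)) has_vector_derivative y') (at t)"
      unfolding z_def eigencoords_complexify y'_def M_def
      by (rule bounded_linear.has_vector_derivative[OF linear_coords[unfolded linear_conv_bounded_linear]])
        (use u in \<open>auto simp: solves_def intro!: derivative_eq_intros\<close>)
    have dS: "((\<lambda>t. S (z (u t))) has_vector_derivative S y') (at t)"
      using linS dz unfolding linear_conv_bounded_linear by (rule bounded_linear.has_vector_derivative)
    have "((\<lambda>t. W (u t)) has_derivative (\<lambda>h. y \<bullet> (h *\<^sub>R S y') + (h *\<^sub>R y') \<bullet> S y)) (at t)"
      unfolding W_def y_def
      by (rule has_derivative_inner[OF dz[unfolded has_vector_derivative_def] dS[unfolded has_vector_derivative_def]])
    then have "((\<lambda>t. W (u t)) has_real_derivative 2 * (y' \<bullet> S y)) (at t)"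
      unfolding has_field_derivative_def
    proof (rule has_derivative_eq_rhs)
      have "y \<bullet> S y' = y' \<bullet> S y" by (metis symS inner_commute)
      then show "(\<lambda>h. y \<bullet> (h *\<^sub>R S y') + (h *\<^sub>R y') \<bullet> S y) = (*) (2 * (y' \<bullet> S y))"
        by (simp add: fun_eq_iff)
    qed
    moreover have "m / C2\<^sup>2 * (norm (u t - \<xi>))\<^sup>2 \<le> 2 * (y' \<bullet> S y)"
    proof -
      have "m * (norm y)\<^sup>2 = (\<Sum>s\<in>UNIV. m * (norm (y $ s))\<^sup>2)"
        by (simp add: power2_norm_eq_inner inner_vec_def sum_distrib_left)
      also have "\<dots> \<le> (\<Sum>s\<in>UNIV. \<bar>Re (l s)\<bar> * (norm (y $ s))\<^sup>2)"
        by (intro sum_mono mult_right_mono m) auto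
      also have "\<dots> = (\<chi> s. l s * y $ s) \<bullet> S y"
      proof -
        have "\<bar>Re (l s)\<bar> * (norm (y $ s))\<^sup>2 = (l s * y $ s) \<bullet> (sgn (Re (l s)) *\<^sub>R y $ s)" for s
          unfolding cmod_power2
          by (cases "Re (l s) < 0"; cases "Re (l s) = 0")
            (simp_all add: inner_complex_def algebra_simps power2_eq_square sgn_if)
        then show ?thesis by (simp add: inner_vec_def S_def)
      qed
      finally have 1: "m * (norm y)\<^sup>2 \<le> (\<chi> s. l s * y $ s) \<bullet> S y" .
      have "norm err \<le> C1 * norm (R (u t))" unfolding err_def by (rule C1)
      also have "\<dots> \<le> C1 * (m / (2 * C1 * C2) * norm (u t - \<xi>))"
        using C1 \<epsilon>(2)[OF t] by (intro mult_left_mono) auto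
      also have "\<dots> \<le> C1 * (m / (2 * C1 * C2) * (C2 * norm y))"
        using C1 C2 m by (intro mult_left_mono) (auto simp: y_def)
      also have "\<dots> = m / 2 * norm y" using C1 C2 by simp
      finally have "norm err * norm (S y) \<le> m / 2 * norm y * norm y"
        by (rule mult_mono[OF _ normS]) (use m in auto)
      then have 2: "- (err \<bullet> S y) \<le> m / 2 * (norm y)\<^sup>2"
        using norm_cauchy_schwarz[of "- err" "S y"] by (simp add: power2_eq_square)
      have "m / C2\<^sup>2 * (norm (u t - \<xi>))\<^sup>2 \<le> m / C2\<^sup>2 * (C2 * norm y)\<^sup>2"
        using m C2 by (intro mult_left_mono power_mono) (auto simp: y_def)
      also have "\<dots> = m * (norm y)\<^sup>2" using C2 by (simp add: power_mult_distrib)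
      also have "\<dots> \<le> 2 * (y' \<bullet> S y)" using 1 2 by (simp add: y' inner_add_left)
      finally show ?thesis .
    qed
    ultimately show "\<exists>D. ((\<lambda>t. W (u t)) has_real_derivative D) (at t) \<and> m / C2\<^sup>2 * (norm (u t - \<xi>))\<^sup>2 \<le> D"
      by blast
  qed
qed

lemma hyperbolic_isolated:
  fixes f :: "real^'n \<Rightarrow> real^'n"
  assumes sm: "smooth f" and hyp: "hyperbolic f \<xi>" and E: "eigenbasis f \<xi> E"
  obtains \<epsilon> where "0 < \<epsilon>"
    "\<And>u K t0. solves f u \<Longrightarrow> compact K \<Longrightarrow> K \<subseteq> ball \<xi> \<epsilon> \<Longrightarrow> (\<And>t. t0 \<le> t \<Longrightarrow> u t \<in> K) \<Longrightarrow> (u \<longlongrightarrow> \<xi>) at_top"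
    "\<And>u K t0. solves f u \<Longrightarrow> compact K \<Longrightarrow> K \<subseteq> ball \<xi> \<epsilon> \<Longrightarrow> (\<And>t. t \<le> t0 \<Longrightarrow> u t \<in> K) \<Longrightarrow> (u \<longlongrightarrow> \<xi>) at_bot"
proof -
  have "times_cont_diff 1 f" using sm unfolding smooth_def by blast
  then have diff: "\<And>x. f differentiable (at x)" by (simp add: differentiable_on_def)
  have contf: "continuous_on A f" for A
    using diff by (meson continuous_at_imp_continuous_on differentiable_imp_continuous_within)
  obtain W \<mu> \<epsilon> where W: "0 < \<mu>" "0 < \<epsilon>" "continuous_on UNIV W"
    "\<And>u t. solves f u \<Longrightarrow> norm (u t - \<xi>) < \<epsilon> \<Longrightarrow>
      \<exists>D. ((\<lambda>t. W (u t)) has_real_derivative D) (at t) \<and> \<mu> * (norm (u t - \<xi>))\<^sup>2 \<le> D"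
    using hyperbolic_lyapunov_function[OF diff hyp E] by metis
  have lip: "\<exists>L. \<forall>s t. s \<le> t \<longrightarrow> (\<forall>r\<in>{s..t}. u r \<in> K) \<longrightarrow> \<bar>norm (u t - \<xi>) - norm (u s - \<xi>)\<bar> \<le> L * (t - s)"
    if u: "solves f u" and K: "compact K" for u K
  proof -
    have "bounded (f ` K)" by (intro compact_imp_bounded compact_continuous_image contf K)
    then obtain L where L: "\<And>x. x \<in> K \<Longrightarrow> norm (f x) \<le> L" unfolding bounded_iff by blast
    have "\<bar>norm (u t - \<xi>) - norm (u s - \<xi>)\<bar> \<le> L * (t - s)"
      if st: "s \<le> t" "\<And>r. r \<in> {s..t} \<Longrightarrow> u r \<in> K" for s t
    proof -
      have "norm (u t - u s) \<le> L * norm (t - s)"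
      proof (rule differentiable_bound[of "{s..t}"])
        fix r assume r: "r \<in> {s..t}"
        show "(u has_derivative (\<lambda>h. h *\<^sub>R f (u r))) (at r within {s..t})"
          using u unfolding solves_def has_vector_derivative_def by (blast intro: has_derivative_at_withinI)
        show "onorm (\<lambda>h. h *\<^sub>R f (u r)) \<le> L"
          by (rule onorm_le) (use mult_right_mono[OF L[OF st(2)[OF r]]] in \<open>simp add: mult.commute[of _ L] mult.commute[of _ "norm (f (u r))"]\<close>)
      qed (use st in auto)
      then show ?thesis
        using norm_triangle_ineq3[of "u t - \<xi>" "u s - \<xi>"] st by simp
    qed
    then show ?thesis by blast
  qed
  have bdd: "\<exists>B. \<forall>x\<in>K. \<bar>W x\<bar> \<le> B" if "compact K" for K
  proof -
    have "bounded (W ` K)"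
      by (intro compact_imp_bounded compact_continuous_image continuous_on_subset[OF W(3)] that) auto
    then show ?thesis unfolding bounded_iff by auto
  qed
  have near: "norm (x - \<xi>) < \<epsilon>" if "K \<subseteq> ball \<xi> \<epsilon>" "x \<in> K" for x K
    using that by (auto simp: dist_norm norm_minus_commute subset_iff)
  have fwd: "(u \<longlongrightarrow> \<xi>) at_top"
    if u: "solves f u" and K: "compact K" "K \<subseteq> ball \<xi> \<epsilon>" and uK: "\<And>t. t0 \<le> t \<Longrightarrow> u t \<in> K" for u K t0
  proof -
    obtain L where L: "\<And>s t. s \<le> t \<Longrightarrow> (\<forall>r\<in>{s..t}. u r \<in> K) \<Longrightarrow> \<bar>norm (u t - \<xi>) - norm (u s - \<xi>)\<bar> \<le> L * (t - s)"
      using lip[OF u K(1)] by blast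
    obtain B where B: "\<And>x. x \<in> K \<Longrightarrow> \<bar>W x\<bar> \<le> B" using bdd[OF K(1)] by blast
    have "((\<lambda>t. norm (u t - \<xi>)) \<longlongrightarrow> 0) at_top"
    proof (rule barbalat[OF W(1)])
      show "\<exists>D. ((\<lambda>t. W (u t)) has_real_derivative D) (at t) \<and> \<mu> * (norm (u t - \<xi>))\<^sup>2 \<le> D" if "t0 \<le> t" for t
        by (rule W(4)[OF u near[OF K(2) uK[OF that]]])
      show "W (u t) \<le> B" if "t0 \<le> t" for t using B[OF uK[OF that]] by simp
      show "\<bar>norm (u t - \<xi>) - norm (u s - \<xi>)\<bar> \<le> L * (t - s)" if "t0 \<le> s" "s \<le> t" for s t
        using that uK by (intro L) auto
    qed simp
    then show ?thesis by (simp add: tendsto_norm_zero_iff LIM_zero_iff)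
  qed
  have bwd: "(u \<longlongrightarrow> \<xi>) at_bot"
    if u: "solves f u" and K: "compact K" "K \<subseteq> ball \<xi> \<epsilon>" and uK: "\<And>t. t \<le> t0 \<Longrightarrow> u t \<in> K" for u K t0
  proof -
    obtain L where L: "\<And>s t. s \<le> t \<Longrightarrow> (\<forall>r\<in>{s..t}. u r \<in> K) \<Longrightarrow> \<bar>norm (u t - \<xi>) - norm (u s - \<xi>)\<bar> \<le> L * (t - s)"
      using lip[OF u K(1)] by blast
    obtain B where B: "\<And>x. x \<in> K \<Longrightarrow> \<bar>W x\<bar> \<le> B" using bdd[OF K(1)] by blast
    have "((\<lambda>t. norm (u (- t) - \<xi>)) \<longlongrightarrow> 0) at_top"
    proof (rule barbalat[OF W(1), of "- t0" "\<lambda>t. - W (u (- t))"])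
      show "\<exists>D. ((\<lambda>t. - W (u (- t))) has_real_derivative D) (at t) \<and> \<mu> * (norm (u (- t) - \<xi>))\<^sup>2 \<le> D"
        if "- t0 \<le> t" for t
      proof -
        have "- t \<le> t0" using that by linarith
        from W(4)[OF u near[OF K(2) uK[OF this]]]
        obtain D where D: "((\<lambda>t. W (u t)) has_real_derivative D) (at (- t))" "\<mu> * (norm (u (- t) - \<xi>))\<^sup>2 \<le> D"
          by blast
        have "((\<lambda>t. - W (u (- t))) has_real_derivative - (D * (- 1))) (at t)"
          by (intro DERIV_minus DERIV_chain'[of uminus "-1" t UNIV "\<lambda>t. W (u t)" D])
            (use D in \<open>auto intro!: derivative_eq_intros\<close>)
        then show ?thesis using D(2) by auto
      qed
      show "- W (u (- t)) \<le> B" if "- t0 \<le> t" for t using B[OF uK[of "- t"]] that by linarith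
      show "\<bar>norm (u (- t) - \<xi>) - norm (u (- s) - \<xi>)\<bar> \<le> L * (t - s)" if "- t0 \<le> s" "s \<le> t" for s t
        using L[of "- t" "- s"] that uK by auto
    qed simp
    then have "((\<lambda>t. u (- t)) \<longlongrightarrow> \<xi>) at_top" by (simp add: tendsto_norm_zero_iff LIM_zero_iff)
    then show ?thesis by (simp add: filterlim_at_bot_mirror)
  qed
  show ?thesis by (rule that[OF W(2) fwd bwd])
qed

section \<open>Trajectories near the network\<close>
definition exits :: "(real \<Rightarrow> 'a) \<Rightarrow> 'a set \<Rightarrow> real \<Rightarrow> real \<Rightarrow> bool" where
  "exits u N p T \<longleftrightarrow> (\<forall>t\<in>{p - T<..<p}. u t \<in> N) \<and> u p \<notin> N"

definition enters :: "(real \<Rightarrow> 'a) \<Rightarrow> 'a set \<Rightarrow> real \<Rightarrow> real \<Rightarrow> bool" where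
  "enters u N q T \<longleftrightarrow> (\<forall>t\<in>{q<..<q + T}. u t \<in> N) \<and> u q \<notin> N"

lemma exits_mono: "exits u N p T \<Longrightarrow> T' \<le> T \<Longrightarrow> exits u N p T'"
  by (auto simp: exits_def)

lemma enters_mono: "enters u N q T \<Longrightarrow> T' \<le> T \<Longrightarrow> enters u N q T'"
  by (auto simp: enters_def)

lemma exits_closure:
  fixes u :: "real \<Rightarrow> 'a::topological_space"
  assumes "exits u N p T" "0 < T" "continuous_on UNIV u" "N \<subseteq> B" "closed B"
  shows "u p \<in> B"
proof -
  have "u ` closure {p - T<..<p} \<subseteq> B"
    using assms by (intro image_closure_subset) (auto simp: exits_def intro: continuous_on_subset)
  then show ?thesis using assms(2) by (auto simp: image_subset_iff)
qed

lemma enters_closure: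
  fixes u :: "real \<Rightarrow> 'a::topological_space"
  assumes "enters u N q T" "0 < T" "continuous_on UNIV u" "N \<subseteq> B" "closed B"
  shows "u q \<in> B"
proof -
  have "u ` closure {q<..<q + T} \<subseteq> B"
    using assms by (intro image_closure_subset) (auto simp: enters_def intro: continuous_on_subset)
  then show ?thesis using assms(2) by (auto simp: image_subset_iff)
qed

text \<open>Uniform constants over finitely many equilibria, faces or triples are all obtained in the same way:
  a natural number \<open>n\<close> stands for the thresholds \<open>n + 1\<close> for times and \<open>1 / (n + 1)\<close> for distances.\<close>
lemma finite_common_bound:
  fixes P :: "'a \<Rightarrow> nat \<Rightarrow> bool"
  assumes "finite S" "\<And>s. s \<in> S \<Longrightarrow> \<exists>n. P s n" "\<And>s m n. P s m \<Longrightarrow> m \<le> n \<Longrightarrow> P s n"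
  shows "\<exists>n. \<forall>s\<in>S. P s n"
  using assms(1,2)
proof (induction S)
  case (insert a S)
  then obtain n m where nm: "\<forall>s\<in>S. P s n" "P a m" by (metis insertI1 insertI2)
  have "P s (max m n)" if "s \<in> insert a S" for s
  proof (cases "s = a")
    case True
    then show ?thesis using assms(3)[OF nm(2) max.cobounded1] by simp
  next
    case False
    then have "P s n" using nm(1) that by simp
    then show ?thesis by (rule assms(3)[OF _ max.cobounded2])
  qed
  then show ?case by blast
qed simp

lemma compact_subsequence:
  fixes x :: "nat \<Rightarrow> 'a::metric_space"
  assumes "compact K" "\<And>n. x n \<in> K"
  obtains l \<rho> where "l \<in> K" "strict_mono \<rho>" "(\<lambda>n. x (\<rho> n)) \<longlonglongrightarrow> l"
  using seq_compactE[OF compact_imp_seq_compact[OF assms(1)], of x] assms(2) unfolding o_def by metis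

lemma tendsto_bot_unstable: "((\<lambda>t. \<Phi> t x) \<longlongrightarrow> c) at_bot \<Longrightarrow> x \<in> unstable_set \<Phi> {c}"
proof -
  assume lim: "((\<lambda>t. \<Phi> t x) \<longlongrightarrow> c) at_bot"
  have k: "filterlim (\<lambda>k. - real k) at_bot sequentially"
    by (simp add: filterlim_uminus_at_top[symmetric] filterlim_real_sequentially)
  have "c \<in> alpha_limit \<Phi> x"
    unfolding alpha_limit_def by (intro CollectI exI[of _ "\<lambda>k. - real k"] conjI filterlim_compose[OF lim] k)
  moreover have "alpha_limit \<Phi> x \<subseteq> {c}"
  proof
    fix z assume "z \<in> alpha_limit \<Phi> x"
    then obtain t :: "nat \<Rightarrow> real" where t: "filterlim t at_bot sequentially" "(\<lambda>k. \<Phi> (t k) x) \<longlonglongrightarrow> z"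
      unfolding alpha_limit_def by blast
    show "z \<in> {c}" using LIMSEQ_unique[OF t(2) filterlim_compose[OF lim t(1)]] by simp
  qed
  ultimately show ?thesis by (auto simp: unstable_set_def)
qed

lemma tendsto_top_stable: "((\<lambda>t. \<Phi> t x) \<longlongrightarrow> c) at_top \<Longrightarrow> x \<in> stable_set \<Phi> {c}"
proof -
  assume lim: "((\<lambda>t. \<Phi> t x) \<longlongrightarrow> c) at_top"
  have "c \<in> omega_limit \<Phi> x"
    unfolding omega_limit_def
    by (intro CollectI exI[of _ real] conjI filterlim_compose[OF lim] filterlim_real_sequentially)
  moreover have "omega_limit \<Phi> x \<subseteq> {c}"
  proof
    fix z assume "z \<in> omega_limit \<Phi> x"
    then obtain t :: "nat \<Rightarrow> real" where t: "filterlim t at_top sequentially" "(\<lambda>k. \<Phi> (t k) x) \<longlonglongrightarrow> z"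
      unfolding omega_limit_def by blast
    show "z \<in> {c}" using LIMSEQ_unique[OF t(2) filterlim_compose[OF lim t(1)]] by simp
  qed
  ultimately show ?thesis by (auto simp: stable_set_def)
qed

text \<open>\<open>Q\<close> is the set of equilibria of the network, and \<open>r\<close> is so small that the closed boxes are disjoint
  and isolate their equilibria. Every point of \<open>Y\<close> is on a connection, where an equilibrium counts as a
  point of the connection to itself.\<close>
locale heteroclinic_dynamics =
  fixes f :: "real^'n \<Rightarrow> real^'n" and \<Phi> :: "real \<Rightarrow> real^'n \<Rightarrow> real^'n" and Y Q :: "(real^'n) set"
    and E :: "real^'n \<Rightarrow> complex^'n^'n" and r :: real
  assumes sm: "smooth f" and fl: "flow_of f \<Phi>"
    and Y: "compact Y" "Y \<noteq> {}" "invariant \<Phi> Y"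
    and Q: "finite Q" "Q \<subseteq> Y" "\<And>c. c \<in> Q \<Longrightarrow> equilibrium f c"
    and Y_connections: "\<And>y. y \<in> Y \<Longrightarrow> \<exists>a\<in>Q. \<exists>b\<in>Q. y \<in> connection \<Phi> a b"
    and unstable_Y: "\<And>c. c \<in> Q \<Longrightarrow> unstable_set \<Phi> {c} \<subseteq> Y"
    and basis: "\<And>c. c \<in> Q \<Longrightarrow> eigenbasis f c (E c)"
    and r: "0 < r"
    and disjoint: "\<And>c d. c \<in> Q \<Longrightarrow> d \<in> Q \<Longrightarrow> c \<noteq> d \<Longrightarrow> closed_box (E c) c r \<inter> closed_box (E d) d r = {}"
    and isolated_top: "\<And>c u t0. c \<in> Q \<Longrightarrow> solves f u \<Longrightarrow> (\<And>t. t0 \<le> t \<Longrightarrow> u t \<in> closed_box (E c) c r) \<Longrightarrow> (u \<longlongrightarrow> c) at_top"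
    and isolated_bot: "\<And>c u t0. c \<in> Q \<Longrightarrow> solves f u \<Longrightarrow> (\<And>t. t \<le> t0 \<Longrightarrow> u t \<in> closed_box (E c) c r) \<Longrightarrow> (u \<longlongrightarrow> c) at_bot"
begin

abbreviation "N c \<equiv> box_nbhd (E c) c r"
abbreviation "B c \<equiv> closed_box (E c) c r"
abbreviation "d x \<equiv> maxdist x Y"
abbreviation "entry_faces a c \<equiv> faces_meeting (E c) c r (connection \<Phi> a c)"
abbreviation "exit_faces c b \<equiv> faces_meeting (E c) c r (connection \<Phi> c b)"
abbreviation "edge a c \<equiv> connection_in f \<Phi> Y a c"

lemma N_sub_B: "N c \<subseteq> B c" by (rule box_subset_closed_box)

lemma compact_B: "c \<in> Q \<Longrightarrow> compact (B c)"
  using basis by (intro compact_closed_box) (auto simp: eigenbasis_def)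

lemma center_N: "c \<in> N c" using r by (rule center_in_box)

lemma limit_in_closed:
  assumes "\<And>n. solves f (v n)" "(\<lambda>n. v n 0) \<longlonglongrightarrow> p" "closed C" "\<forall>\<^sub>F n in sequentially. v n t \<in> C"
  shows "\<Phi> t p \<in> C"
proof -
  have "(\<lambda>n. v n t) \<longlonglongrightarrow> \<Phi> t p"
    by (rule solves_tendsto[OF sm flow_solves[OF fl] assms(1)]) (simp add: assms(2) flow_zero[OF fl])
  then show ?thesis using Lim_in_closed_set[OF assms(3,4)] by simp
qed

lemma backward_in_box: "c \<in> Q \<Longrightarrow> (\<And>t. t \<le> t0 \<Longrightarrow> \<Phi> t x \<in> B c) \<Longrightarrow> x \<in> unstable_set \<Phi> {c}"
  by (intro tendsto_bot_unstable isolated_bot flow_solves[OF fl])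

lemma forward_in_box: "c \<in> Q \<Longrightarrow> (\<And>t. t0 \<le> t \<Longrightarrow> \<Phi> t x \<in> B c) \<Longrightarrow> x \<in> stable_set \<Phi> {c}"
  by (intro tendsto_top_stable isolated_top flow_solves[OF fl])

lemma eventually_bot_in_open:
  assumes y: "y \<in> Y" "y \<in> unstable_set \<Phi> {a}" and U: "open U" "a \<in> U"
  shows "\<exists>S. \<forall>t\<le>S. \<Phi> t y \<in> U"
proof (rule ccontr)
  assume "\<not> ?thesis"
  then have "\<forall>n::nat. \<exists>t. t \<le> - real n \<and> \<Phi> t y \<notin> U" by blast
  then obtain t where "\<forall>n. t n \<le> - real n \<and> \<Phi> (t n) y \<notin> U" unfolding choice_iff by blast
  then have t: "\<And>n. t n \<le> - real n" "\<And>n. \<Phi> (t n) y \<notin> U" by blast+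
  have "\<Phi> (t n) y \<in> Y" for n using Y(3) y(1) by (simp add: invariant_def)
  then obtain z \<rho> where z: "z \<in> Y" "strict_mono \<rho>" "(\<lambda>n. \<Phi> (t (\<rho> n)) y) \<longlonglongrightarrow> z"
    by (rule compact_subsequence[OF Y(1)])
  have "filterlim (\<lambda>n. - real n) at_bot sequentially"
    by (simp add: filterlim_uminus_at_top[symmetric] filterlim_real_sequentially)
  then have "filterlim t at_bot sequentially"
    using t(1) by (rule filterlim_at_bot_mono[OF _ always_eventually, rule_format])
  then have "filterlim (\<lambda>n. t (\<rho> n)) at_bot sequentially"
    by (rule filterlim_compose[OF _ filterlim_subseq[OF z(2)]])
  then have "z \<in> alpha_limit \<Phi> y"
    unfolding alpha_limit_def using z(3) by (intro CollectI exI[of _ "\<lambda>n. t (\<rho> n)"] conjI)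
  then have "z = a" using y by (auto simp: unstable_set_def)
  then have "\<forall>\<^sub>F n in sequentially. \<Phi> (t (\<rho> n)) y \<in> U" using topological_tendstoD[OF z(3) U(1)] U(2) by simp
  then show False using t(2) by simp
qed

lemma eventually_top_in_open:
  assumes y: "y \<in> Y" "y \<in> stable_set \<Phi> {a}" and U: "open U" "a \<in> U"
  shows "\<exists>S. \<forall>t\<ge>S. \<Phi> t y \<in> U"
proof (rule ccontr)
  assume "\<not> ?thesis"
  then have "\<forall>n::nat. \<exists>t. t \<ge> real n \<and> \<Phi> t y \<notin> U" by blast
  then obtain t where "\<forall>n. t n \<ge> real n \<and> \<Phi> (t n) y \<notin> U" unfolding choice_iff by blast
  then have t: "\<And>n. t n \<ge> real n" "\<And>n. \<Phi> (t n) y \<notin> U" by blast+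
  have "\<Phi> (t n) y \<in> Y" for n using Y(3) y(1) by (simp add: invariant_def)
  then obtain z \<rho> where z: "z \<in> Y" "strict_mono \<rho>" "(\<lambda>n. \<Phi> (t (\<rho> n)) y) \<longlonglongrightarrow> z"
    by (rule compact_subsequence[OF Y(1)])
  have "filterlim t at_top sequentially"
    using t(1) by (rule filterlim_at_top_mono[OF filterlim_real_sequentially always_eventually, rule_format])
  then have "filterlim (\<lambda>n. t (\<rho> n)) at_top sequentially"
    by (rule filterlim_compose[OF _ filterlim_subseq[OF z(2)]])
  then have "z \<in> omega_limit \<Phi> y"
    unfolding omega_limit_def using z(3) by (intro CollectI exI[of _ "\<lambda>n. t (\<rho> n)"] conjI)
  then have "z = a" using y by (auto simp: stable_set_def)
  then have "\<forall>\<^sub>F n in sequentially. \<Phi> (t (\<rho> n)) y \<in> U" using topological_tendstoD[OF z(3) U(1)] U(2) by simp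
  then show False using t(2) by simp
qed

lemma growth:
  obtains \<delta> K where "0 < \<delta>" "1 \<le> K"
    "\<And>u s t. solves f u \<Longrightarrow> d (u s) < \<delta> \<Longrightarrow> \<bar>t - s\<bar> \<le> S \<Longrightarrow> d (u t) \<le> K * d (u s)"
proof -
  obtain \<delta> K where *: "0 < \<delta>" "1 \<le> K"
    "\<And>u t. solves f u \<Longrightarrow> d (u 0) < \<delta> \<Longrightarrow> \<bar>t\<bar> \<le> S \<Longrightarrow> d (u t) \<le> K * d (u 0)"
    using maxdist_growth[OF sm fl Y] by blast
  have "d (u t) \<le> K * d (u s)" if "solves f u" "d (u s) < \<delta>" "\<bar>t - s\<bar> \<le> S" for u s t
    using *(3)[OF solves_shift[OF that(1), of s], of "t - s"] that by simp
  then show ?thesis by (rule that[OF *(1,2)])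
qed

lemma one_div_subseq:
  assumes "strict_mono (\<rho> :: nat \<Rightarrow> nat)" shows "1 / real (Suc (\<rho> n)) \<le> 1 / real (Suc n)"
  using seq_suble[OF assms, of n] by (simp add: frac_le)

definition stays :: "(real \<Rightarrow> real^'n) \<Rightarrow> real^'n \<Rightarrow> real \<Rightarrow> real \<Rightarrow> bool" where
  "stays u c s t \<longleftrightarrow> solves f u \<and> s \<le> t \<and> (\<forall>\<tau>\<in>{s..t}. u \<tau> \<in> B c)"

text \<open>Otherwise there are stays in the box that start ever closer to \<open>Y\<close> and end at distance at least \<open>\<epsilon>\<close>.
  By the growth estimate their durations tend to infinity, so the backward orbit of a limit of the
  end points never leaves the box. That limit is on the unstable manifold, hence in \<open>Y\<close>.\<close>
lemma stay_close_one:
  assumes c: "c \<in> Q" and \<epsilon>: "0 < \<epsilon>"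
  shows "\<exists>n::nat. \<forall>u s t. stays u c s t \<and> d (u s) < 1 / real (Suc n) \<longrightarrow> d (u t) < \<epsilon>"
proof (rule ccontr)
  assume "\<not> ?thesis"
  then have "\<forall>n::nat. \<exists>u s t. stays u c s t \<and> d (u s) < 1 / real (Suc n) \<and> \<not> d (u t) < \<epsilon>"
    by blast
  then obtain u s t where *: "\<forall>n. stays (u n) c (s n) (t n) \<and>
      d (u n (s n)) < 1 / real (Suc n) \<and> \<not> d (u n (t n)) < \<epsilon>"
    unfolding choice_iff by blast
  then have u: "\<And>n. solves f (u n)" and st: "\<And>n. s n \<le> t n"
    and uB: "\<And>n \<tau>. s n \<le> \<tau> \<Longrightarrow> \<tau> \<le> t n \<Longrightarrow> u n \<tau> \<in> B c"
    and small: "\<And>n. d (u n (s n)) < 1 / real (Suc n)" and big: "\<And>n. \<epsilon> \<le> d (u n (t n))"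
    unfolding stays_def by (auto simp del: not_less simp: not_less[symmetric])
  have "u n (t n) \<in> B c" for n using uB st by blast
  then obtain p \<rho> where p: "p \<in> B c" "strict_mono \<rho>" "(\<lambda>n. u (\<rho> n) (t (\<rho> n))) \<longlonglongrightarrow> p"
    by (rule compact_subsequence[OF compact_B[OF c]])
  define v where "v n \<tau> = u (\<rho> n) (t (\<rho> n) + \<tau>)" for n \<tau>
  have v: "solves f (v n)" for n unfolding v_def by (rule solves_shift[OF u])
  have v0: "(\<lambda>n. v n 0) \<longlonglongrightarrow> p" using p(3) by (simp add: v_def o_def)
  have "\<Phi> \<tau> p \<in> B c" if "\<tau> \<le> 0" for \<tau>
  proof (rule limit_in_closed[OF v v0 closed_closed_box])
    obtain \<delta> K where K: "0 < \<delta>" "1 \<le> K"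
      "\<And>u s t. solves f u \<Longrightarrow> d (u s) < \<delta> \<Longrightarrow> \<bar>t - s\<bar> \<le> - \<tau> \<Longrightarrow> d (u t) \<le> K * d (u s)"
      using growth by blast
    \<comment> \<open>Within time \<open>- \<tau>\<close> the distance grows at most by the factor \<open>K\<close>.\<close>
    have long: "s n \<le> t n + \<tau>" if n: "1 / real (Suc n) < min \<delta> (\<epsilon> / K)" for n
    proof (rule ccontr)
      assume "\<not> ?thesis"
      then have "d (u n (t n)) \<le> K * d (u n (s n))"
        using st[of n] small[of n] n by (intro K u) auto
      also have "\<dots> < K * (\<epsilon> / K)" using small[of n] n K by (intro mult_strict_left_mono) auto
      finally show False using big[of n] K by simp
    qed
    have "\<forall>\<^sub>F n in sequentially. 1 / real (Suc n) < min \<delta> (\<epsilon> / K)"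
      using order_tendstoD(2)[OF LIMSEQ_inverse_real_of_nat, of "min \<delta> (\<epsilon> / K)"] K \<epsilon>
      by (simp add: inverse_eq_divide)
    then show "\<forall>\<^sub>F n in sequentially. v n \<tau> \<in> B c"
    proof (rule eventually_mono)
      fix n assume "1 / real (Suc n) < min \<delta> (\<epsilon> / K)"
      then have "1 / real (Suc (\<rho> n)) < min \<delta> (\<epsilon> / K)" using one_div_subseq[OF p(2), of n] by linarith
      from long[OF this] show "v n \<tau> \<in> B c" unfolding v_def using that by (intro uB) auto
    qed
  qed
  then have "p \<in> Y" using backward_in_box[OF c] unstable_Y[OF c] by blast
  then have "d p \<le> 0" using maxdist_mem_iff[OF Y(1,2)] by blast
  moreover have "\<epsilon> \<le> d p"
    using LIMSEQ_le_const[OF tendsto_maxdist[OF Y(1,2) p(3)]] big by (simp add: o_def)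
  ultimately show False using \<epsilon> by simp
qed

lemma stay_close:
  assumes \<epsilon>: "0 < \<epsilon>"
  obtains \<delta> where "0 < \<delta>"
    "\<And>u c s t. solves f u \<Longrightarrow> c \<in> Q \<Longrightarrow> s \<le> t \<Longrightarrow> (\<And>\<tau>. s \<le> \<tau> \<Longrightarrow> \<tau> \<le> t \<Longrightarrow> u \<tau> \<in> B c) \<Longrightarrow> d (u s) < \<delta> \<Longrightarrow> d (u t) < \<epsilon>"
proof -
  have "\<exists>n::nat. \<forall>c\<in>Q. \<forall>u s t. stays u c s t \<and> d (u s) < 1 / real (Suc n) \<longrightarrow> d (u t) < \<epsilon>"
  proof (rule finite_common_bound[OF Q(1) stay_close_one[OF _ \<epsilon>]])
    fix c m and n :: nat assume *: "\<forall>u s t. stays u c s t \<and> d (u s) < 1 / real (Suc m) \<longrightarrow> d (u t) < \<epsilon>" "m \<le> n"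
    then have "1 / real (Suc n) \<le> 1 / real (Suc m)" by (simp add: frac_le)
    then show "\<forall>u s t. stays u c s t \<and> d (u s) < 1 / real (Suc n) \<longrightarrow> d (u t) < \<epsilon>"
      using *(1) order_less_le_trans by blast
  qed auto
  then obtain n :: nat where "\<forall>c\<in>Q. \<forall>u s t. stays u c s t \<and> d (u s) < 1 / real (Suc n) \<longrightarrow> d (u t) < \<epsilon>"
    by blast
  then show ?thesis unfolding stays_def by (intro that[of "1 / real (Suc n)"]) (simp, meson atLeastAtMost_iff)
qed

text \<open>The condition under which a passage through the box of \<open>c\<close> that ends at \<open>x\<close>, followed by one through
  the box of \<open>e\<close> that begins at \<open>y\<close>, is consistent with the edge from \<open>c\<close> to \<open>e\<close>.\<close>
definition matched :: "real^'n \<Rightarrow> real^'n \<Rightarrow> real^'n \<Rightarrow> real^'n \<Rightarrow> bool" where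
  "matched c e x y \<longleftrightarrow> edge c e \<and>
     x \<in> exit_faces c e \<and> y \<in> entry_faces c e"

definition gap_of_length :: "real \<Rightarrow> nat \<Rightarrow> (real \<Rightarrow> real^'n) \<Rightarrow> real^'n \<Rightarrow> real \<Rightarrow> real^'n \<Rightarrow> real \<Rightarrow> bool" where
  "gap_of_length S n u c p e q \<longleftrightarrow> solves f u \<and> p \<le> q \<and> q \<le> p + S \<and>
    exits u (N c) p (real (Suc n)) \<and> enters u (N e) q (real (Suc n))"

lemma gap_of_length_mono: "gap_of_length S n u c p e q \<Longrightarrow> m \<le> n \<Longrightarrow> gap_of_length S m u c p e q"
  unfolding gap_of_length_def by (auto intro: exits_mono enters_mono)

text \<open>Let the stays on both sides of the gap get longer and longer. The backward orbit of a limit \<open>p'\<close> of the exit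
  points stays in the box of \<open>c\<close>, and after time \<open>S\<close> its forward orbit stays in the box of \<open>e\<close>; so
  \<open>p'\<close> is on the connection, and it is on the face because faces are closed. The
  same holds for a limit \<open>q'\<close> of the entry points.\<close>
lemma matching_one:
  assumes c: "c \<in> Q" and e: "e \<in> Q" and F: "F \<in> faces (E c) c r" and G: "G \<in> faces (E e) e r"
  shows "\<exists>n::nat. \<forall>u p q. gap_of_length S n u c p e q \<and> u p \<in> F \<and> u q \<in> G \<longrightarrow> matched c e (u p) (u q)"
proof (rule ccontr)
  assume neg: "\<not> ?thesis"
  then have "\<forall>n::nat. \<exists>u p q. gap_of_length S n u c p e q \<and> u p \<in> F \<and> u q \<in> G \<and> \<not> matched c e (u p) (u q)"
    by blast
  then obtain u p q where *: "\<forall>n::nat. gap_of_length S n (u n) c (p n) e (q n) \<and> u n (p n) \<in> F \<and> u n (q n) \<in> G \<and>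
    \<not> matched c e (u n (p n)) (u n (q n))"
    unfolding choice_iff by blast
  then have u: "\<And>n. solves f (u n)" and pq: "\<And>n. p n \<le> q n" "\<And>n. q n \<le> p n + S"
    and ex: "\<And>n. exits (u n) (N c) (p n) (real (Suc n))"
    and en: "\<And>n. enters (u n) (N e) (q n) (real (Suc n))"
    and uF: "\<And>n. u n (p n) \<in> F" and uG: "\<And>n. u n (q n) \<in> G"
    and not: "\<And>n. \<not> matched c e (u n (p n)) (u n (q n))"
    unfolding gap_of_length_def by blast+
  have FB: "F \<subseteq> B c - N c" and GB: "G \<subseteq> B e - N e" using face_subset F G by blast+
  have closed: "closed F" "closed G" using closed_face F G by blast+
  have "u n (p n) \<in> B c" for n using uF FB by blast
  then obtain p' \<rho> where p': "p' \<in> B c" "strict_mono \<rho>" "(\<lambda>n. u (\<rho> n) (p (\<rho> n))) \<longlonglongrightarrow> p'"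
    by (rule compact_subsequence[OF compact_B[OF c]])
  define v where "v n \<tau> = u (\<rho> n) (p (\<rho> n) + \<tau>)" for n \<tau>
  have v: "solves f (v n)" for n unfolding v_def by (rule solves_shift[OF u])
  have v0: "(\<lambda>n. v n 0) \<longlonglongrightarrow> p'" using p'(3) by (simp add: v_def o_def)
  have p'F: "p' \<in> F" by (rule Lim_in_closed_set[OF closed(1) _ _ p'(3)]) (use uF in auto)
  have large: "\<forall>\<^sub>F n in sequentially. a < real (Suc (\<rho> n))" for a
  proof -
    have "\<forall>\<^sub>F n in sequentially. a < real n" by (rule filterlim_real_sequentially[unfolded filterlim_at_top_dense, rule_format])
    then show ?thesis
    proof (rule eventually_mono)
      fix n assume "a < real n"
      then show "a < real (Suc (\<rho> n))" using seq_suble[OF p'(2), of n] by linarith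
    qed
  qed
  have p'c: "p' \<in> unstable_set \<Phi> {c}"
  proof (rule backward_in_box[OF c, of "-1"])
    fix \<tau> :: real assume \<tau>: "\<tau> \<le> -1"
    show "\<Phi> \<tau> p' \<in> B c"
    proof (rule limit_in_closed[OF v v0 closed_closed_box], rule eventually_mono[OF large[of "- \<tau>"]])
      fix n assume "- \<tau> < real (Suc (\<rho> n))"
      then show "v n \<tau> \<in> B c" using ex[of "\<rho> n"] \<tau> N_sub_B unfolding exits_def v_def by fastforce
    qed
  qed
  have p'e: "p' \<in> stable_set \<Phi> {e}"
  proof (rule forward_in_box[OF e, of "S + 1"])
    fix \<tau> assume \<tau>: "S + 1 \<le> \<tau>"
    show "\<Phi> \<tau> p' \<in> B e"
    proof (rule limit_in_closed[OF v v0 closed_closed_box], rule eventually_mono[OF large[of "\<tau>"]])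
      fix n assume n: "\<tau> < real (Suc (\<rho> n))"
      have "p (\<rho> n) + \<tau> \<in> {q (\<rho> n)<..<q (\<rho> n) + real (Suc (\<rho> n))}"
        using n \<tau> pq[of "\<rho> n"] by simp
      then show "v n \<tau> \<in> B e" using en[of "\<rho> n"] N_sub_B unfolding enters_def v_def by blast
    qed
  qed
  have conn: "p' \<in> connection \<Phi> c e" using p'c p'e by (simp add: connection_def)
  have ne: "p' \<noteq> c" "p' \<noteq> e"
  proof -
    show "p' \<noteq> c" using p'F FB center_N by blast
    then show "p' \<noteq> e" using disjoint[OF c e] p'(1) center_N[of e] N_sub_B[of e] by blast
  qed
  have in_Y: "edge c e"
    unfolding connection_in_def connected_to_def
    using c e Q(2,3) conn ne unstable_Y[OF c] by (auto simp: connection_def)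
  have "u (\<rho> n) (q (\<rho> n)) \<in> B e" for n using uG GB by blast
  then obtain q' \<rho>' where q': "q' \<in> B e" "strict_mono \<rho>'" "(\<lambda>n. u (\<rho> (\<rho>' n)) (q (\<rho> (\<rho>' n)))) \<longlonglongrightarrow> q'"
    by (rule compact_subsequence[OF compact_B[OF e]])
  define w where "w n \<tau> = u (\<rho> (\<rho>' n)) (q (\<rho> (\<rho>' n)) + \<tau>)" for n \<tau>
  have w: "solves f (w n)" for n unfolding w_def by (rule solves_shift[OF u])
  have w0: "(\<lambda>n. w n 0) \<longlonglongrightarrow> q'" using q'(3) by (simp add: w_def o_def)
  have q'G: "q' \<in> G" by (rule Lim_in_closed_set[OF closed(2) _ _ q'(3)]) (use uG in auto)
  have large': "\<forall>\<^sub>F n in sequentially. a < real (Suc (\<rho> (\<rho>' n)))" for a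
    using eventually_subseq[OF q'(2) large] .
  have q'c: "q' \<in> unstable_set \<Phi> {c}"
  proof (rule backward_in_box[OF c, of "- S - 1"])
    fix \<tau> :: real assume \<tau>: "\<tau> \<le> - S - 1"
    show "\<Phi> \<tau> q' \<in> B c"
    proof (rule limit_in_closed[OF w w0 closed_closed_box], rule eventually_mono[OF large'[of "- \<tau>"]])
      fix n assume n: "- \<tau> < real (Suc (\<rho> (\<rho>' n)))"
      let ?m = "\<rho> (\<rho>' n)"
      have "q ?m + \<tau> \<in> {p ?m - real (Suc ?m)<..<p ?m}" using n \<tau> pq[of ?m] by simp
      then show "w n \<tau> \<in> B c" using ex[of ?m] N_sub_B unfolding exits_def w_def by blast
    qed
  qed
  have q'e: "q' \<in> stable_set \<Phi> {e}"
  proof (rule forward_in_box[OF e, of "1"])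
    fix \<tau> :: real assume \<tau>: "1 \<le> \<tau>"
    show "\<Phi> \<tau> q' \<in> B e"
    proof (rule limit_in_closed[OF w w0 closed_closed_box], rule eventually_mono[OF large'[of "\<tau>"]])
      fix n assume "\<tau> < real (Suc (\<rho> (\<rho>' n)))"
      then show "w n \<tau> \<in> B e" using en[of "\<rho> (\<rho>' n)"] \<tau> N_sub_B unfolding enters_def w_def by fastforce
    qed
  qed
  have "q' \<in> connection \<Phi> c e" using q'c q'e by (simp add: connection_def)
  then have "matched c e x y" if "x \<in> F" "y \<in> G" for x y
    using that in_Y conn p'F q'G F G unfolding matched_def faces_meeting_def by blast
  then show False using not uF uG by blast
qed

lemma matching_uniform:
  "\<exists>n::nat. \<forall>c\<in>Q. \<forall>e\<in>Q. \<forall>u p q. gap_of_length S n u c p e q \<longrightarrow> matched c e (u p) (u q)"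
proof -
  define P where "P = (\<lambda>(c, e, F, G) (n::nat). \<forall>u p q. gap_of_length S n u c p e q \<and> u p \<in> F \<and> u q \<in> G \<longrightarrow> matched c e (u p) (u q))"
  define T where "T = (SIGMA c:Q. SIGMA e:Q. faces (E c) c r \<times> faces (E e) e r)"
  have "finite T" unfolding T_def by (intro finite_SigmaI Q(1) finite_cartesian_product finite_faces[OF basis])
  moreover have "\<exists>n. P s n" if "s \<in> T" for s
  proof -
    obtain c e F G where s: "s = (c, e, F, G)" by (rule prod_cases4)
    show ?thesis using that matching_one[of c e F G S] unfolding s T_def P_def by simp
  qed
  moreover have "P s n" if "P s m" "m \<le> n" for s m n
  proof -
    obtain c e F G where s: "s = (c, e, F, G)" by (rule prod_cases4)
    show ?thesis
      using that(1) gap_of_length_mono[OF _ that(2)]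
      unfolding P_def s prod.case by blast
  qed
  ultimately obtain n where n: "\<And>s. s \<in> T \<Longrightarrow> P s n" using finite_common_bound[of T P] by blast
  show ?thesis
  proof (intro exI[of _ n] ballI allI impI)
    fix c e u p q
    assume c: "c \<in> Q" and e: "e \<in> Q" and gap: "gap_of_length S n u c p e q"
    have u: "solves f u" and ex: "exits u (N c) p (real (Suc n))" and en: "enters u (N e) q (real (Suc n))"
      using gap by (auto simp: gap_of_length_def)
    have "u p \<in> B c" using exits_closure[OF ex _ solves_continuous[OF u] N_sub_B closed_closed_box] by simp
    then obtain F where F: "F \<in> faces (E c) c r" "u p \<in> F" using boundary_in_face ex unfolding exits_def by blast
    have "u q \<in> B e" using enters_closure[OF en _ solves_continuous[OF u] N_sub_B closed_closed_box] by simp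
    then obtain G where G: "G \<in> faces (E e) e r" "u q \<in> G" using boundary_in_face en unfolding enters_def by blast
    have "P (c, e, F, G) n" using n c e F G by (simp add: T_def)
    then show "matched c e (u p) (u q)" unfolding P_def prod.case using gap F G by blast
  qed
qed

text \<open>The required length of the stays on both sides depends on the length of the gap itself.\<close>
definition gap_pair :: "(real \<Rightarrow> real) \<Rightarrow> (real \<Rightarrow> real^'n) \<Rightarrow> real^'n \<Rightarrow> real \<Rightarrow> real^'n \<Rightarrow> real \<Rightarrow> bool" where
  "gap_pair h u c p e q \<longleftrightarrow> c \<in> Q \<and> e \<in> Q \<and> p \<le> q \<and> exits u (N c) p (h (q - p)) \<and> enters u (N e) q (h (q - p))"

text \<open>Summing the thresholds for all gap lengths up to \<open>x\<close> makes \<open>h\<close> monotone, and \<open>x + 1 \<le> h x\<close> makes gaps nested or disjoint.\<close>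
lemma matching:
  obtains h where "mono h" "\<And>x. x + 1 \<le> h x"
    "\<And>u c p e q. solves f u \<Longrightarrow> gap_pair h u c p e q \<Longrightarrow> matched c e (u p) (u q)"
proof -
  define P where "P k n \<longleftrightarrow> (\<forall>c\<in>Q. \<forall>e\<in>Q. \<forall>u p q. gap_of_length (real k) n u c p e q \<longrightarrow> matched c e (u p) (u q))" for k n :: nat
  have "\<forall>k. \<exists>n. P k n" unfolding P_def using matching_uniform by blast
  then obtain g where g: "\<And>k. P k (g k)" by metis
  define h where "h x = x + 1 + (\<Sum>k\<le>nat \<lceil>x\<rceil>. real (Suc (g k)))" for x :: real
  show ?thesis
  proof (rule that[of h])
    show "mono h" unfolding h_def
    proof (intro monoI add_mono sum_mono2)
      fix x y :: real assume "x \<le> y"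
      then show "{..nat \<lceil>x\<rceil>} \<subseteq> {..nat \<lceil>y\<rceil>}" by (simp add: nat_mono ceiling_mono del: nat_le_eq_zle nat_ceiling_le_eq)
    qed auto
    show "x + 1 \<le> h x" for x by (simp add: h_def sum_nonneg)
    fix u c p e q assume u: "solves f u" and gap: "gap_pair h u c p e q"
    define k where "k = nat \<lceil>q - p\<rceil>"
    have pq: "c \<in> Q" "e \<in> Q" "p \<le> q" and ex: "exits u (N c) p (h (q - p))" and en: "enters u (N e) q (h (q - p))"
      using gap by (simp_all add: gap_pair_def)
    have "real (Suc (g k)) \<le> (\<Sum>k\<le>k. real (Suc (g k)))" by (intro member_le_sum) auto
    then have long: "real (Suc (g k)) \<le> h (q - p)" using pq(3) by (simp add: h_def k_def)
    have "q \<le> p + real k" using real_nat_ceiling_ge[of "q - p"] by (simp add: k_def)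
    then have "gap_of_length (real k) (g k) u c p e q"
      unfolding gap_of_length_def using u pq(3) exits_mono[OF ex long] enters_mono[OF en long] by blast
    then show "matched c e (u p) (u q)" using g[of k] pq(1,2) unfolding P_def by blast
  qed
qed

end

lemma first_exit:
  fixes u :: "real \<Rightarrow> 'a::topological_space"
  assumes cont: "continuous_on UNIV u" and N: "open N" and ab: "a \<le> b" "u b \<notin> N"
    and H: "0 \<le> H" and before: "\<And>s. a - H \<le> s \<Longrightarrow> s \<le> a \<Longrightarrow> u s \<in> N"
  obtains p where "a < p" "p \<le> b" "exits u N p H" "\<And>s. a - H \<le> s \<Longrightarrow> s < p \<Longrightarrow> u s \<in> N"
proof -
  define Z where "Z = {a..b} \<inter> u -` (- N)"
  have "closed Z" unfolding Z_def
    by (rule continuous_closed_preimage[OF continuous_on_subset[OF cont]]) (use N in auto)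
  moreover have "b \<in> Z" "bdd_below Z" using ab by (auto simp: Z_def)
  ultimately have "Inf Z \<in> Z" by (intro closed_contains_Inf) auto
  then have p: "a \<le> Inf Z" "Inf Z \<le> b" "u (Inf Z) \<notin> N" by (auto simp: Z_def)
  have "u a \<in> N" using before[of a] H by simp
  then have "a < Inf Z" using p by (cases "a = Inf Z") auto
  moreover have in_N: "u s \<in> N" if "a - H \<le> s" "s < Inf Z" for s
  proof (cases "s \<le> a")
    case True then show ?thesis using before that by simp
  next
    case False
    show ?thesis
    proof (rule ccontr)
      assume "u s \<notin> N"
      then have "s \<in> Z" using False that p by (simp add: Z_def)
      then have "Inf Z \<le> s" using \<open>bdd_below Z\<close> by (rule cInf_lower)
      then show False using that by simp
    qed
  qed
  moreover have "exits u N (Inf Z) H" using p in_N \<open>a < Inf Z\<close> by (auto simp: exits_def)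
  ultimately show ?thesis using that p by blast
qed

lemma last_entry:
  fixes u :: "real \<Rightarrow> 'a::topological_space"
  assumes cont: "continuous_on UNIV u" and N: "open N" and ab: "b \<le> a" "u b \<notin> N"
    and H: "0 \<le> H" and after: "\<And>s. a \<le> s \<Longrightarrow> s \<le> a + H \<Longrightarrow> u s \<in> N"
  obtains q where "b \<le> q" "q < a" "enters u N q H"
proof -
  have "continuous_on UNIV (\<lambda>s. u (- s))"
    by (rule continuous_on_compose2[OF cont]) (auto intro!: continuous_intros)
  moreover have "u (- s) \<in> N" if "- a - H \<le> s" "s \<le> - a" for s using that by (intro after) auto
  ultimately obtain p where p: "- a < p" "p \<le> - b" "exits (\<lambda>s. u (- s)) N p H"
    using N ab H by (elim first_exit[of "\<lambda>s. u (- s)" N "- a" "- b" H]) auto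
  have "u s \<in> N" if "s \<in> {- p<..<- p + H}" for s
    using p(3) that unfolding exits_def by (auto dest: bspec[of _ _ "- s"])
  then have "enters u N (- p) H" using p(3) by (simp add: enters_def exits_def)
  then show ?thesis using that[of "- p"] p by auto
qed

context heteroclinic_dynamics
begin

text \<open>Otherwise points without such a gap accumulate at a point \<open>z\<close> of \<open>Y\<close>. The orbit of \<open>z\<close> is in
  the box of its source \<open>a\<close> until time \<open>- s0\<close> and in that of its target \<open>b\<close> from time \<open>s0\<close> on. Nearby
  trajectories follow it long enough to have a gap of length at most \<open>2 s0\<close> between stays of
  length \<open>h (2 s0)\<close>.\<close>
lemma covering:
  assumes h: "mono h" "\<And>x. x + 1 \<le> h x"
  obtains S \<delta> where "0 < \<delta>"
    "\<And>u t. solves f u \<Longrightarrow> d (u t) < \<delta> \<Longrightarrow> (\<And>c. c \<in> Q \<Longrightarrow> u t \<notin> N c) \<Longrightarrow>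
       \<exists>c p e q. gap_pair h u c p e q \<and> p \<le> t \<and> t \<le> q \<and> q - p \<le> S"
proof -
  have "\<exists>n::nat. \<forall>u t. solves f u \<and> d (u t) < 1 / real (Suc n) \<and> (\<forall>c\<in>Q. u t \<notin> N c) \<longrightarrow>
       (\<exists>c p e q. gap_pair h u c p e q \<and> p \<le> t \<and> t \<le> q \<and> q - p \<le> real n)"
  proof (rule ccontr)
    assume "\<not> ?thesis"
    then have "\<forall>n::nat. \<exists>u t. solves f u \<and> d (u t) < 1 / real (Suc n) \<and> (\<forall>c\<in>Q. u t \<notin> N c) \<and>
       \<not> (\<exists>c p e q. gap_pair h u c p e q \<and> p \<le> t \<and> t \<le> q \<and> q - p \<le> real n)"
      by blast
    then obtain u t where *: "\<forall>n::nat. solves f (u n) \<and> d (u n (t n)) < 1 / real (Suc n) \<and> (\<forall>c\<in>Q. u n (t n) \<notin> N c) \<and>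
       \<not> (\<exists>c p e q. gap_pair h (u n) c p e q \<and> p \<le> t n \<and> t n \<le> q \<and> q - p \<le> real n)"
      unfolding choice_iff by blast
    have u: "solves f (u n)" and small: "d (u n (t n)) < 1 / real (Suc n)"
      and out: "c \<in> Q \<Longrightarrow> u n (t n) \<notin> N c" for n c
      using *[rule_format, of n] by blast+
    have none: "\<not> q - p \<le> real n" if "gap_pair h (u n) c p e q" "p \<le> t n" "t n \<le> q" for n c p e q
      using *[rule_format, of n] that by blast
    have "\<exists>y\<in>Y. norm (u n (t n) - y) \<le> sqrt CARD('n) * d (u n (t n))" for n
      using maxdist_attained[OF Y(1,2)] by blast
    then obtain y where y: "\<And>n. y n \<in> Y" "\<And>n. norm (u n (t n) - y n) \<le> sqrt CARD('n) * d (u n (t n))"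
      by metis
    obtain z \<rho> where z: "z \<in> Y" "strict_mono \<rho>" "(\<lambda>n. y (\<rho> n)) \<longlonglongrightarrow> z"
      by (rule compact_subsequence[OF Y(1) y(1)])
    have "(\<lambda>n. u n (t n) - y n) \<longlonglongrightarrow> 0"
    proof (rule Lim_null_comparison[OF always_eventually])
      show "(\<lambda>n. sqrt CARD('n) * inverse (real (Suc n))) \<longlonglongrightarrow> 0"
        by (intro tendsto_mult_right_zero LIMSEQ_inverse_real_of_nat)
      show "\<forall>n. norm (u n (t n) - y n) \<le> sqrt CARD('n) * inverse (real (Suc n))"
      proof
        fix n
        have "sqrt CARD('n) * d (u n (t n)) \<le> sqrt CARD('n) * inverse (real (Suc n))"
          using less_imp_le[OF small[of n]] by (intro mult_left_mono) (auto simp: inverse_eq_divide)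
        then show "norm (u n (t n) - y n) \<le> sqrt CARD('n) * inverse (real (Suc n))"
          using y(2)[of n] by linarith
      qed
    qed
    then have "(\<lambda>n. u (\<rho> n) (t (\<rho> n)) - y (\<rho> n)) \<longlonglongrightarrow> 0"
      by (rule LIMSEQ_subseq_LIMSEQ[OF _ z(2), unfolded o_def])
    from tendsto_add[OF this z(3)] have lim: "(\<lambda>n. u (\<rho> n) (t (\<rho> n))) \<longlonglongrightarrow> z" by simp
    obtain a b where ab: "a \<in> Q" "b \<in> Q" "z \<in> connection \<Phi> a b" using Y_connections[OF z(1)] by blast
    \<comment> \<open>Compactness of \<open>Y\<close> turns the one-point limit sets into convergence.\<close>
    obtain Sa where Sa: "\<And>s. s \<le> Sa \<Longrightarrow> \<Phi> s z \<in> N a"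
      using eventually_bot_in_open[OF z(1) _ open_box_nbhd center_N] ab unfolding connection_def by blast
    obtain Sb where Sb: "\<And>s. s \<ge> Sb \<Longrightarrow> \<Phi> s z \<in> N b"
      using eventually_top_in_open[OF z(1) _ open_box_nbhd center_N] ab unfolding connection_def by blast
    define s0 where "s0 = max \<bar>Sa\<bar> \<bar>Sb\<bar>"
    define H where "H = h (2 * s0)"
    have s0: "0 \<le> s0" "- s0 \<le> Sa" "Sb \<le> s0" by (auto simp: s0_def)
    have H: "0 \<le> H" using h(2)[of "2 * s0"] s0 by (simp add: H_def)
    define M where "M = s0 + H"
    have z_solves: "solves f (\<lambda>s. \<Phi> s z)" by (rule flow_solves[OF fl])
    have comp: "compact ((\<lambda>s. \<Phi> s z) ` {x..x'})" for x x'
      by (intro compact_continuous_image solves_continuous[OF z_solves]) auto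
    have margin: "\<exists>e>0. \<forall>s\<in>{x..x'}. \<forall>w. dist (\<Phi> s z) w < e \<longrightarrow> w \<in> N c"
      if sub: "\<And>s. s \<in> {x..x'} \<Longrightarrow> \<Phi> s z \<in> N c" for x x' c
    proof -
      have "(\<lambda>s. \<Phi> s z) ` {x..x'} \<subseteq> N c" using sub by auto
      then obtain e where "0 < e" "(\<Union>y\<in>(\<lambda>s. \<Phi> s z) ` {x..x'}. ball y e) \<subseteq> N c"
        by (rule compact_subset_open_imp_ball_epsilon_subset[OF comp open_box_nbhd])
      then show ?thesis by (intro exI[of _ e]) (auto simp: subset_iff)
    qed
    have "\<exists>e>0. \<forall>s\<in>{- M..- s0}. \<forall>w. dist (\<Phi> s z) w < e \<longrightarrow> w \<in> N a"
      using Sa s0 by (intro margin) auto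
    then obtain e1 where e1: "0 < e1" "\<And>s x. s \<in> {- M..- s0} \<Longrightarrow> dist (\<Phi> s z) x < e1 \<Longrightarrow> x \<in> N a"
      by blast
    have "\<exists>e>0. \<forall>s\<in>{s0..M}. \<forall>w. dist (\<Phi> s z) w < e \<longrightarrow> w \<in> N b"
      using Sb s0 by (intro margin) auto
    then obtain e2 where e2: "0 < e2" "\<And>s x. s \<in> {s0..M} \<Longrightarrow> dist (\<Phi> s z) x < e2 \<Longrightarrow> x \<in> N b"
      by blast
    define v where "v n s = u (\<rho> n) (t (\<rho> n) + s)" for n s
    have v: "solves f (v n)" for n unfolding v_def by (rule solves_shift[OF u])
    have "\<forall>\<^sub>F n in sequentially. \<forall>s. \<bar>s\<bar> \<le> M \<longrightarrow> norm (v n s - \<Phi> s z) < min e1 e2"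
      by (rule solves_converge[OF sm z_solves v]) (use lim e1 e2 flow_zero[OF fl] in \<open>auto simp: v_def\<close>)
    moreover have "\<forall>\<^sub>F n in sequentially. 2 * s0 < real n"
      by (rule filterlim_real_sequentially[unfolded filterlim_at_top_dense, rule_format])
    ultimately have "\<forall>\<^sub>F n in sequentially. (\<forall>s. \<bar>s\<bar> \<le> M \<longrightarrow> norm (v n s - \<Phi> s z) < min e1 e2) \<and> 2 * s0 < real n"
      by (rule eventually_conj)
    from eventually_happens'[OF sequentially_bot this]
    obtain n where n: "\<And>s. \<bar>s\<bar> \<le> M \<Longrightarrow> norm (v n s - \<Phi> s z) < min e1 e2" "2 * s0 < real n"
      by blast
    define m where "m = \<rho> n"
    have m: "2 * s0 < real m" using n(2) seq_suble[OF z(2), of n] by (simp add: m_def)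
    have close: "dist (\<Phi> (s - t m) z) (u m s) < min e1 e2" if "\<bar>s - t m\<bar> \<le> M" for s
      using n(1)[OF that] by (simp add: v_def m_def dist_norm norm_minus_commute)
    have in_a: "u m s \<in> N a" if "t m - s0 - H \<le> s" "s \<le> t m - s0" for s
      using close[of s] that s0 H by (intro e1(2)[of "s - t m"]) (auto simp: M_def)
    have in_b: "u m s \<in> N b" if "t m + s0 \<le> s" "s \<le> t m + s0 + H" for s
      using close[of s] that s0 H by (intro e2(2)[of "s - t m"]) (auto simp: M_def)
    have le: "t m - s0 \<le> t m" "t m \<le> t m + s0" using s0 by auto
    obtain p where p: "t m - s0 < p" "p \<le> t m" "exits (u m) (N a) p H"
      using first_exit[OF solves_continuous[OF u] open_box_nbhd le(1) out[OF ab(1)] H in_a] by blast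
    obtain q where q: "t m \<le> q" "q < t m + s0" "enters (u m) (N b) q H"
      using last_entry[OF solves_continuous[OF u] open_box_nbhd le(2) out[OF ab(2)] H in_b] by blast
    have "h (q - p) \<le> H" unfolding H_def using p q by (intro monoD[OF h(1)]) simp
    then have "gap_pair h (u m) a p b q"
      using p q ab exits_mono enters_mono by (auto simp: gap_pair_def)
    then show False using none[of m a p b q] p q m by simp
  qed
  then obtain n :: nat where "\<forall>u t. solves f u \<and> d (u t) < 1 / real (Suc n) \<and> (\<forall>c\<in>Q. u t \<notin> N c) \<longrightarrow>
       (\<exists>c p e q. gap_pair h u c p e q \<and> p \<le> t \<and> t \<le> q \<and> q - p \<le> real n)" by blast
  then show ?thesis by (intro that[of "1 / real (Suc n)" "real n"]) (simp, blast)
qed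

lemma N_disjoint: "c \<in> Q \<Longrightarrow> e \<in> Q \<Longrightarrow> x \<in> N c \<Longrightarrow> x \<in> B e \<Longrightarrow> c = e"
  using disjoint N_sub_B by blast

lemma no_entry_inside:
  assumes "c \<in> Q" "e \<in> Q" "\<And>t. a < t \<Longrightarrow> t < b \<Longrightarrow> u t \<in> N c" "enters u (N e) q T" "0 < T" "a < q" "q < b"
  shows False
proof -
  define s where "s = min ((q + b) / 2) (q + T / 2)"
  have s: "q < s" "s < b" "s < q + T" using assms by (auto simp: s_def min_def)
  then have "u s \<in> N c" "u s \<in> N e" using assms by (auto simp: enters_def)
  then have "c = e" using N_disjoint[OF assms(1,2)] N_sub_B by blast
  then show False using assms by (auto simp: enters_def)
qed

lemma exit_inside:
  assumes "c \<in> Q" "e \<in> Q" "\<And>t. a < t \<Longrightarrow> t < b \<Longrightarrow> u t \<in> N c" "exits u (N e) p T" "0 < T" "a < p" "p \<le> b"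
  shows "c = e \<and> p = b"
proof -
  define s where "s = max ((a + p) / 2) (p - T / 2)"
  have s: "a < s" "s < p" "p - T < s" using assms by (auto simp: s_def max_def)
  then have "u s \<in> N c" "u s \<in> N e" using assms by (auto simp: exits_def)
  then have "c = e" using N_disjoint[OF assms(1,2)] N_sub_B by blast
  moreover have "p = b"
  proof (rule ccontr)
    assume "p \<noteq> b"
    then have "u p \<in> N c" using assms by auto
    then show False using assms \<open>c = e\<close> by (auto simp: exits_def)
  qed
  ultimately show ?thesis by simp
qed

text \<open>The gap around \<open>t\<close> with the latest end \<open>q\<close> is chosen. Another gap that begins before \<open>q\<close> and ends after
  it would contain the long stay that begins at \<open>q\<close>. If it began after \<open>t\<close>, the long stay before it would be
  part of the chosen gap, and each of the two gaps would be longer than the other.\<close>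
lemma maximal_gap:
  assumes h: "mono h" "\<And>x. x + 1 \<le> h x" and out: "\<And>c. c \<in> Q \<Longrightarrow> u t \<notin> N c"
    and ex: "\<exists>c p e q. gap_pair h u c p e q \<and> p \<le> t \<and> t \<le> q \<and> q - p \<le> S"
  obtains c p e q where "gap_pair h u c p e q" "p \<le> t" "t \<le> q" "q - p \<le> S"
    "\<And>c' p' e' q'. gap_pair h u c' p' e' q' \<Longrightarrow> p' \<le> q \<Longrightarrow> q' - p' \<le> S \<Longrightarrow> q' \<le> q"
proof -
  define A where "A = {q. \<exists>c p e. gap_pair h u c p e q \<and> p \<le> t \<and> t \<le> q \<and> q - p \<le> S}"
  have "A \<noteq> {}" using ex by (auto simp: A_def)
  have bdd: "bdd_above A" by (rule bdd_aboveI[of _ "t + S"]) (auto simp: A_def)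
  \<comment> \<open>Ends of gaps are at least \<open>1\<close> apart, so this \<open>q\<close> is the latest one.\<close>
  obtain q where q: "q \<in> A" "Sup A - 1 < q"
    using less_cSup_iff[OF \<open>A \<noteq> {}\<close> bdd, of "Sup A - 1"] by auto
  then obtain c p e where gap: "gap_pair h u c p e q" "p \<le> t" "t \<le> q" "q - p \<le> S" by (auto simp: A_def)
  define T where "T = h (q - p)"
  have T: "q - p + 1 \<le> T" "1 \<le> T" using h(2)[of "q - p"] gap by (auto simp: T_def)
  have "q' \<le> q" if gap': "gap_pair h u c' p' e' q'" and p': "p' \<le> q" and S: "q' - p' \<le> S" for c' p' e' q'
  proof (rule ccontr)
    assume "\<not> q' \<le> q"
    have "0 \<le> q' - p'" using gap' by (simp add: gap_pair_def)
    then have T': "q' - p' + 1 \<le> h (q' - p')" "0 < h (q' - p')" using h(2)[of "q' - p'"] by auto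
    \<comment> \<open>The other gap ends with an entry, which cannot happen during the stay in the box of \<open>e\<close>.\<close>
    have sep: "q + T \<le> q'"
    proof (rule ccontr)
      assume "\<not> q + T \<le> q'"
      then show False
        using no_entry_inside[of e e' q "q + T" u q' "h (q' - p')"] gap gap' T' \<open>\<not> q' \<le> q\<close>
        by (auto simp: gap_pair_def enters_def T_def)
    qed
    show False
    proof (cases "p' \<le> t")
      case True
      then have "q' \<in> A" using gap' S gap \<open>\<not> q' \<le> q\<close> unfolding A_def by force
      then have "q' \<le> Sup A" using bdd by (rule cSup_upper)
      then show False using sep T q by simp
    next
      case False
      \<comment> \<open>The stay before the other gap cannot contain \<open>t\<close>, which is outside the boxes.\<close>
      have "h (q' - p') \<le> p' - t"
      proof (rule ccontr)
        assume "\<not> h (q' - p') \<le> p' - t"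
        then have "u t \<in> N c'" using gap' False by (auto simp: gap_pair_def exits_def)
        then show False using out gap' by (auto simp: gap_pair_def)
      qed
      then have "q' - p' + 1 \<le> q - p" using T' p' gap by linarith
      then show False using sep T p' by linarith
    qed
  qed
  then show ?thesis using that gap by blast
qed

text \<open>\<open>stage u a c q\<close> expresses that the walk of the trajectory \<open>u\<close> goes from \<open>a\<close> to \<open>c\<close> and that \<open>u\<close> enters the
  box of \<open>c\<close> at time \<open>q\<close>. Near \<open>Y\<close>, every time outside the boxes is soon followed by a stage,
  and every passage that ends is soon followed by the next one, along an edge whose
  connection meets the exit face.\<close>
definition itinerary :: "real \<Rightarrow> real \<Rightarrow> ((real \<Rightarrow> real^'n) \<Rightarrow> real^'n \<Rightarrow> real^'n \<Rightarrow> real \<Rightarrow> bool) \<Rightarrow> bool" where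
  "itinerary S \<delta> stage \<longleftrightarrow>
    (\<forall>u t. solves f u \<and> d (u t) < \<delta> \<and> (\<forall>c\<in>Q. u t \<notin> N c) \<longrightarrow>
       (\<exists>a c q. stage u a c q \<and> t \<le> q \<and> q \<le> t + S)) \<and>
    (\<forall>u a c q. stage u a c q \<longrightarrow> c \<in> Q \<and> edge a c \<and>
       u q \<in> entry_faces a c \<and> enters u (N c) q 1) \<and>
    (\<forall>u a c q \<beta>. solves f u \<and> stage u a c q \<and> q < \<beta> \<and> (\<forall>t\<in>{q<..<\<beta>}. u t \<in> N c) \<and> u \<beta> \<notin> N c \<and>
       d (u \<beta>) < \<delta> \<longrightarrow> (\<exists>b q1. \<beta> \<le> q1 \<and> q1 \<le> \<beta> + S \<and> edge c b \<and>
         u \<beta> \<in> exit_faces c b \<and> stage u c b q1))"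

text \<open>A stage begins at the end of a maximal gap. The maximal gap around the time \<open>\<beta>\<close> at which the trajectory leaves
  the box of \<open>c\<close> cannot begin before the passage, since a gap with such a beginning ends before it, and
  it cannot begin inside the box; so it begins at \<open>\<beta>\<close>, and its first box is that of \<open>c\<close>.\<close>
lemma itinerary_exists:
  obtains S \<delta> stage where "0 < \<delta>" "itinerary S \<delta> stage"
proof -
  obtain h where h: "mono h" "\<And>x. x + 1 \<le> h x"
    and match: "\<And>u c p e q. solves f u \<Longrightarrow> gap_pair h u c p e q \<Longrightarrow> matched c e (u p) (u q)"
    by (rule matching) (rule that; blast)
  obtain S \<delta> where \<delta>: "0 < \<delta>" and
    cov: "\<And>u t. solves f u \<Longrightarrow> d (u t) < \<delta> \<Longrightarrow> (\<And>c. c \<in> Q \<Longrightarrow> u t \<notin> N c) \<Longrightarrow>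
       \<exists>c p e q. gap_pair h u c p e q \<and> p \<le> t \<and> t \<le> q \<and> q - p \<le> S"
    by (rule covering[OF h]) (rule that; blast)
  define stage where "stage u a c q \<longleftrightarrow> c \<in> Q \<and> edge a c \<and>
       u q \<in> entry_faces a c \<and> enters u (N c) q 1 \<and>
       (\<forall>c' p' e' q'. gap_pair h u c' p' e' q' \<and> p' \<le> q \<and> q' - p' \<le> S \<longrightarrow> q' \<le> q)" for u a c q
  have max: "\<exists>c p e q. gap_pair h u c p e q \<and> p \<le> t \<and> t \<le> q \<and> q - p \<le> S \<and> stage u c e q \<and> matched c e (u p) (u q)"
    if u: "solves f u" and dt: "d (u t) < \<delta>" and out: "\<And>c. c \<in> Q \<Longrightarrow> u t \<notin> N c" for u t
  proof -
    obtain c p e q where gap: "gap_pair h u c p e q" "p \<le> t" "t \<le> q" "q - p \<le> S"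
      and kept: "\<And>c' p' e' q'. gap_pair h u c' p' e' q' \<Longrightarrow> p' \<le> q \<Longrightarrow> q' - p' \<le> S \<Longrightarrow> q' \<le> q"
      using maximal_gap[OF h out cov[OF u dt out]] by blast
    have m: "matched c e (u p) (u q)" by (rule match[OF u gap(1)])
    have "enters u (N e) q 1"
      by (rule enters_mono) (use gap h(2)[of "q - p"] in \<open>auto simp: gap_pair_def\<close>)
    then have "stage u c e q" unfolding stage_def using m kept gap(1) by (auto simp: matched_def gap_pair_def)
    then show ?thesis using gap m by blast
  qed
  have next_stage: "\<exists>b q1. \<beta> \<le> q1 \<and> q1 \<le> \<beta> + S \<and> edge c b \<and>
         u \<beta> \<in> exit_faces c b \<and> stage u c b q1"
    if u: "solves f u" and s: "stage u a c q" and \<beta>: "q < \<beta>" and pass: "\<And>t. q < t \<Longrightarrow> t < \<beta> \<Longrightarrow> u t \<in> N c"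
      and end': "u \<beta> \<notin> N c" and db: "d (u \<beta>) < \<delta>" for u a c q \<beta>
  proof -
    have c: "c \<in> Q" using s by (simp add: stage_def)
    have "exits u (N c) \<beta> (\<beta> - q)" using pass end' by (auto simp: exits_def)
    then have "u \<beta> \<in> B c" using \<beta> exits_closure[OF _ _ solves_continuous[OF u] N_sub_B closed_closed_box] by simp
    then have "u \<beta> \<notin> N c'" if "c' \<in> Q" for c' using N_disjoint[OF that c] end' by blast
    then obtain c1 p1 e1 q1 where g: "gap_pair h u c1 p1 e1 q1" "p1 \<le> \<beta>" "\<beta> \<le> q1" "q1 - p1 \<le> S"
      "stage u c1 e1 q1" "matched c1 e1 (u p1) (u q1)"
      using max[OF u db] by meson
    have "q < p1"
    proof (rule ccontr)
      assume "\<not> q < p1"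
      then have "p1 \<le> q" by simp
      then have "q1 \<le> q" using s g(1,4) unfolding stage_def by blast
      then show False using g \<beta> by simp
    qed
    moreover have "c1 \<in> Q" "exits u (N c1) p1 (h (q1 - p1))" using g(1) by (auto simp: gap_pair_def)
    moreover have "0 < h (q1 - p1)" using h(2)[of "q1 - p1"] g by linarith
    ultimately have "c = c1 \<and> p1 = \<beta>" using exit_inside[where u = u and a = q and b = \<beta>, OF c _ pass] g(2) by blast
    then show ?thesis using g by (intro exI[of _ e1] exI[of _ q1]) (auto simp: matched_def)
  qed
  have first_stage: "\<exists>a c q. stage u a c q \<and> t \<le> q \<and> q \<le> t + S"
    if out: "solves f u" "d (u t) < \<delta>" "\<forall>c\<in>Q. u t \<notin> N c" for u t
  proof -
    obtain c p e q where "gap_pair h u c p e q" "p \<le> t" "t \<le> q" "q - p \<le> S" "stage u c e q"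
      using max[of u t] out by blast
    then show ?thesis by (intro exI[of _ c] exI[of _ e] exI[of _ q]) auto
  qed
  have "itinerary S \<delta> stage"
    unfolding itinerary_def
  proof (intro conjI)
    show "\<forall>u t. solves f u \<and> d (u t) < \<delta> \<and> (\<forall>c\<in>Q. u t \<notin> N c) \<longrightarrow>
        (\<exists>a c q. stage u a c q \<and> t \<le> q \<and> q \<le> t + S)" using first_stage by blast
    show "\<forall>u a c q. stage u a c q \<longrightarrow> c \<in> Q \<and> edge a c \<and>
       u q \<in> entry_faces a c \<and> enters u (N c) q 1" by (simp add: stage_def)
  qed (use next_stage in \<open>unfold Ball_def greaterThanLessThan_iff, blast\<close>)
  with \<delta> show ?thesis by (rule that)
qed

end

section \<open>Potentials on weighted digraphs\<close>
fun path_cost :: "('v \<Rightarrow> 'v \<Rightarrow> real) \<Rightarrow> 'v list \<Rightarrow> real" where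
  "path_cost w (x # y # xs) = w x y + path_cost w (y # xs)"
| "path_cost w _ = 0"

lemma path_cost_append: "path_cost w (xs @ x # ys) = path_cost w (xs @ [x]) + path_cost w (x # ys)"
  by (induction xs rule: induct_list012) auto

lemma path_cost_snoc: "xs \<noteq> [] \<Longrightarrow> path_cost w (xs @ [y]) = path_cost w xs + w (last xs) y"
  by (induction xs rule: induct_list012) auto

lemma path_cost_sum:
  "path_cost w xs = (\<Sum>j<length xs - 1. w (xs ! j) (xs ! Suc j))"
  by (induction w xs rule: path_cost.induct) (auto simp: sum.lessThan_Suc_shift simp del: sum.lessThan_Suc)

definition simple_cycle :: "('v \<times> 'v) set \<Rightarrow> 'v list \<Rightarrow> bool" where
  "simple_cycle L es \<longleftrightarrow> es \<noteq> [] \<and> distinct es \<and> (\<forall>j<length es. (es ! j, cyc_nth es (j + 1)) \<in> L)"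

lemma cyc_nth_less: "j < length es \<Longrightarrow> cyc_nth es j = es ! j"
  by (simp add: cyc_nth_def)

lemma cyc_nth_length [simp]: "cyc_nth es (j + length es) = cyc_nth es j"
  by (simp add: cyc_nth_def)

lemma cyc_nth_map: "es \<noteq> [] \<Longrightarrow> cyc_nth (map g es) j = g (cyc_nth es j)"
  by (simp add: cyc_nth_def)

lemma cyc_nth_all:
  assumes "es \<noteq> []" "\<And>j. j < length es \<Longrightarrow> P (es ! j) (cyc_nth es (j + 1))"
  shows "P (cyc_nth es j) (cyc_nth es (j + 1))"
  using assms(2)[of "j mod length es"] assms(1) by (simp add: cyc_nth_def mod_Suc_eq)

lemma successively_nth_iff:
  "successively P xs \<longleftrightarrow> (\<forall>j. Suc j < length xs \<longrightarrow> P (xs ! j) (xs ! Suc j))"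
  by (induction xs rule: induct_list012) (auto simp: nth_Cons split: nat.splits)

lemma simple_cycleI:
  assumes "es \<noteq> []" "distinct es" "successively (\<lambda>x y. (x, y) \<in> L) es" "(last es, hd es) \<in> L"
  shows "simple_cycle L es"
  unfolding simple_cycle_def
proof (intro conjI allI impI assms(1,2))
  fix j assume j: "j < length es"
  show "(es ! j, cyc_nth es (j + 1)) \<in> L"
  proof (cases "Suc j < length es")
    case True then show ?thesis using assms(3) by (simp add: successively_nth_iff cyc_nth_less)
  next
    case False
    then have "Suc j = length es" using j by simp
    then have "es ! j = last es" "cyc_nth es (j + 1) = hd es"
      using assms(1) by (simp_all add: last_conv_nth hd_conv_nth cyc_nth_def flip: \<open>Suc j = length es\<close>)
    then show ?thesis using assms(4) by simp
  qed
qed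

lemma cycle_cost:
  assumes "es \<noteq> []"
  shows "(\<Sum>j<length es. w (es ! j) (cyc_nth es (j + 1))) = path_cost w es + w (last es) (hd es)"
proof -
  obtain n where n: "length es = Suc n" using assms by (cases es) auto
  have "cyc_nth es (n + 1) = hd es" "es ! n = last es"
    using assms n by (simp_all add: cyc_nth_def hd_conv_nth last_conv_nth)
  moreover have "(\<Sum>j<n. w (es ! j) (cyc_nth es (j + 1))) = path_cost w es"
    unfolding path_cost_sum using n by (intro sum.cong) (auto simp: cyc_nth_less)
  ultimately show ?thesis by (simp add: n)
qed

text \<open>The potential of \<open>e\<close> is the least cost of a simple path that ends at \<open>e\<close>. When an optimal path to
  \<open>e\<close> is extended by an arc to a vertex \<open>e'\<close> that it already contains, the closing loop is a simple cycle,
  and dropping it does not increase the cost.\<close>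
lemma potential_exists:
  fixes w :: "'v \<Rightarrow> 'v \<Rightarrow> real"
  assumes V: "finite V" "L \<subseteq> V \<times> V"
    and cyc: "\<And>es. simple_cycle L es \<Longrightarrow> 0 \<le> (\<Sum>j<length es. w (es ! j) (cyc_nth es (j + 1)))"
  obtains \<pi> where "\<And>e e'. (e, e') \<in> L \<Longrightarrow> \<pi> e' \<le> \<pi> e + w e e'"
proof -
  define paths where "paths e = {es. es \<noteq> [] \<and> distinct es \<and> set es \<subseteq> V \<and>
    successively (\<lambda>x y. (x, y) \<in> L) es \<and> last es = e}" for e
  define \<pi> where "\<pi> e = Min (path_cost w ` paths e)" for e
  have fin: "finite (paths e)" for e
    by (rule finite_subset[OF _ finite_subset_distinct[OF V(1)]]) (auto simp: paths_def)
  have "\<pi> e' \<le> \<pi> e + w e e'" if L: "(e, e') \<in> L" for e e'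
  proof -
    have "[e] \<in> paths e" using L V by (auto simp: paths_def)
    then have "\<pi> e \<in> path_cost w ` paths e" unfolding \<pi>_def using fin by (intro Min_in) auto
    then obtain es where es: "es \<in> paths e" "\<pi> e = path_cost w es" by auto
    have low: "\<pi> e' \<le> path_cost w xs" if "xs \<in> paths e'" for xs
      unfolding \<pi>_def using fin that by (intro Min_le) auto
    show ?thesis
    proof (cases "e' \<in> set es")
      case False
      have "es @ [e'] \<in> paths e'" using es(1) False L V by (auto simp: paths_def successively_append_iff)
      from low[OF this] show ?thesis using es by (simp add: path_cost_snoc paths_def)
    next
      case True
      then obtain xs ys where split: "es = xs @ e' # ys" by (auto dest: split_list)
      have "xs @ [e'] \<in> paths e'"
        using es(1) unfolding split paths_def by (auto simp: successively_append_iff)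
      then have "\<pi> e' \<le> path_cost w (xs @ [e'])" by (rule low)
      moreover have "simple_cycle L (e' # ys)"
        using es(1) L unfolding split paths_def by (intro simple_cycleI) (auto simp: successively_append_iff)
      from cyc[OF this] have "0 \<le> path_cost w (e' # ys) + w e e'"
        using es(1) unfolding split paths_def by (subst (asm) cycle_cost) (auto split: if_splits)
      ultimately show ?thesis using es(2) path_cost_append[of w xs e' ys] by (simp add: split)
    qed
  qed
  then show ?thesis using that by blast
qed

lemma arc_on_simple_cycle:
  assumes "(e, e') \<in> L" "(e', e) \<in> L\<^sup>*"
  obtains es j where "simple_cycle L es" "j < length es" "es ! j = e" "cyc_nth es (j + 1) = e'"
proof -
  define r where "r x y \<longleftrightarrow> (x, y) \<in> L" for x y
  have "r\<^sup>*\<^sup>* e' e" using assms(2) unfolding r_def rtranclp_rtrancl_eq by simp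
  then obtain xs0 where "rtrancl_path r e' xs0 e" by (auto simp: rtranclp_eq_rtrancl_path)
  then obtain xs where xs: "rtrancl_path r e' xs e" "distinct (e' # xs)" by (rule rtrancl_path_distinct)
  have last_e: "last (e' # xs) = e"
    using xs(1) by (cases "xs = []") (auto simp: rtrancl_path_last elim: rtrancl_path.cases)
  have steps: "successively (\<lambda>x y. (x, y) \<in> L) (e' # xs)"
    unfolding successively_nth_iff using rtrancl_path_nth[OF xs(1)] by (auto simp: r_def)
  have "simple_cycle L (e' # xs)" by (rule simple_cycleI) (use xs last_e steps assms in auto)
  moreover have "(e' # xs) ! length xs = e" using last_e last_conv_nth[of "e' # xs"] by simp
  moreover have "cyc_nth (e' # xs) (length xs + 1) = e'" by (simp add: cyc_nth_def)
  ultimately show ?thesis using that[of "e' # xs" "length xs"] by simp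
qed

text \<open>The exponent \<open>\<rho> e e'\<close> is the largest one that some simple cycle offers for the arc, so its product around
  each simple cycle is still greater than \<open>1\<close>. There are finitely many cycles, hence the mean of \<open>ln \<rho>\<close> along
  a simple cycle is at least some \<open>\<eta> > 0\<close>, and \<open>ln \<rho> - \<eta>\<close> has a potential.\<close>
lemma weighted_potential:
  fixes good :: "'v \<Rightarrow> 'v \<Rightarrow> real \<Rightarrow> bool"
  assumes V: "finite V" "L \<subseteq> V \<times> V"
    and return: "\<And>e e'. (e, e') \<in> L \<Longrightarrow> (e', e) \<in> L\<^sup>*"
    and cyc: "\<And>es. simple_cycle L es \<Longrightarrow> \<exists>\<rho>. (\<forall>j<length es. 0 < \<rho> j \<and> good (es ! j) (cyc_nth es (j + 1)) (\<rho> j)) \<and>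
       1 < (\<Prod>j<length es. \<rho> j)"
  obtains \<rho> \<pi> \<eta> where "0 < \<eta>"
    "\<And>e e'. (e, e') \<in> L \<Longrightarrow> 0 < \<rho> e e' \<and> good e e' (\<rho> e e') \<and> \<pi> e' \<le> \<pi> e + ln (\<rho> e e') - \<eta>"
proof -
  obtain R where R: "\<And>es j. simple_cycle L es \<Longrightarrow> j < length es \<Longrightarrow> 0 < R es j \<and> good (es ! j) (cyc_nth es (j + 1)) (R es j)"
    "\<And>es. simple_cycle L es \<Longrightarrow> 1 < (\<Prod>j<length es. R es j)"
    using cyc by metis
  define C where "C = {es. simple_cycle L es}"
  have "set es \<subseteq> V" if "simple_cycle L es" for es
    using that V(2) unfolding simple_cycle_def in_set_conv_nth subset_iff by blast
  then have finC: "finite C"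
    by (intro finite_subset[OF _ finite_subset_distinct[OF V(1)]]) (auto simp: C_def simple_cycle_def)
  define X where "X e e' = (\<Union>es\<in>C. R es ` {j. j < length es \<and> es ! j = e \<and> cyc_nth es (j + 1) = e'})" for e e'
  define \<rho> where "\<rho> e e' = Max (X e e')" for e e'
  have finX: "finite (X e e')" for e e' unfolding X_def using finC by auto
  have good: "0 < \<rho> e e' \<and> good e e' (\<rho> e e')" if L: "(e, e') \<in> L" for e e'
  proof -
    obtain es j where "simple_cycle L es" "j < length es" "es ! j = e" "cyc_nth es (j + 1) = e'"
      using arc_on_simple_cycle[OF L return[OF L]] by blast
    then have "X e e' \<noteq> {}" by (auto simp: X_def C_def)
    then have "\<rho> e e' \<in> X e e'" unfolding \<rho>_def using finX by (intro Max_in)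
    then show ?thesis using R(1) by (auto simp: X_def C_def)
  qed
  have pos: "0 < (\<Sum>j<length es. ln (\<rho> (es ! j) (cyc_nth es (j + 1))))" if es: "simple_cycle L es" for es
  proof -
    have "R es j \<le> \<rho> (es ! j) (cyc_nth es (j + 1))" if "j < length es" for j
      unfolding \<rho>_def using that es finX by (intro Max_ge) (auto simp: X_def C_def)
    then have "(\<Prod>j<length es. R es j) \<le> (\<Prod>j<length es. \<rho> (es ! j) (cyc_nth es (j + 1)))"
      using R(1)[OF es] by (intro prod_mono) (auto intro: less_imp_le)
    then have "1 < (\<Prod>j<length es. \<rho> (es ! j) (cyc_nth es (j + 1)))" using R(2)[OF es] by simp
    moreover have "ln (\<Prod>j<length es. \<rho> (es ! j) (cyc_nth es (j + 1))) = (\<Sum>j<length es. ln (\<rho> (es ! j) (cyc_nth es (j + 1))))"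
    proof (rule ln_prod)
      fix j assume "j \<in> {..<length es}"
      then have "(es ! j, cyc_nth es (j + 1)) \<in> L" using es by (simp add: simple_cycle_def)
      then show "\<rho> (es ! j) (cyc_nth es (j + 1)) \<noteq> 0" using good by fastforce
    qed simp
    ultimately show ?thesis using ln_gt_zero by metis
  qed
  define mean where "mean es = (\<Sum>j<length es. ln (\<rho> (es ! j) (cyc_nth es (j + 1)))) / length es" for es
  define \<eta> where "\<eta> = Min (insert 1 (mean ` C))"
  have \<eta>: "0 < \<eta>" unfolding \<eta>_def using finC pos by (auto simp: Min_gr_iff C_def mean_def simple_cycle_def)
  have "0 \<le> (\<Sum>j<length es. ln (\<rho> (es ! j) (cyc_nth es (j + 1))) - \<eta>)" if es: "simple_cycle L es" for es
  proof -
    have "\<eta> \<le> mean es" unfolding \<eta>_def using finC es by (intro Min_le) (auto simp: C_def)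
    moreover have "0 < real (length es)" using es by (simp add: simple_cycle_def)
    ultimately have "real (length es) * \<eta> \<le> (\<Sum>j<length es. ln (\<rho> (es ! j) (cyc_nth es (j + 1))))"
      by (simp add: mean_def field_simps)
    then show ?thesis by (simp add: sum_subtractf)
  qed
  then obtain \<pi> where \<pi>: "\<And>e e'. (e, e') \<in> L \<Longrightarrow> \<pi> e' \<le> \<pi> e + (ln (\<rho> e e') - \<eta>)"
    using potential_exists[OF V, of "\<lambda>e e'. ln (\<rho> e e') - \<eta>"] by blast
  show ?thesis by (rule that[OF \<eta>, of \<rho> \<pi>]) (use good \<pi> in force)
qed

text \<open>The bounds on the local maps live on consecutive pairs of edges, that is, on the arcs of the line graph.\<close>
definition line_graph :: "('a \<times> 'a) set \<Rightarrow> (('a \<times> 'a) \<times> ('a \<times> 'a)) set" where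
  "line_graph R = {((a, c), (c', b)) | a c c' b. (a, c) \<in> R \<and> (c', b) \<in> R \<and> c = c'}"

lemma line_path:
  assumes "(x, y) \<in> R\<^sup>*" "(v, x) \<in> R" "(y, z) \<in> R"
  shows "((v, x), (y, z)) \<in> (line_graph R)\<^sup>*"
  using assms
proof (induction arbitrary: z rule: rtrancl_induct)
  case base
  then show ?case by (auto simp: line_graph_def)
next
  case (step y y')
  have "((v, x), (y, y')) \<in> (line_graph R)\<^sup>*" using step by blast
  moreover have "((y, y'), (y', z)) \<in> line_graph R" using step by (auto simp: line_graph_def)
  ultimately show ?case by (rule rtrancl_into_rtrancl)
qed

lemma line_graph_back:
  assumes return: "\<And>x y. (x, y) \<in> R \<Longrightarrow> (y, x) \<in> R\<^sup>*" and L: "(e, e') \<in> line_graph R"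
  shows "(e', e) \<in> (line_graph R)\<^sup>*"
proof -
  obtain a c b where e: "e = (a, c)" "e' = (c, b)" "(a, c) \<in> R" "(c, b) \<in> R"
    using L by (auto simp: line_graph_def)
  have "(b, a) \<in> R\<^sup>*" using return[OF e(3)] return[OF e(4)] by (rule rtrancl_trans[rotated])
  then show ?thesis unfolding e(1,2) by (rule line_path[OF _ e(4,3)])
qed

lemma cyclic_walk_back:
  assumes "\<And>j. j < length P \<Longrightarrow> (P ! j, cyc_nth P (j + 1)) \<in> R" "j < length P"
  shows "(cyc_nth P (j + 1), P ! j) \<in> R\<^sup>*"
proof -
  have P: "P \<noteq> []" using assms(2) by auto
  have step: "(cyc_nth P k, cyc_nth P (k + 1)) \<in> R" for k
    by (rule cyc_nth_all[OF P]) (rule assms(1))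
  have "(cyc_nth P (j + 1), cyc_nth P (j + 1 + k)) \<in> R\<^sup>*" for k
  proof (induction k)
    case (Suc k)
    then show ?case using step[of "j + 1 + k"] by (simp add: rtrancl_into_rtrancl)
  qed simp
  from this[of "length P - 1"] show ?thesis
    using assms(2) P cyc_nth_length[of P j] by (simp add: cyc_nth_less)
qed

text \<open>The end points of the edges of a simple cycle in the line graph form a closed walk in which no edge
  is repeated; in particular no triple is.\<close>
lemma simple_cycle_line_graph:
  assumes es: "simple_cycle (line_graph R) es"
  defines "P \<equiv> map snd es"
  shows "\<And>j. j < length P \<Longrightarrow> (P ! j, cyc_nth P (j + 1)) \<in> R"
    and "semi_linear P"
    and "\<And>j. j < length P \<Longrightarrow> es ! j = (cyc_nth P (j + length P - 1), P ! j)"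
    and "\<And>j. j < length P \<Longrightarrow> cyc_nth es (j + 1) = (P ! j, cyc_nth P (j + 1))"
proof -
  have ne: "es \<noteq> []" "distinct es" using es by (auto simp: simple_cycle_def)
  have arc: "(cyc_nth es j, cyc_nth es (j + 1)) \<in> line_graph R" for j
    by (rule cyc_nth_all[OF ne(1)]) (use es in \<open>simp add: simple_cycle_def\<close>)
  have link: "fst (cyc_nth es (j + 1)) = snd (cyc_nth es j)" "cyc_nth es j \<in> R" for j
    using arc[of j] by (auto simp: line_graph_def)
  have cycP: "cyc_nth P j = snd (cyc_nth es j)" for j
    unfolding P_def by (rule cyc_nth_map[OF ne(1)])
  have nthP: "P ! j = cyc_nth P j" if "j < length P" for j using that by (simp add: cyc_nth_less)
  have 4: "cyc_nth es (j + 1) = (P ! j, cyc_nth P (j + 1))" if "j < length P" for j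
    using link(1)[of j] nthP[OF that] by (simp add: cycP prod_eq_iff)
  have 3: "es ! j = (cyc_nth P (j + length P - 1), P ! j)" if j: "j < length P" for j
  proof -
    have "fst (cyc_nth es (j + length P - 1 + 1)) = cyc_nth P (j + length P - 1)"
      using link(1)[of "j + length P - 1"] by (simp only: cycP)
    moreover have "j + length P - 1 + 1 = j + length es" using j by (simp add: P_def)
    ultimately have "fst (cyc_nth es j) = cyc_nth P (j + length P - 1)" using cyc_nth_length by metis
    then show ?thesis using j by (simp add: P_def cyc_nth_less prod_eq_iff)
  qed
  show "(P ! j, cyc_nth P (j + 1)) \<in> R" if "j < length P" for j
    using 4[OF that] link(2)[of "j + 1"] by simp
  show "semi_linear P"
    unfolding semi_linear_def
  proof (rule inj_onI)
    fix i j assume ij: "i \<in> {..<length P}" "j \<in> {..<length P}"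
      and eq: "(cyc_nth P (i + length P - 1), P ! i, cyc_nth P (i + 1)) = (cyc_nth P (j + length P - 1), P ! j, cyc_nth P (j + 1))"
    then have "es ! i = es ! j" using 3[of i] 3[of j] by simp
    then show "i = j" using ne(2) ij by (simp add: nth_eq_iff_index_eq P_def)
  qed
  show "\<And>j. j < length P \<Longrightarrow> es ! j = (cyc_nth P (j + length P - 1), P ! j)" by (rule 3)
  show "\<And>j. j < length P \<Longrightarrow> cyc_nth es (j + 1) = (P ! j, cyc_nth P (j + 1))" by (rule 4)
qed

section \<open>Contraction along itineraries\<close>

context heteroclinic_dynamics
begin

definition passage :: "(real \<Rightarrow> real^'n) \<Rightarrow> real^'n \<Rightarrow> real^'n \<Rightarrow> real^'n \<Rightarrow> real \<Rightarrow> real \<Rightarrow> real \<Rightarrow> bool" where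
  "passage u a c b s t \<delta> \<longleftrightarrow> s < t \<and> u s \<in> entry_faces a c \<and>
     u t \<in> exit_faces c b \<and>
     (\<forall>\<tau>\<in>{s<..<t}. u \<tau> \<in> N c) \<and> (\<forall>\<tau>\<in>{s..t}. d (u \<tau>) < \<delta>)"

definition triple_bound :: "real^'n \<Rightarrow> real^'n \<Rightarrow> real^'n \<Rightarrow> real \<Rightarrow> real \<Rightarrow> bool" where
  "triple_bound a c b A \<rho> \<longleftrightarrow> (\<exists>\<delta>>0. \<forall>x s t. x \<notin> Y \<and> passage (\<lambda>\<tau>. \<Phi> \<tau> x) a c b s t \<delta> \<longrightarrow>
     d (\<Phi> t x) < A * d (\<Phi> s x) powr \<rho>)"

lemma local_map_bound_triple:
  "local_map_bound \<Phi> E r Y P j A \<rho> \<longleftrightarrow>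
     triple_bound (cyc_nth P (j + length P - 1)) (P ! j) (cyc_nth P (j + 1)) A \<rho>"
  unfolding local_map_bound_def triple_bound_def passage_def Let_def ..

definition edges :: "((real^'n) \<times> (real^'n)) set" where
  "edges = {(a, c). edge a c}"

lemma equilibrium_in_Q:
  assumes "y \<in> Y" "equilibrium f y" shows "y \<in> Q"
proof -
  obtain a b where ab: "a \<in> Q" "y \<in> connection \<Phi> a b" using Y_connections[OF assms(1)] by blast
  have "\<Phi> t y = y" for t
    using solves_unique[OF sm flow_solves[OF fl, of y] solves_const[of f y], of t] assms(2) flow_zero[OF fl]
    by (simp add: equilibrium_def)
  then have "y \<in> unstable_set \<Phi> {y}" by (intro tendsto_bot_unstable) simp
  then have "y = a" using ab unfolding connection_def unstable_set_def by blast
  then show ?thesis using ab by simp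
qed

lemma edges_subset: "edges \<subseteq> Q \<times> Q"
  using equilibrium_in_Q by (auto simp: edges_def connection_in_def)

lemma finite_edges: "finite edges"
  using edges_subset Q(1) finite_subset by blast

text \<open>The hypothesis \<open>on_cycle\<close> makes reachability symmetric, so every pair of consecutive edges is on a simple cycle of
  the line graph and receives an exponent.\<close>
lemma exponents:
  assumes on_cycle: "\<And>a c. (a, c) \<in> edges \<Longrightarrow> \<exists>P j. j < length P \<and> (\<forall>i<length P. (P ! i, cyc_nth P (i + 1)) \<in> edges) \<and>
      P ! j = a \<and> cyc_nth P (j + 1) = c"
    and walks: "\<And>P. closed_walk f \<Phi> Y P \<Longrightarrow> semi_linear P \<Longrightarrow>
       \<exists>A \<rho>. (\<forall>j<length P. A j > 0 \<and> \<rho> j > 0 \<and> local_map_bound \<Phi> E r Y P j (A j) (\<rho> j)) \<and>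
              (\<Prod>j<length P. \<rho> j) > 1"
  obtains \<rho> :: "real^'n \<Rightarrow> real^'n \<Rightarrow> real^'n \<Rightarrow> real" and \<pi> :: "(real^'n) \<times> (real^'n) \<Rightarrow> real" and \<eta> where "0 < \<eta>"
    "\<And>a c b. (a, c) \<in> edges \<Longrightarrow> (c, b) \<in> edges \<Longrightarrow> 0 < \<rho> a c b \<and> (\<exists>A>0. triple_bound a c b A (\<rho> a c b)) \<and>
       \<pi> (c, b) \<le> \<pi> (a, c) + ln (\<rho> a c b) - \<eta>"
proof -
  define good where "good e e' \<rho> \<longleftrightarrow> (\<exists>A>0. triple_bound (fst e) (snd e) (snd e') A \<rho>)"
    for e e' :: "(real^'n) \<times> (real^'n)" and \<rho>
  obtain \<rho> \<pi> \<eta> where *: "0 < \<eta>"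
    "\<And>e e'. (e, e') \<in> line_graph edges \<Longrightarrow> 0 < \<rho> e e' \<and> good e e' (\<rho> e e') \<and> \<pi> e' \<le> \<pi> e + ln (\<rho> e e') - \<eta>"
  proof (rule weighted_potential[OF finite_edges, of "line_graph edges" good])
    show "line_graph edges \<subseteq> edges \<times> edges" by (auto simp: line_graph_def)
    show "(e', e) \<in> (line_graph edges)\<^sup>*" if "(e, e') \<in> line_graph edges" for e e'
    proof (rule line_graph_back[OF _ that])
      fix x y assume "(x, y) \<in> edges"
      then obtain P j where "j < length P" "\<forall>i<length P. (P ! i, cyc_nth P (i + 1)) \<in> edges" "P ! j = x" "cyc_nth P (j + 1) = y"
        using on_cycle by blast
      then show "(y, x) \<in> edges\<^sup>*" using cyclic_walk_back[of P edges j] by blast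
    qed
    fix es assume es: "simple_cycle (line_graph edges) es"
    define P where "P = map snd es"
    note cyc = simple_cycle_line_graph[OF es, folded P_def]
    have len: "length P = length es" "P \<noteq> []" using es by (auto simp: P_def simple_cycle_def)
    have "closed_walk f \<Phi> Y P" using cyc(1) len by (auto simp: closed_walk_def edges_def)
    from walks[OF this cyc(2)] obtain A \<rho> where
      "\<forall>j<length P. A j > 0 \<and> \<rho> j > 0 \<and> local_map_bound \<Phi> E r Y P j (A j) (\<rho> j)" "(\<Prod>j<length P. \<rho> j) > 1"
      by blast
    then show "\<exists>\<rho>. (\<forall>j<length es. 0 < \<rho> j \<and> good (es ! j) (cyc_nth es (j + 1)) (\<rho> j)) \<and> 1 < (\<Prod>j<length es. \<rho> j)"
      using cyc(3,4) unfolding good_def local_map_bound_triple len(1) by (intro exI[of _ \<rho>]) force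
  qed blast
  show ?thesis
  proof (rule that[of \<eta> "\<lambda>a c b. \<rho> (a, c) (c, b)" \<pi>])
    show "0 < \<eta>" by (rule *)
    fix a c b assume "(a, c) \<in> edges" "(c, b) \<in> edges"
    then have "((a, c), (c, b)) \<in> line_graph edges" by (auto simp: line_graph_def)
    from *(2)[OF this] show "0 < \<rho> (a, c) (c, b) \<and> (\<exists>A>0. triple_bound a c b A (\<rho> (a, c) (c, b))) \<and>
       \<pi> (c, b) \<le> \<pi> (a, c) + ln (\<rho> (a, c) (c, b)) - \<eta>" by (simp add: good_def)
  qed
qed

lemma uniform_triple_bound:
  assumes "\<And>a c b. (a, c) \<in> edges \<Longrightarrow> (c, b) \<in> edges \<Longrightarrow> \<exists>A>0. triple_bound a c b A (\<rho> a c b)"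
  obtains A \<delta> where "1 \<le> A" "0 < \<delta>"
    "\<And>a c b u s t. (a, c) \<in> edges \<Longrightarrow> (c, b) \<in> edges \<Longrightarrow> solves f u \<Longrightarrow> u 0 \<notin> Y \<Longrightarrow> passage u a c b s t \<delta> \<Longrightarrow>
      d (u t) \<le> A * d (u s) powr \<rho> a c b"
proof -
  define P where "P = (\<lambda>(a, c, b) (n::nat). \<forall>u s t. solves f u \<and> u 0 \<notin> Y \<and> passage u a c b s t (1 / real (Suc n)) \<longrightarrow>
      d (u t) \<le> real (Suc n) * d (u s) powr \<rho> a c b)"
  define X where "X = {(a, c, b) | a c b. (a, c) \<in> edges \<and> (c, b) \<in> edges}"
  have mono: "passage u a c b s t \<delta>'" if "passage u a c b s t \<delta>" "\<delta> \<le> \<delta>'" for u a c b s t \<delta> \<delta>'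
    using that by (auto simp: passage_def intro: less_le_trans)
  have "X \<subseteq> Q \<times> Q \<times> Q" using edges_subset by (auto simp: X_def)
  then have "finite X" using Q(1) by (simp add: finite_subset)
  moreover have "\<exists>n. P x n" if xX: "x \<in> X" for x
  proof -
    obtain a c b where x: "x = (a, c, b)" "(a, c) \<in> edges" "(c, b) \<in> edges" using xX by (auto simp: X_def)
    obtain A \<delta> where A: "0 < \<delta>" "\<And>x s t. x \<notin> Y \<Longrightarrow> passage (\<lambda>\<tau>. \<Phi> \<tau> x) a c b s t \<delta> \<Longrightarrow>
        d (\<Phi> t x) < A * d (\<Phi> s x) powr \<rho> a c b"
      using assms[OF x(2,3)] unfolding triple_bound_def by blast
    obtain n :: nat where n: "max A (1 / \<delta>) < real n" using reals_Archimedean2 by blast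
    have small: "1 / real (Suc n) \<le> \<delta>" using n A by (simp add: field_simps)
    have "d (u t) \<le> real (Suc n) * d (u s) powr \<rho> a c b"
      if u: "solves f u" "u 0 \<notin> Y" and p: "passage u a c b s t (1 / real (Suc n))" for u s t
    proof -
      have "\<Phi> \<tau> (u 0) = u \<tau>" for \<tau>
        by (rule solves_unique[OF sm flow_solves[OF fl] u(1)]) (rule flow_zero[OF fl])
      then have "d (u t) < A * d (u s) powr \<rho> a c b" using A(2)[OF u(2), of s t] mono[OF p small] by simp
      also have "\<dots> \<le> real (Suc n) * d (u s) powr \<rho> a c b" using n by (intro mult_right_mono) auto
      finally show ?thesis by simp
    qed
    then show ?thesis unfolding P_def x prod.case by blast
  qed
  moreover have "P x n" if "P x m" "m \<le> n" for x m n
  proof -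
    obtain a c b where x: "x = (a, c, b)" by (rule prod_cases3)
    have 1: "1 / real (Suc n) \<le> 1 / real (Suc m)" using that by (simp add: frac_le)
    have 2: "real (Suc m) * d y powr p \<le> real (Suc n) * d y powr p" for y p
      using that by (intro mult_right_mono) auto
    show ?thesis using that(1) mono[OF _ 1] order_trans[OF _ 2] unfolding P_def x prod.case by blast
  qed
  ultimately obtain n where n: "\<And>x. x \<in> X \<Longrightarrow> P x n" using finite_common_bound[of X P] by blast
  show ?thesis
  proof (rule that[of "real (Suc n)" "1 / real (Suc n)"])
    fix a c b u s t
    assume "(a, c) \<in> edges" "(c, b) \<in> edges" and u: "solves f u" "u 0 \<notin> Y" "passage u a c b s t (1 / real (Suc n))"
    then have "P (a, c, b) n" using n by (simp add: X_def)
    then show "d (u t) \<le> real (Suc n) * d (u s) powr \<rho> a c b" unfolding P_def prod.case using u by blast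
  qed auto
qed

end

text \<open>One threshold \<open>\<delta>0\<close> for all estimates: \<open>K\<close> bounds the growth of the distance between two boxes, and
  \<open>A\<close> and \<open>\<rho>\<close> bound its change through a box.\<close>
locale contracting_itinerary = heteroclinic_dynamics f \<Phi> Y Q E r
  for f :: "real^'n \<Rightarrow> real^'n" and \<Phi> Y Q E r +
  fixes S \<delta>0 K A \<eta> :: real
    and stage :: "(real \<Rightarrow> real^'n) \<Rightarrow> real^'n \<Rightarrow> real^'n \<Rightarrow> real \<Rightarrow> bool"
    and \<rho> :: "real^'n \<Rightarrow> real^'n \<Rightarrow> real^'n \<Rightarrow> real" and \<pi> :: "(real^'n) \<times> (real^'n) \<Rightarrow> real"
  assumes \<delta>0: "0 < \<delta>0" and K: "1 \<le> K" and A: "1 \<le> A" and \<eta>: "0 < \<eta>"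
    and stages: "itinerary S \<delta>0 stage"
    and grow: "\<And>u s t. solves f u \<Longrightarrow> d (u s) < \<delta>0 \<Longrightarrow> \<bar>t - s\<bar> \<le> S \<Longrightarrow> d (u t) \<le> K * d (u s)"
    and \<rho>: "\<And>a c b. edge a c \<Longrightarrow> edge c b \<Longrightarrow>
       0 < \<rho> a c b \<and> \<pi> (c, b) \<le> \<pi> (a, c) + ln (\<rho> a c b) - \<eta>"
    and bound: "\<And>a c b u s t. edge a c \<Longrightarrow> edge c b \<Longrightarrow> solves f u \<Longrightarrow> u 0 \<notin> Y \<Longrightarrow>
       passage u a c b s t \<delta>0 \<Longrightarrow> d (u t) \<le> A * d (u s) powr \<rho> a c b"
begin

lemma
  shows start: "solves f u \<Longrightarrow> d (u t) < \<delta>0 \<Longrightarrow> (\<And>c. c \<in> Q \<Longrightarrow> u t \<notin> N c) \<Longrightarrow>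
       \<exists>a c q. stage u a c q \<and> t \<le> q \<and> q \<le> t + S"
    and stage: "stage u a c q \<Longrightarrow> c \<in> Q \<and> edge a c \<and>
       u q \<in> entry_faces a c \<and> enters u (N c) q 1"
    and step: "solves f u \<Longrightarrow> stage u a c q \<Longrightarrow> q < \<beta> \<Longrightarrow> (\<And>t. q < t \<Longrightarrow> t < \<beta> \<Longrightarrow> u t \<in> N c) \<Longrightarrow>
       u \<beta> \<notin> N c \<Longrightarrow> d (u \<beta>) < \<delta>0 \<Longrightarrow> \<exists>b q1. \<beta> \<le> q1 \<and> q1 \<le> \<beta> + S \<and> edge c b \<and>
         u \<beta> \<in> exit_faces c b \<and> stage u c b q1"
  using stages unfolding itinerary_def Ball_def greaterThanLessThan_iff by blast+

lemma d_nonneg: "0 \<le> d x" by (rule maxdist_nonneg[OF Y(2)])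

definition "m = Min (insert 1 ((\<lambda>e. exp (\<pi> e)) ` edges))"
definition "M = Max (insert 1 ((\<lambda>e. exp (\<pi> e)) ` edges))"

lemma m: "0 < m" "edge a c \<Longrightarrow> m \<le> exp (\<pi> (a, c))"
  unfolding m_def using finite_edges by (auto simp: Min_gr_iff edges_def intro!: Min_le)

lemma M: "edge a c \<Longrightarrow> exp (\<pi> (a, c)) \<le> M"
  unfolding M_def using finite_edges by (auto simp: edges_def intro!: Max_ge)

definition "\<kappa> = (1 + exp \<eta>) / 2"

lemma \<kappa>: "1 < \<kappa>" "\<kappa> < exp \<eta>"
proof -
  have "1 < exp \<eta>" using \<eta> by simp
  then show "1 < \<kappa>" "\<kappa> < exp \<eta>" by (auto simp: \<kappa>_def)
qed

text \<open>From this level on, the loss of the factors \<open>K\<close> and \<open>A\<close> is made up for by claiming growth by \<open>\<kappa>\<close> only, instead of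
  \<open>exp \<eta>\<close>.\<close>
definition "\<Lambda>0 = max 1 (ln (K * A) / ((exp \<eta> - \<kappa>) * m))"

lemma \<Lambda>0: "1 \<le> \<Lambda>0" "ln (K * A) \<le> (exp \<eta> - \<kappa>) * \<Lambda>0 * m"
proof -
  have "ln (K * A) / ((exp \<eta> - \<kappa>) * m) \<le> \<Lambda>0" by (simp add: \<Lambda>0_def)
  then show "ln (K * A) \<le> (exp \<eta> - \<kappa>) * \<Lambda>0 * m"
    using \<kappa> m(1) by (simp add: pos_divide_le_eq mult.assoc mult.left_commute mult.commute)
qed (simp add: \<Lambda>0_def)

text \<open>\<open>\<Lambda>\<close> measures the closeness to \<open>Y\<close> as \<open>|ln d|\<close>, rescaled by the potential of the current edge so that it
  can be compared between different edges.\<close>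
definition level :: "(real \<Rightarrow> real^'n) \<Rightarrow> real^'n \<Rightarrow> real^'n \<Rightarrow> real \<Rightarrow> real \<Rightarrow> bool" where
  "level u a c q \<Lambda> \<longleftrightarrow> stage u a c q \<and> d (u q) \<le> exp (- \<Lambda> * exp (\<pi> (a, c)))"

lemma trapped:
  assumes trapped: "solves f u" "c \<in> Q" "\<And>t. q < t \<Longrightarrow> u t \<in> N c"
  shows "((\<lambda>t. d (u t)) \<longlongrightarrow> 0) at_top"
proof -
  have "(u \<longlongrightarrow> c) at_top" by (rule isolated_top[OF trapped(2,1), of "q + 1"]) (use trapped(3) N_sub_B in force)
  then have "((\<lambda>t. d (u t)) \<longlongrightarrow> d c) at_top" by (rule tendsto_maxdist[OF Y(1,2)])
  moreover have "d c = 0" using maxdist_mem_iff[OF Y(1,2), of c] d_nonneg[of c] Q(2) trapped(2) by fastforce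
  ultimately show ?thesis by simp
qed

text \<open>If the trajectory leaves the box, the entry distance \<open>exp (- \<Lambda> exp (\<pi> (a, c)))\<close> becomes at most
  \<open>K A exp (- \<rho> \<Lambda> exp (\<pi> (a, c)))\<close> at the next entry, and \<open>\<rho> exp (\<pi> (a, c)) \<ge> exp \<eta> exp (\<pi> (c, b))\<close>.\<close>
lemma progress:
  assumes \<epsilon>: "0 < \<epsilon>"
  obtains \<Lambda>1 where "\<Lambda>0 \<le> \<Lambda>1"
    "\<And>u a c q \<Lambda>. solves f u \<Longrightarrow> u 0 \<notin> Y \<Longrightarrow> level u a c q \<Lambda> \<Longrightarrow> \<Lambda>1 \<le> \<Lambda> \<Longrightarrow>
      (\<forall>t\<ge>q. d (u t) < \<epsilon>) \<and> ((\<lambda>t. d (u t)) \<longlongrightarrow> 0) at_top \<or>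
      (\<exists>b q1. q + 1 \<le> q1 \<and> (\<forall>t\<in>{q..q1}. d (u t) < \<epsilon>) \<and> level u c b q1 (\<kappa> * \<Lambda>))"
proof -
  define \<epsilon>' where "\<epsilon>' = min (\<epsilon> / K) (min \<epsilon> \<delta>0)"
  have \<epsilon>': "0 < \<epsilon>'" "\<epsilon>' \<le> \<epsilon>" "\<epsilon>' \<le> \<delta>0" using \<epsilon> \<delta>0 K by (auto simp: \<epsilon>'_def)
  have "K * \<epsilon>' \<le> K * (\<epsilon> / K)" using K by (intro mult_left_mono) (auto simp: \<epsilon>'_def)
  then have K\<epsilon>': "K * \<epsilon>' \<le> \<epsilon>" using K by simp
  obtain \<delta>' where \<delta>': "0 < \<delta>'" and stay:
    "\<And>u c s t. solves f u \<Longrightarrow> c \<in> Q \<Longrightarrow> s \<le> t \<Longrightarrow> (\<And>\<tau>. s \<le> \<tau> \<Longrightarrow> \<tau> \<le> t \<Longrightarrow> u \<tau> \<in> B c) \<Longrightarrow> d (u s) < \<delta>' \<Longrightarrow> d (u t) < \<epsilon>'"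
    using stay_close[OF \<epsilon>'(1)] by blast
  define \<Lambda>1 where "\<Lambda>1 = max \<Lambda>0 ((1 - ln \<delta>') / m)"
  have KA: "0 < K * A" using K A by simp
  have "(\<forall>t\<ge>q. d (u t) < \<epsilon>) \<and> ((\<lambda>t. d (u t)) \<longlongrightarrow> 0) at_top \<or>
    (\<exists>b q1. q + 1 \<le> q1 \<and> (\<forall>t\<in>{q..q1}. d (u t) < \<epsilon>) \<and> level u c b q1 (\<kappa> * \<Lambda>))"
    if u: "solves f u" and nY: "u 0 \<notin> Y" and lv: "level u a c q \<Lambda>" and \<Lambda>: "\<Lambda>1 \<le> \<Lambda>" for u a c q \<Lambda>
  proof -
    have s: "stage u a c q" and dq: "d (u q) \<le> exp (- \<Lambda> * exp (\<pi> (a, c)))" using lv by (auto simp: level_def)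
    have c: "c \<in> Q" and ac: "edge a c" and entry: "u q \<in> entry_faces a c"
      and en: "enters u (N c) q 1"
      using stage[OF s] by auto
    have \<Lambda>pos: "\<Lambda>0 \<le> \<Lambda>" "0 < \<Lambda>" using \<Lambda> \<Lambda>0 by (auto simp: \<Lambda>1_def)
    have uq: "u q \<in> B c" by (rule enters_closure[OF en _ solves_continuous[OF u] N_sub_B closed_closed_box]) simp
    have "1 - ln \<delta>' \<le> \<Lambda> * m" using \<Lambda> m by (simp add: \<Lambda>1_def pos_divide_le_eq)
    also have "\<dots> \<le> \<Lambda> * exp (\<pi> (a, c))" using m(2)[OF ac] \<Lambda>pos by simp
    finally have "- \<Lambda> * exp (\<pi> (a, c)) < ln \<delta>'" by simp
    then have "exp (- \<Lambda> * exp (\<pi> (a, c))) < exp (ln \<delta>')" by (simp only: exp_less_cancel_iff)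
    then have "exp (- \<Lambda> * exp (\<pi> (a, c))) < \<delta>'" using \<delta>' by simp
    then have dq': "d (u q) < \<delta>'" using dq by linarith
    show ?thesis
    proof (cases "\<forall>t>q. u t \<in> N c")
      case True
      have inB: "u \<tau> \<in> B c" if "q \<le> \<tau>" for \<tau>
        proof (cases "\<tau> = q")
          case False
          then have "u \<tau> \<in> N c" using that True by simp
          then show ?thesis using N_sub_B by blast
        qed (simp add: uq)
      have "d (u t) < \<epsilon>" if "q \<le> t" for t using stay[OF u c that inB dq'] \<epsilon>' by simp
      moreover have "((\<lambda>t. d (u t)) \<longlongrightarrow> 0) at_top" using True by (intro trapped[OF u c, of q]) simp
        ultimately show ?thesis by blast
    next
      case False
      then obtain t' where t': "q < t'" "u t' \<notin> N c" by auto
      have "q + 1 \<le> t'"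
      proof (rule ccontr)
        assume "\<not> q + 1 \<le> t'"
        then show False using en t' by (simp add: enters_def)
      qed
      \<comment> \<open>The trajectory is on the boundary at time \<open>q\<close>, so the search for the exit starts inside the box.\<close>
      obtain \<beta> where \<beta>: "q + 1/2 < \<beta>" "\<beta> \<le> t'" "exits u (N c) \<beta> (1/4)" "\<And>s. q + 1/2 - 1/4 \<le> s \<Longrightarrow> s < \<beta> \<Longrightarrow> u s \<in> N c"
      proof (rule first_exit[OF solves_continuous[OF u] open_box_nbhd _ t'(2), of "q + 1/2" "1/4"])
        show "u s \<in> N c" if "q + 1/2 - 1/4 \<le> s" "s \<le> q + 1/2" for s using en that by (simp add: enters_def)
      qed (use \<open>q + 1 \<le> t'\<close> in auto)
      have out: "u \<beta> \<notin> N c" using \<beta>(3) by (simp add: exits_def)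
      have pass: "u t \<in> N c" if "q < t" "t < \<beta>" for t
        using \<beta>(4)[of t] en that by (cases "t < q + 1") (auto simp: enters_def)
      have q1: "q + 1 \<le> \<beta>"
      proof (rule ccontr)
        assume "\<not> q + 1 \<le> \<beta>"
        then show False using en \<beta>(1) out by (simp add: enters_def)
      qed
      have "u \<beta> \<in> B c" by (rule exits_closure[OF \<beta>(3) _ solves_continuous[OF u] N_sub_B closed_closed_box]) simp
      then have inB: "u \<tau> \<in> B c" if "q \<le> \<tau>" "\<tau> \<le> \<beta>" for \<tau>
      proof (cases "\<tau> = q \<or> \<tau> = \<beta>")
        case False
        then have "u \<tau> \<in> N c" using that by (intro pass) auto
        then show ?thesis using N_sub_B by blast
      qed (use uq \<open>u \<beta> \<in> B c\<close> in auto)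
      have near: "d (u t) < \<epsilon>'" if "q \<le> t" "t \<le> \<beta>" for t
        by (rule stay[OF u c that(1) inB dq']) (use that in auto)
      have "d (u \<beta>) < \<delta>0" using near[of \<beta>] q1 \<epsilon>' by simp
      from step[OF u s _ pass out this] obtain b q1 where
        b: "\<beta> \<le> q1" "q1 \<le> \<beta> + S" "edge c b" "u \<beta> \<in> exit_faces c b" "stage u c b q1"
        using q1 by auto
      note cb = b(3)
      have after: "d (u t) \<le> K * d (u \<beta>)" if "\<beta> \<le> t" "t \<le> q1" for t
        by (rule grow[OF u]) (use near[of \<beta>] q1 \<epsilon>' that b in \<open>auto simp: \<close>)
      have "d (u t) < \<epsilon>" if "q \<le> t" "t \<le> q1" for t
      proof (cases "t \<le> \<beta>")
        case True then show ?thesis using near that \<epsilon>' by fastforce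
      next
        case False
        then have "d (u t) \<le> K * d (u \<beta>)" using after that by simp
        also have "\<dots> < K * \<epsilon>'" using near[of \<beta>] q1 K by (intro mult_strict_left_mono) auto
        finally show ?thesis using K\<epsilon>' by simp
      qed
      moreover have "level u c b q1 (\<kappa> * \<Lambda>)"
      proof -
        have \<rho>': "0 < \<rho> a c b" "\<pi> (c, b) \<le> \<pi> (a, c) + ln (\<rho> a c b) - \<eta>" using \<rho>[OF ac cb] by auto
        have "d (u \<beta>) \<le> A * d (u q) powr \<rho> a c b"
          using q1 pass entry b(4) less_le_trans[OF near \<epsilon>'(3)]
          by (intro bound[OF ac cb u nY]) (auto simp: passage_def)
      also have "\<dots> \<le> A * exp (- \<Lambda> * exp (\<pi> (a, c))) powr \<rho> a c b"
          using dq d_nonneg \<rho>' A by (intro mult_left_mono powr_mono2) auto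
        finally have "d (u \<beta>) \<le> A * exp (- \<Lambda> * exp (\<pi> (a, c)) * \<rho> a c b)" by (simp add: exp_powr_real)
        then have "K * d (u \<beta>) \<le> K * (A * exp (- \<Lambda> * exp (\<pi> (a, c)) * \<rho> a c b))"
          using K by (intro mult_left_mono) auto
        also have "\<dots> = exp (ln (K * A) - \<Lambda> * exp (\<pi> (a, c)) * \<rho> a c b)" unfolding exp_diff exp_ln[OF KA] by (simp add: exp_minus divide_inverse)
        also have "\<dots> \<le> exp (- (\<kappa> * \<Lambda>) * exp (\<pi> (c, b)))"
        proof -
          have "exp (\<eta> + \<pi> (c, b)) \<le> exp (\<pi> (a, c) + ln (\<rho> a c b))" using \<rho>'(2) by simp
          then have "exp \<eta> * exp (\<pi> (c, b)) \<le> exp (\<pi> (a, c)) * \<rho> a c b" using \<rho>'(1) by (simp add: exp_add)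
          then have 1: "\<Lambda> * (exp \<eta> * exp (\<pi> (c, b))) \<le> \<Lambda> * (exp (\<pi> (a, c)) * \<rho> a c b)"
            using \<Lambda>pos by (intro mult_left_mono) auto
          have "ln (K * A) \<le> (exp \<eta> - \<kappa>) * \<Lambda>0 * m" by (rule \<Lambda>0)
          also have "\<dots> \<le> (exp \<eta> - \<kappa>) * \<Lambda> * exp (\<pi> (c, b))"
            using \<kappa> \<Lambda>pos \<Lambda>0 m m(2)[OF cb] by (intro mult_mono mult_left_mono) auto
          finally show ?thesis using 1 by (simp add: algebra_simps)
        qed
        finally show ?thesis using after[of q1] b unfolding level_def by simp
      qed
      ultimately show ?thesis using q1 b(1) by (intro disjI2 exI[of _ b] exI[of _ q1]) auto
    qed
  qed
  then show ?thesis by (intro that[of \<Lambda>1]) (auto simp: \<Lambda>1_def)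
qed

lemma forever:
  assumes \<epsilon>: "0 < \<epsilon>"
  obtains \<Lambda>1 where "\<And>u a c q \<Lambda> t. solves f u \<Longrightarrow> u 0 \<notin> Y \<Longrightarrow> level u a c q \<Lambda> \<Longrightarrow> \<Lambda>1 \<le> \<Lambda> \<Longrightarrow> q \<le> t \<Longrightarrow> d (u t) < \<epsilon>"
proof -
  obtain \<Lambda>1 where \<Lambda>1: "\<Lambda>0 \<le> \<Lambda>1" and pr: "\<And>u a c q \<Lambda>. solves f u \<Longrightarrow> u 0 \<notin> Y \<Longrightarrow> level u a c q \<Lambda> \<Longrightarrow> \<Lambda>1 \<le> \<Lambda> \<Longrightarrow>
    (\<forall>t\<ge>q. d (u t) < \<epsilon>) \<and> ((\<lambda>t. d (u t)) \<longlongrightarrow> 0) at_top \<or>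
    (\<exists>b q1. q + 1 \<le> q1 \<and> (\<forall>t\<in>{q..q1}. d (u t) < \<epsilon>) \<and> level u c b q1 (\<kappa> * \<Lambda>))"
    using progress[OF \<epsilon>] by blast
  have "\<forall>t. q \<le> t \<and> t \<le> q + real n \<longrightarrow> d (u t) < \<epsilon>"
    if u: "solves f u" "u 0 \<notin> Y" and "level u a c q \<Lambda>" "\<Lambda>1 \<le> \<Lambda>" for u a c q \<Lambda> n
    using that(3,4)
  proof (induction n arbitrary: a c q \<Lambda>)
    case 0
    from pr[OF u 0] show ?case by auto
  next
    case (Suc n)
    from pr[OF u Suc.prems] consider "\<forall>t\<ge>q. d (u t) < \<epsilon>"
      | b q1 where "q + 1 \<le> q1" "\<forall>t\<in>{q..q1}. d (u t) < \<epsilon>" "level u c b q1 (\<kappa> * \<Lambda>)" by blast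
    then show ?case
    proof cases
      case 2
      have "1 * \<Lambda> \<le> \<kappa> * \<Lambda>" using \<kappa> Suc.prems \<Lambda>1 \<Lambda>0 by (intro mult_right_mono) auto
      then have IH: "\<forall>t. q1 \<le> t \<and> t \<le> q1 + real n \<longrightarrow> d (u t) < \<epsilon>"
        using Suc.IH[OF 2(3)] Suc.prems(2) order_trans[OF Suc.prems(2)] by simp
      show ?thesis
      proof (intro allI impI)
        fix t assume "q \<le> t \<and> t \<le> q + real (Suc n)"
        then show "d (u t) < \<epsilon>" using IH 2 by (cases "t \<le> q1") auto
      qed
    qed simp
  qed note * = this
  have "d (u t) < \<epsilon>" if "solves f u" "u 0 \<notin> Y" "level u a c q \<Lambda>" "\<Lambda>1 \<le> \<Lambda>" "q \<le> t" for u a c q \<Lambda> t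
    proof -
    have "t \<le> q + real (nat \<lceil>t - q\<rceil>)" using real_nat_ceiling_ge[of "t - q"] by linarith
    then show ?thesis using *[OF that(1-4)] that(5) by blast
  qed
  then show ?thesis by (rule that)
qed

lemma convergence:
  obtains \<Lambda>1 where "\<And>u a c q \<Lambda>. solves f u \<Longrightarrow> u 0 \<notin> Y \<Longrightarrow> level u a c q \<Lambda> \<Longrightarrow> \<Lambda>1 \<le> \<Lambda> \<Longrightarrow> ((\<lambda>t. d (u t)) \<longlongrightarrow> 0) at_top"
proof -
  obtain \<Lambda>1 where \<Lambda>1: "\<Lambda>0 \<le> \<Lambda>1" and pr: "\<And>u a c q \<Lambda>. solves f u \<Longrightarrow> u 0 \<notin> Y \<Longrightarrow> level u a c q \<Lambda> \<Longrightarrow> \<Lambda>1 \<le> \<Lambda> \<Longrightarrow>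
    (\<forall>t\<ge>q. d (u t) < 1) \<and> ((\<lambda>t. d (u t)) \<longlongrightarrow> 0) at_top \<or>
    (\<exists>b q1. q + 1 \<le> q1 \<and> (\<forall>t\<in>{q..q1}. d (u t) < 1) \<and> level u c b q1 (\<kappa> * \<Lambda>))"
    using progress[OF zero_less_one] by blast
  have "((\<lambda>t. d (u t)) \<longlongrightarrow> 0) at_top" if u: "solves f u" "u 0 \<notin> Y" and lv: "level u a c q \<Lambda>" "\<Lambda>1 \<le> \<Lambda>" for u a c q \<Lambda>
  proof (rule ccontr)
    assume neg: "\<not> ((\<lambda>t. d (u t)) \<longlongrightarrow> 0) at_top"
    have \<Lambda>: "1 \<le> \<Lambda>" using \<Lambda>1 \<Lambda>0 lv by simp
    have chain: "\<exists>a c q. level u a c q (\<kappa> ^ n * \<Lambda>)" for n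
    proof (induction n)
      case 0 then show ?case using lv by auto
    next
      case (Suc n)
      then obtain a c q where q: "level u a c q (\<kappa> ^ n * \<Lambda>)" by blast
      have "1 * \<Lambda> \<le> \<kappa> ^ n * \<Lambda>" using \<kappa> \<Lambda> by (intro mult_right_mono one_le_power) auto
      then have "\<Lambda>1 \<le> \<kappa> ^ n * \<Lambda>" using lv by simp
      from pr[OF u q this] neg obtain b q1 where "level u c b q1 (\<kappa> * (\<kappa> ^ n * \<Lambda>))" by blast
      then show ?case by (auto simp: mult.assoc)
    qed
    have "((\<lambda>t. d (u t)) \<longlongrightarrow> 0) at_top"
    proof (rule tendstoI)
      fix e :: real assume "0 < e"
      from forever[OF this] obtain \<Lambda>2 where fe: "\<And>u a c q \<Lambda> t. solves f u \<Longrightarrow> u 0 \<notin> Y \<Longrightarrow> level u a c q \<Lambda> \<Longrightarrow> \<Lambda>2 \<le> \<Lambda> \<Longrightarrow> q \<le> t \<Longrightarrow> d (u t) < e"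
        by blast
      obtain n where "\<Lambda>2 < \<kappa> ^ n" using real_arch_pow[OF \<kappa>(1)] by blast
      moreover have "\<kappa> ^ n * 1 \<le> \<kappa> ^ n * \<Lambda>" using \<Lambda> \<kappa> by (intro mult_left_mono) auto
      ultimately have "\<Lambda>2 \<le> \<kappa> ^ n * \<Lambda>" by simp
      moreover obtain a c q where "level u a c q (\<kappa> ^ n * \<Lambda>)" using chain by blast
      ultimately have "\<forall>t\<ge>q. d (u t) < e" using fe[OF u] by blast
      then show "\<forall>\<^sub>F t in at_top. dist (d (u t)) 0 < e"
        using d_nonneg by (auto simp: eventually_at_top_linorder intro!: exI[of _ q])
    qed
    then show False using neg by simp
  qed
  then show ?thesis by (rule that)
qed

text \<open>A trajectory that starts in a box leaves it close to \<open>Y\<close> or is trapped there; outside the boxes it is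
  soon at its first stage, whose level is high because the distance is small.\<close>
lemma attraction:
  assumes \<epsilon>: "0 < \<epsilon>"
  obtains \<delta> where "0 < \<delta>" "\<And>u. solves f u \<Longrightarrow> d (u 0) < \<delta> \<Longrightarrow> (\<forall>t\<ge>0. d (u t) < \<epsilon>) \<and> ((\<lambda>t. d (u t)) \<longlongrightarrow> 0) at_top"
proof -
  obtain \<Lambda>1 where f1: "\<And>u a c q \<Lambda> t. solves f u \<Longrightarrow> u 0 \<notin> Y \<Longrightarrow> level u a c q \<Lambda> \<Longrightarrow> \<Lambda>1 \<le> \<Lambda> \<Longrightarrow> q \<le> t \<Longrightarrow> d (u t) < \<epsilon>"
    using forever[OF \<epsilon>] by blast
  obtain \<Lambda>2 where f2: "\<And>u a c q \<Lambda>. solves f u \<Longrightarrow> u 0 \<notin> Y \<Longrightarrow> level u a c q \<Lambda> \<Longrightarrow> \<Lambda>2 \<le> \<Lambda> \<Longrightarrow> ((\<lambda>t. d (u t)) \<longlongrightarrow> 0) at_top"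
    using convergence by blast
  define \<Lambda> where "\<Lambda> = max 1 (max \<Lambda>1 \<Lambda>2)"
  define \<delta>' where "\<delta>' = min \<delta>0 (min (\<epsilon> / K) (exp (- \<Lambda> * M) / K))"
  have \<delta>': "0 < \<delta>'" using \<delta>0 \<epsilon> K by (auto simp: \<delta>'_def)
  have outside: "(\<forall>t\<ge>t0. d (u t) < \<epsilon>) \<and> ((\<lambda>t. d (u t)) \<longlongrightarrow> 0) at_top"
    if u: "solves f u" "u 0 \<notin> Y" and out: "\<And>c. c \<in> Q \<Longrightarrow> u t0 \<notin> N c" and d0: "d (u t0) < \<delta>'" for u t0
  proof -
    have "d (u t0) < \<delta>0" using d0 by (simp add: \<delta>'_def)
    from start[OF u(1) this out] obtain a c q where q: "stage u a c q" "t0 \<le> q" "q \<le> t0 + S" by blast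
    have g: "d (u t) \<le> K * d (u t0)" if "t0 \<le> t" "t \<le> q" for t
      by (rule grow[OF u(1)]) (use d0 that q in \<open>auto simp: \<delta>'_def\<close>)
    have K\<delta>: "K * d (u t0) < \<epsilon>" "K * d (u t0) < exp (- \<Lambda> * M)" using d0 K by (auto simp: \<delta>'_def field_simps)
    have "edge a c" using stage[OF q(1)] by simp
    then have "\<Lambda> * exp (\<pi> (a, c)) \<le> \<Lambda> * M" using M by (intro mult_left_mono) (auto simp: \<Lambda>_def)
    then have "exp (- \<Lambda> * M) \<le> exp (- \<Lambda> * exp (\<pi> (a, c)))" by simp
    then have "d (u q) \<le> exp (- \<Lambda> * exp (\<pi> (a, c)))" using g[of q] q(2) K\<delta>(2) by linarith
    then have "level u a c q \<Lambda>" using q(1) by (simp add: level_def)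
    then have "\<forall>t\<ge>q. d (u t) < \<epsilon>" "((\<lambda>t. d (u t)) \<longlongrightarrow> 0) at_top"
      using f1[OF u, of a c q \<Lambda>] f2[OF u, of a c q \<Lambda>] by (auto simp: \<Lambda>_def)
    moreover have "d (u t) < \<epsilon>" if "t0 \<le> t" "t \<le> q" for t using g[OF that] K\<delta> by simp
    ultimately show ?thesis by (meson linorder_linear)
  qed
  obtain \<delta> where \<delta>: "0 < \<delta>" and stay:
    "\<And>u c s t. solves f u \<Longrightarrow> c \<in> Q \<Longrightarrow> s \<le> t \<Longrightarrow> (\<And>\<tau>. s \<le> \<tau> \<Longrightarrow> \<tau> \<le> t \<Longrightarrow> u \<tau> \<in> B c) \<Longrightarrow> d (u s) < \<delta> \<Longrightarrow> d (u t) < min \<epsilon> \<delta>'"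
    using stay_close[of "min \<epsilon> \<delta>'"] \<epsilon> \<delta>' by auto
  show ?thesis
  proof (rule that[of "min \<delta> \<delta>'"])
    show "0 < min \<delta> \<delta>'" using \<delta> \<delta>' by simp
    fix u assume u: "solves f u" and d0: "d (u 0) < min \<delta> \<delta>'"
    show "(\<forall>t\<ge>0. d (u t) < \<epsilon>) \<and> ((\<lambda>t. d (u t)) \<longlongrightarrow> 0) at_top"
    proof (cases "u 0 \<in> Y")
      case True
      have "u t \<in> Y" for t
        using solves_unique[OF sm flow_solves[OF fl] u, of "u 0" t] flow_zero[OF fl] Y(3) True
        by (metis invariant_def)
      then have "d (u t) = 0" for t using maxdist_mem_iff[OF Y(1,2), of "u t"] d_nonneg[of "u t"] by simp
      then show ?thesis using \<epsilon> by simp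
    next
      case nY: False
      show ?thesis
      proof (cases "\<exists>c\<in>Q. u 0 \<in> N c")
        case False
        then show ?thesis using outside[OF u nY, of 0] d0 by auto
      next
        case True
        then obtain c where c: "c \<in> Q" "u 0 \<in> N c" by blast
        show ?thesis
        proof (cases "\<forall>t>0. u t \<in> N c")
          case True
          have "u \<tau> \<in> N c" if "0 \<le> \<tau>" for \<tau> using that True c(2) by (cases "\<tau> = 0") auto
          then have "u \<tau> \<in> B c" if "0 \<le> \<tau>" for \<tau> using that N_sub_B by blast
          then have "d (u t) < min \<epsilon> \<delta>'" if "0 \<le> t" for t
            by (intro stay[OF u c(1) that]) (use d0 in auto)
          moreover have "((\<lambda>t. d (u t)) \<longlongrightarrow> 0) at_top" using True by (intro trapped[OF u c(1), of 0]) simp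
          ultimately show ?thesis by simp
        next
          case False
          then obtain t' where t': "0 \<le> t'" "u t' \<notin> N c" by (meson less_imp_le)
          obtain \<beta> where \<beta>: "0 < \<beta>" "\<beta> \<le> t'" "exits u (N c) \<beta> 0" "\<And>s. 0 - 0 \<le> s \<Longrightarrow> s < \<beta> \<Longrightarrow> u s \<in> N c"
            by (rule first_exit[OF solves_continuous[OF u] open_box_nbhd t', of 0]) (use c in auto)
          have ex: "exits u (N c) \<beta> \<beta>" using \<beta> by (auto simp: exits_def)
          have "u \<beta> \<in> B c" by (rule exits_closure[OF ex \<beta>(1) solves_continuous[OF u] N_sub_B closed_closed_box])
          then have inB: "u \<tau> \<in> B c" if "0 \<le> \<tau>" "\<tau> \<le> \<beta>" for \<tau>
          proof (cases "\<tau> = \<beta>")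
            case False
            then have "u \<tau> \<in> N c" using that by (intro \<beta>(4)) auto
            then show ?thesis using N_sub_B by blast
          qed (use \<open>u \<beta> \<in> B c\<close> in simp)
          have near: "d (u t) < min \<epsilon> \<delta>'" if "0 \<le> t" "t \<le> \<beta>" for t
            by (rule stay[OF u c(1) that(1) inB]) (use that d0 in auto)
          have "u \<beta> \<notin> N e" if "e \<in> Q" for e
            using N_disjoint[OF that c(1)] \<open>u \<beta> \<in> B c\<close> \<beta>(3) by (auto simp: exits_def)
          then have "(\<forall>t\<ge>\<beta>. d (u t) < \<epsilon>) \<and> ((\<lambda>t. d (u t)) \<longlongrightarrow> 0) at_top"
            using outside[OF u nY, of \<beta>] near[of \<beta>] \<beta>(1) by auto
          moreover have "d (u t) < \<epsilon>" if "0 \<le> t" "t \<le> \<beta>" for t using near[OF that] by simp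
          ultimately show ?thesis by (meson linorder_linear)
        qed
      qed
    qed
  qed
qed

end

section \<open>Asymptotic stability\<close>

context heteroclinic_dynamics
begin

lemma asymptotically_stable_if_contracting:
  assumes on_cycle: "\<And>a c. (a, c) \<in> edges \<Longrightarrow> \<exists>P j. j < length P \<and> (\<forall>i<length P. (P ! i, cyc_nth P (i + 1)) \<in> edges) \<and>
      P ! j = a \<and> cyc_nth P (j + 1) = c"
    and walks: "\<And>P. closed_walk f \<Phi> Y P \<Longrightarrow> semi_linear P \<Longrightarrow>
       \<exists>A \<rho>. (\<forall>j<length P. A j > 0 \<and> \<rho> j > 0 \<and> local_map_bound \<Phi> E r Y P j (A j) (\<rho> j)) \<and>
              (\<Prod>j<length P. \<rho> j) > 1"
  shows "asymptotically_stable \<Phi> Y"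
proof -
  obtain \<rho> \<pi> \<eta> where *: "0 < \<eta>"
    "\<And>a c b. (a, c) \<in> edges \<Longrightarrow> (c, b) \<in> edges \<Longrightarrow> 0 < \<rho> a c b \<and> (\<exists>A>0. triple_bound a c b A (\<rho> a c b)) \<and>
       \<pi> (c, b) \<le> \<pi> (a, c) + ln (\<rho> a c b) - \<eta>"
  proof (rule exponents[OF on_cycle walks])
    fix \<rho> \<eta> and \<pi> :: "(real^'n) \<times> (real^'n) \<Rightarrow> real" assume "0 < \<eta>"
      "\<And>a c b. (a, c) \<in> edges \<Longrightarrow> (c, b) \<in> edges \<Longrightarrow> 0 < \<rho> a c b \<and> (\<exists>A>0. triple_bound a c b A (\<rho> a c b)) \<and>
         \<pi> (c, b) \<le> \<pi> (a, c) + ln (\<rho> a c b) - \<eta>"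
    then show thesis by (rule that)
  qed
  obtain S \<delta>1 stage where \<delta>1: "0 < \<delta>1" and it: "itinerary S \<delta>1 stage"
    by (rule itinerary_exists)
  obtain \<delta>2 K where \<delta>2: "0 < \<delta>2" "1 \<le> K" and
    grow: "\<And>u s t. solves f u \<Longrightarrow> d (u s) < \<delta>2 \<Longrightarrow> \<bar>t - s\<bar> \<le> S \<Longrightarrow> d (u t) \<le> K * d (u s)"
    using growth[of S] by blast
  obtain A \<delta>3 where A: "1 \<le> A" and \<delta>3: "0 < \<delta>3" and bound:
    "\<And>a c b u s t. (a, c) \<in> edges \<Longrightarrow> (c, b) \<in> edges \<Longrightarrow> solves f u \<Longrightarrow> u 0 \<notin> Y \<Longrightarrow> passage u a c b s t \<delta>3 \<Longrightarrow>
      d (u t) \<le> A * d (u s) powr \<rho> a c b"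
    by (rule uniform_triple_bound[of \<rho>]) (use *(2) in blast)+
  define \<delta>0 where "\<delta>0 = min \<delta>1 (min \<delta>2 \<delta>3)"
  have le: "x < \<delta>1" "x < \<delta>2" "x < \<delta>3" if "x < \<delta>0" for x using that by (auto simp: \<delta>0_def)
  interpret contracting_itinerary f \<Phi> Y Q E r S \<delta>0 K A \<eta> stage \<rho> \<pi>
  proof unfold_locales
    fix a c b u s t
    assume "edge a c" "edge c b" "solves f u" "u 0 \<notin> Y" "passage u a c b s t \<delta>0"
    then show "d (u t) \<le> A * d (u s) powr \<rho> a c b"
      by (intro bound) (auto simp: edges_def passage_def intro: le)
  next
    show "itinerary S \<delta>0 stage" using it le(1) unfolding itinerary_def by blast
  next
    fix a c b assume "edge a c" "edge c b"
    then show "0 < \<rho> a c b \<and> \<pi> (c, b) \<le> \<pi> (a, c) + ln (\<rho> a c b) - \<eta>"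
      using *(2)[of a c b] by (auto simp: edges_def)
  next
    fix u s t assume "solves f u" "d (u s) < \<delta>0" "\<bar>t - s\<bar> \<le> S"
    then show "d (u t) \<le> K * d (u s)" by (intro grow le)
  next
    show "0 < \<delta>0" using \<delta>1 \<delta>2 \<delta>3 by (simp add: \<delta>0_def)
  qed (fact \<delta>2(2) A *(1))+
  have nbhd: "open {x. d x < \<delta>} \<and> Y \<subseteq> {x. d x < \<delta>}" if "0 < \<delta>" for \<delta>
  proof
    have "continuous_on UNIV d"
      unfolding continuous_on_def by (auto intro!: tendsto_maxdist[OF Y(1,2)] tendsto_ident_at)
    then show "open {x. d x < \<delta>}" by (intro open_Collect_less) auto
    show "Y \<subseteq> {x. d x < \<delta>}"
    proof
      fix x assume "x \<in> Y"
      then have "d x \<le> 0" using maxdist_mem_iff[OF Y(1,2)] by blast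
      then show "x \<in> {x. d x < \<delta>}" using that by simp
    qed
  qed
  have attr: "\<exists>\<delta>>0. \<forall>x. d x < \<delta> \<longrightarrow> (\<forall>t\<ge>0. d (\<Phi> t x) < \<epsilon>) \<and> ((\<lambda>t. d (\<Phi> t x)) \<longlongrightarrow> 0) at_top" if e0: "0 < \<epsilon>" for \<epsilon>
  proof -
    obtain \<delta> where \<delta>: "0 < \<delta>" "\<And>u. solves f u \<Longrightarrow> d (u 0) < \<delta> \<Longrightarrow> (\<forall>t\<ge>0. d (u t) < \<epsilon>) \<and> ((\<lambda>t. d (u t)) \<longlongrightarrow> 0) at_top"
      by (rule attraction[OF e0]) (rule that; blast)
    then show ?thesis using \<delta>(2)[OF flow_solves[OF fl]] flow_zero[OF fl] by (intro exI[of _ \<delta>]) simp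
  qed
  show ?thesis unfolding asymptotically_stable_def lyapunov_stable_def
  proof (intro conjI allI impI, elim conjE)
    fix U :: "(real^'n) set" assume U: "open U" "Y \<subseteq> U"
    obtain e where e: "0 < e" "(\<Union>y\<in>Y. ball y e) \<subseteq> U"
      by (rule compact_subset_open_imp_ball_epsilon_subset[OF Y(1) U])
    define \<epsilon> where "\<epsilon> = e / sqrt CARD('n)"
    have \<epsilon>: "0 < \<epsilon>" using e by (simp add: \<epsilon>_def)
    have sub: "x \<in> U" if "d x < \<epsilon>" for x
    proof -
      obtain y where y: "y \<in> Y" "norm (x - y) \<le> sqrt CARD('n) * d x" using maxdist_attained[OF Y(1,2)] by blast
      have "sqrt CARD('n) * d x < e" using that by (simp add: \<epsilon>_def field_simps)
      then have "x \<in> ball y e" using y by (simp add: dist_norm norm_minus_commute)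
      then show ?thesis using e y by blast
    qed
    obtain \<delta> where \<delta>: "0 < \<delta>" "\<And>x t. d x < \<delta> \<Longrightarrow> 0 \<le> t \<Longrightarrow> d (\<Phi> t x) < \<epsilon>" using attr[OF \<epsilon>] by blast
    then have "\<forall>x\<in>{x. d x < \<delta>}. \<forall>\<tau>>0. \<Phi> \<tau> x \<in> U" using sub by simp
    then show "\<exists>V. open V \<and> Y \<subseteq> V \<and> (\<forall>x\<in>V. \<forall>\<tau>>0. \<Phi> \<tau> x \<in> U)" using nbhd[OF \<delta>(1)] by blast
  next
    obtain \<delta> where \<delta>: "0 < \<delta>" "\<And>x. d x < \<delta> \<Longrightarrow> ((\<lambda>t. d (\<Phi> t x)) \<longlongrightarrow> 0) at_top" using attr[OF zero_less_one] by blast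
    then have "\<forall>x\<in>{x. d x < \<delta>}. ((\<lambda>\<tau>. d (\<Phi> \<tau> x)) \<longlongrightarrow> 0) at_top" by simp
    then show "\<exists>V. open V \<and> Y \<subseteq> V \<and> (\<forall>x\<in>V. ((\<lambda>\<tau>. maxdist (\<Phi> \<tau> x) Y) \<longlongrightarrow> 0) at_top)" using nbhd[OF \<delta>(1)] by blast
  qed
qed

end

theorem theorem4p19:
  fixes f :: "real^'n \<Rightarrow> real^'n"
    and \<Phi> :: "real \<Rightarrow> real^'n \<Rightarrow> real^'n"
    and Y :: "(real^'n) set"
    and E :: "real^'n \<Rightarrow> complex^'n^'n"
  assumes "smooth f"
    and "flow_of f \<Phi>"
    and "heteroclinic_network f \<Phi> Y"
    and "robust f \<Phi> Y"
    and "clean \<Phi> Y"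
    and "\<And>\<xi>. \<xi> \<in> Y \<Longrightarrow> equilibrium f \<xi> \<Longrightarrow> eigenbasis f \<xi> (E \<xi>)"
  shows "\<forall>\<^sub>F r in at_right 0.
    (\<forall>P. closed_walk f \<Phi> Y P \<and> semi_linear P \<longrightarrow>
       (\<exists>A \<rho>. (\<forall>j<length P. A j > 0 \<and> \<rho> j > 0 \<and> local_map_bound \<Phi> E r Y P j (A j) (\<rho> j)) \<and>
              (\<Prod>j<length P. \<rho> j) > 1))
    \<longrightarrow> asymptotically_stable \<Phi> Y"
proof -
  have cl: "compact Y" "invariant \<Phi> Y" "\<And>X. X \<subseteq> Y \<Longrightarrow> invariant \<Phi> X \<Longrightarrow> unstable_set \<Phi> X \<subseteq> Y"
    using assms(5) by (auto simp: clean_def)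
  obtain \<C> where C: "finite \<C>" "\<C> \<noteq> {}" "\<And>X. X \<in> \<C> \<Longrightarrow> heteroclinic_cycle f \<Phi> X" "Y = \<Union>\<C>"
    using assms(3) unfolding heteroclinic_network_def by blast
  define is_walk where "is_walk X P \<longleftrightarrow> P \<noteq> [] \<and> (\<forall>\<xi>\<in>set P. hyperbolic f \<xi>) \<and>
     (\<forall>j<length P. connected_to \<Phi> (P ! j) (cyc_nth P (j + 1))) \<and>
     X = set P \<union> (\<Union>j<length P. connection \<Phi> (P ! j) (cyc_nth P (j + 1)))" for X P
  have "\<forall>X\<in>\<C>. \<exists>P. is_walk X P" using C(3) unfolding heteroclinic_cycle_def is_walk_def by (rule ballI)
  then obtain W where W': "\<forall>X\<in>\<C>. is_walk X (W X)" by (rule bchoice[THEN exE])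
  have W: "W X \<noteq> []" "\<And>\<xi>. \<xi> \<in> set (W X) \<Longrightarrow> hyperbolic f \<xi>"
    "\<And>j. j < length (W X) \<Longrightarrow> connected_to \<Phi> (W X ! j) (cyc_nth (W X) (j + 1))"
    "X = set (W X) \<union> (\<Union>j<length (W X). connection \<Phi> (W X ! j) (cyc_nth (W X) (j + 1)))" if "X \<in> \<C>" for X
    using bspec[OF W' that] unfolding is_walk_def by blast+
  define Q where "Q = (\<Union>X\<in>\<C>. set (W X))"
  have finQ: "finite Q" using C(1) by (simp add: Q_def)
  have QY: "Q \<subseteq> Y" using W(4) unfolding Q_def C(4) by blast
  have hyp: "hyperbolic f c" if "c \<in> Q" for c using that W(2) unfolding Q_def by blast
  then have eq: "equilibrium f c" if "c \<in> Q" for c using that by (auto simp: hyperbolic_def)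
  have basis: "eigenbasis f c (E c)" if "c \<in> Q" for c using assms(6) eq QY that by blast
  have inv: "invertible (E c)" if "c \<in> Q" for c using basis[OF that] by (simp add: eigenbasis_def)
  have fixed: "\<Phi> t c = c" if "equilibrium f c" for t c
    using solves_unique[OF assms(1) flow_solves[OF assms(2), of c] solves_const[of f c], of t] that flow_zero[OF assms(2)]
    by (simp add: equilibrium_def)
  \<comment> \<open>An equilibrium is a point of its own connection \<open>connection \<Phi> c c\<close>.\<close>
  have fixed_unstable: "c \<in> unstable_set \<Phi> {c}" if "equilibrium f c" for c
    by (rule tendsto_bot_unstable) (simp add: fixed[OF that])
  have fixed_stable: "c \<in> stable_set \<Phi> {c}" if "equilibrium f c" for c
    by (rule tendsto_top_stable) (simp add: fixed[OF that])
  have unique_source: "a = a'" if "x \<in> unstable_set \<Phi> {a}" "x \<in> unstable_set \<Phi> {a'}" for x a a'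
    using that unfolding unstable_set_def by blast
  have unique_target: "a = a'" if "x \<in> stable_set \<Phi> {a}" "x \<in> stable_set \<Phi> {a'}" for x a a'
    using that unfolding stable_set_def by blast
  have unstable_Y: "unstable_set \<Phi> {c} \<subseteq> Y" if "c \<in> Q" for c
    using that QY fixed[OF eq[OF that]] by (intro cl(3)) (auto simp: invariant_def)
  have cyc_mem: "W X ! j \<in> Q" "cyc_nth (W X) (j + 1) \<in> Q" if "X \<in> \<C>" "j < length (W X)" for X j
  proof -
    have "W X ! j \<in> set (W X)" "cyc_nth (W X) (j + 1) \<in> set (W X)"
      using that(2) W(1)[OF that(1)] by (simp_all add: cyc_nth_def)
    then show "W X ! j \<in> Q" "cyc_nth (W X) (j + 1) \<in> Q" using that(1) unfolding Q_def by blast+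
  qed
  have edge: "connection_in f \<Phi> Y (W X ! j) (cyc_nth (W X) (j + 1))" if "X \<in> \<C>" "j < length (W X)" for X j
  proof -
    have "connection \<Phi> (W X ! j) (cyc_nth (W X) (j + 1)) \<subseteq> Y"
      using unstable_Y[OF cyc_mem(1)[OF that]] unfolding connection_def by blast
    moreover have "W X ! j \<in> Y" "cyc_nth (W X) (j + 1) \<in> Y" using cyc_mem[OF that] QY by blast+
    ultimately show ?thesis
      using W(3)[OF that] eq[OF cyc_mem(1)[OF that]] eq[OF cyc_mem(2)[OF that]] by (simp add: connection_in_def)
  qed
  have cases_Y: "y \<in> Q \<or> (\<exists>X\<in>\<C>. \<exists>j<length (W X). y \<in> connection \<Phi> (W X ! j) (cyc_nth (W X) (j + 1)))"
    if "y \<in> Y" for y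
  proof -
    obtain X where X: "X \<in> \<C>" "y \<in> X" using C(4) \<open>y \<in> Y\<close> by blast
    then have "y \<in> set (W X) \<union> (\<Union>j<length (W X). connection \<Phi> (W X ! j) (cyc_nth (W X) (j + 1)))"
      using W(4)[OF X(1)] by simp
    then show ?thesis using X(1) unfolding Q_def by blast
  qed
  have Y_connections: "\<exists>a\<in>Q. \<exists>b\<in>Q. y \<in> connection \<Phi> a b" if "y \<in> Y" for y
    using cases_Y[OF that]
  proof
    assume "y \<in> Q"
    then show ?thesis using fixed_unstable fixed_stable eq unfolding connection_def by blast
  next
    assume "\<exists>X\<in>\<C>. \<exists>j<length (W X). y \<in> connection \<Phi> (W X ! j) (cyc_nth (W X) (j + 1))"
    then show ?thesis using cyc_mem by blast
  qed
  have on_cycle: "\<exists>P j. j < length P \<and> (\<forall>i<length P. connection_in f \<Phi> Y (P ! i) (cyc_nth P (i + 1))) \<and>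
      P ! j = a \<and> cyc_nth P (j + 1) = c" if ac: "connection_in f \<Phi> Y a c" for a c
  proof -
    obtain x where x: "x \<in> connection \<Phi> a c" "x \<noteq> a" "x \<in> Y"
      using ac unfolding connection_in_def connected_to_def by blast
    \<comment> \<open>A point of the connection other than its source is not an equilibrium.\<close>
    have "x \<notin> Q" using x fixed_unstable[OF eq] unique_source unfolding connection_def by blast
    then obtain X j where X: "X \<in> \<C>" "j < length (W X)" "x \<in> connection \<Phi> (W X ! j) (cyc_nth (W X) (j + 1))"
      using cases_Y[OF x(3)] by blast
    have "W X ! j = a" using X(3) x(1) unfolding connection_def by (intro unique_source) auto
    moreover have "cyc_nth (W X) (j + 1) = c" using X(3) x(1) unfolding connection_def by (intro unique_target) auto
    ultimately show ?thesis using X(2) edge[OF X(1)] by blast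
  qed
  \<comment> \<open>Half the distance to the other equilibria keeps the boxes disjoint.\<close>
  define isolating where "isolating c \<epsilon> \<longleftrightarrow> 0 < \<epsilon> \<and> (\<forall>c'\<in>Q. c' \<noteq> c \<longrightarrow> 2 * \<epsilon> \<le> dist c c') \<and>
      (\<forall>u K t0. solves f u \<and> compact K \<and> K \<subseteq> ball c \<epsilon> \<longrightarrow>
        ((\<forall>t\<ge>t0. u t \<in> K) \<longrightarrow> (u \<longlongrightarrow> c) at_top) \<and> ((\<forall>t\<le>t0. u t \<in> K) \<longrightarrow> (u \<longlongrightarrow> c) at_bot))" for c \<epsilon>
  have "\<exists>\<epsilon>. isolating c \<epsilon>" if c: "c \<in> Q" for c
  proof -
    obtain \<epsilon>1 where \<epsilon>1: "0 < \<epsilon>1"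
      "\<And>u K t0. solves f u \<Longrightarrow> compact K \<Longrightarrow> K \<subseteq> ball c \<epsilon>1 \<Longrightarrow> (\<And>t. t0 \<le> t \<Longrightarrow> u t \<in> K) \<Longrightarrow> (u \<longlongrightarrow> c) at_top"
      "\<And>u K t0. solves f u \<Longrightarrow> compact K \<Longrightarrow> K \<subseteq> ball c \<epsilon>1 \<Longrightarrow> (\<And>t. t \<le> t0 \<Longrightarrow> u t \<in> K) \<Longrightarrow> (u \<longlongrightarrow> c) at_bot"
      using hyperbolic_isolated[OF assms(1) hyp[OF c] basis[OF c]] by metis
    obtain \<epsilon>2 where \<epsilon>2: "0 < \<epsilon>2" "\<And>x. x \<in> Q \<Longrightarrow> x \<noteq> c \<Longrightarrow> \<epsilon>2 \<le> dist c x" using finite_set_avoid[OF finQ, of c] by blast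
    define \<epsilon> where "\<epsilon> = min \<epsilon>1 (\<epsilon>2 / 2)"
    have sub: "ball c \<epsilon> \<subseteq> ball c \<epsilon>1" by (rule subset_ball) (simp add: \<epsilon>_def)
    have "2 * \<epsilon> \<le> dist c c'" if "c' \<in> Q" "c' \<noteq> c" for c'
      using \<epsilon>2(2)[OF that] by (simp add: \<epsilon>_def)
    moreover have "0 < \<epsilon>" using \<epsilon>1 \<epsilon>2 by (simp add: \<epsilon>_def)
    moreover have "(u \<longlongrightarrow> c) at_top" if "solves f u" "compact K" "K \<subseteq> ball c \<epsilon>" "\<forall>t\<ge>t0. u t \<in> K" for u K t0
      by (rule \<epsilon>1(2)[OF that(1,2), of t0]) (use that sub in auto)
    moreover have "(u \<longlongrightarrow> c) at_bot" if "solves f u" "compact K" "K \<subseteq> ball c \<epsilon>" "\<forall>t\<le>t0. u t \<in> K" for u K t0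
      by (rule \<epsilon>1(3)[OF that(1,2), of t0]) (use that sub in auto)
    ultimately show ?thesis unfolding isolating_def by (intro exI[of _ \<epsilon>]) blast
  qed
  then obtain \<epsilon> where iso: "\<And>c. c \<in> Q \<Longrightarrow> isolating c (\<epsilon> c)" by metis
  have \<epsilon>: "0 < \<epsilon> c" "c' \<in> Q \<Longrightarrow> c' \<noteq> c \<Longrightarrow> 2 * \<epsilon> c \<le> dist c c'" if "c \<in> Q" for c c'
    using iso[OF that] unfolding isolating_def by blast+
  have "\<forall>\<^sub>F r in at_right 0. \<forall>c\<in>Q. closed_box (E c) c r \<subseteq> ball c (\<epsilon> c)"
    by (intro eventually_ball_finite[OF finQ] ballI closed_box_small inv \<epsilon>(1))
  moreover have "\<forall>\<^sub>F r::real in at_right 0. 0 < r" by (rule eventually_at_right_less)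
  ultimately show ?thesis
  proof eventually_elim
    fix r :: real assume small: "\<forall>c\<in>Q. closed_box (E c) c r \<subseteq> ball c (\<epsilon> c)" and r: "0 < r"
    interpret heteroclinic_dynamics f \<Phi> Y Q E r
    proof
      obtain X where "X \<in> \<C>" using C(2) by blast
      then show "Y \<noteq> {}" using W(1)[of X] QY unfolding Q_def by (cases "W X") auto
    next
      fix c d assume cd: "c \<in> Q" "d \<in> Q" "c \<noteq> d"
      show "closed_box (E c) c r \<inter> closed_box (E d) d r = {}"
      proof (rule ccontr)
        assume "\<not> ?thesis"
        then obtain z where "z \<in> ball c (\<epsilon> c)" "z \<in> ball d (\<epsilon> d)" using small cd by blast
        then have "dist c d < \<epsilon> c + \<epsilon> d"
          using dist_triangle[of c d z] by (simp add: dist_commute)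
        then show False using \<epsilon>(2)[of c d] \<epsilon>(2)[of d c] cd by (simp add: dist_commute)
      qed
    next
      fix c u t0 assume c: "c \<in> Q" "solves f u"
      have K: "compact (closed_box (E c) c r)" "closed_box (E c) c r \<subseteq> ball c (\<epsilon> c)"
        using compact_closed_box[OF inv[OF c(1)]] small c by auto
      show "(u \<longlongrightarrow> c) at_top" if "\<And>t. t0 \<le> t \<Longrightarrow> u t \<in> closed_box (E c) c r"
        using iso[OF c(1)] c(2) K that unfolding isolating_def by blast
      show "(u \<longlongrightarrow> c) at_bot" if "\<And>t. t \<le> t0 \<Longrightarrow> u t \<in> closed_box (E c) c r"
        using iso[OF c(1)] c(2) K that unfolding isolating_def by blast
    qed (fact assms(1,2) cl(1,2) finQ QY eq Y_connections unstable_Y basis r)+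
    show "(\<forall>P. closed_walk f \<Phi> Y P \<and> semi_linear P \<longrightarrow>
       (\<exists>A \<rho>. (\<forall>j<length P. A j > 0 \<and> \<rho> j > 0 \<and> local_map_bound \<Phi> E r Y P j (A j) (\<rho> j)) \<and>
              (\<Prod>j<length P. \<rho> j) > 1)) \<longrightarrow> asymptotically_stable \<Phi> Y"
    proof (intro impI asymptotically_stable_if_contracting)
      fix a c assume "(a, c) \<in> edges"
      then show "\<exists>P j. j < length P \<and> (\<forall>i<length P. (P ! i, cyc_nth P (i + 1)) \<in> edges) \<and> P ! j = a \<and> cyc_nth P (j + 1) = c"
        using on_cycle[of a c] by (simp add: edges_def)
    qed blast
  qed
qed

end
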